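(* Let $(\mathcal C_i)_{i\in I}$ be a family of (small) neutral tannakian categories, $\mathcal C_i$ being over the field $k_i=\mathrm{End}(\underline 1_i)$ with fibre functor $\omega_i$, and let $\mathcal U$ be a non-principal ultrafilter on $I$. Then the restricted ultraproduct $\prod_R\mathcal C_i$ is a tannakian category, neutralized over the field $k=\prod_{\mathcal U}k_i$ by the functor $\omega:\prod_R\mathcal C_i\to\mathrm{Vec}_k$ defined by $\omega([X_i])=\prod_{\mathcal U}\omega_i(X_i)$ and $\omega([\phi_i])=[\omega_i(\phi_i)]$.
   Context: A tannakian category is a rigid abelian tensor category (abelian category with a bi-additive tensor product that is associative, commutative and unital up to coherent natural isomorphisms assoc, comm, unit, with all internal Homs $\underline{\mathrm{Hom}}(X,Y)$ existing, all objects reflexive, and all canonical maps $\underline{\mathrm{Hom}}(X_1,Y_1)\otimes\underline{\mathrm{Hom}}(X_2,Y_2)\to\underline{\mathrm{Hom}}(X_1\otimes X_2,Y_1\otimes Y_2)$ isomorphisms) such that $\mathrm{End}(\underline1)$ is a field, where $\underline 1$ is the identity object. Such a category is linear over $k=\mathrm{End}(\underline1)$. A fibre functor on it is an exact, faithful, $k$-linear tensor functor to $\mathrm{Vec}_k$, the category of finite dimensional $k$-vector spaces. A neutral tannakian category is a tannakian category equipped with a fibre functor; a functor "neutralizes" a tannakian category if it is a fibre functor on it. The ultraproduct $\prod_{\mathcal U}\mathcal C_i$ is the ultraproduct with respect to $\mathcal U$ of the $\mathcal C_i$, regarded as relational structures: its objects (morphisms) are the classes $[X_i]$ (resp. $[\phi_i]$)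 of tuples of objects (morphisms) modulo equality on a set in $\mathcal U$, with $[\phi_i]:[X_i]\to[Y_i]$ iff $\phi_i:X_i\to Y_i$ for almost every $i$ (i.e. on a set in $\mathcal U$), and composition, addition, tensor product, assoc, comm, unit are all defined componentwise. The restricted ultraproduct $\prod_R\mathcal C_i$ is the full subcategory of $\prod_{\mathcal U}\mathcal C_i$ consisting of the objects $[X_i]$ such that $\dim_{k_i}\omega_i(X_i)$ is bounded for almost every $i$ (there is $n$ with $\dim\omega_i(X_i)\le n$ on a set in $\mathcal U$). For vector spaces $V_i$ over $k_i$, $\prod_{\mathcal U}V_i$ is the ultraproduct, a vector space over $\prod_{\mathcal U}k_i$ with $[a_i][v_i]=[a_iv_i]$; for linear maps $\psi_i:V_i\to W_i$, $[\psi_i]:\prod_{\mathcal U}V_i\to\prod_{\mathcal U}W_i$ is given by $[\psi_i]([v_i])=[\psi_i(v_i)]$. The field $\mathrm{End}([\underline1_i])$ is identified with $\prod_{\mathcal U}k_i$. *)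

theory Defs
  imports "Jordan_Normal_Form.Missing_VectorSpace" "HOL-Algebra.AbelCoset"
begin

section \<open>Abelian categories\<close>

text \<open>
  A small category is given by its set of objects and the relation \<open>f : X \<rightarrow> Y\<close>, written
  \<open>f \<in> Hom C X Y\<close>; the value of \<^term>\<open>Hom\<close> matters only at objects of the category, so a
  full subcategory is obtained by shrinking \<open>Obj\<close>. Composition is in the usual order:
  \<open>g \<cdot> f\<close> is \<open>f\<close> followed by \<open>g\<close>.
\<close>

record ('o, 'm) cat =
  Obj :: "'o set"
  Hom :: "'o \<Rightarrow> 'o \<Rightarrow> 'm set"
  Comp :: "'m \<Rightarrow> 'm \<Rightarrow> 'm"  (infixr \<open>\<cdot>\<index>\<close> 75)
  Id :: "'o \<Rightarrow> 'm"

locale category =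
  fixes C :: "('o, 'm, 'z) cat_scheme" (structure)
  assumes Hom_unique:
      "\<lbrakk>X \<in> Obj C; Y \<in> Obj C; X' \<in> Obj C; Y' \<in> Obj C; f \<in> Hom C X Y; f \<in> Hom C X' Y'\<rbrakk>
        \<Longrightarrow> X = X' \<and> Y = Y'"
    and Comp_closed:
      "\<lbrakk>X \<in> Obj C; Y \<in> Obj C; Z \<in> Obj C; f \<in> Hom C X Y; g \<in> Hom C Y Z\<rbrakk> \<Longrightarrow> g \<cdot> f \<in> Hom C X Z"
    and Id_closed: "X \<in> Obj C \<Longrightarrow> Id C X \<in> Hom C X X"
    and Comp_Id: "\<lbrakk>X \<in> Obj C; Y \<in> Obj C; f \<in> Hom C X Y\<rbrakk> \<Longrightarrow> f \<cdot> Id C X = f"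
    and Id_Comp: "\<lbrakk>X \<in> Obj C; Y \<in> Obj C; f \<in> Hom C X Y\<rbrakk> \<Longrightarrow> Id C Y \<cdot> f = f"
    and Comp_assoc:
      "\<lbrakk>X \<in> Obj C; Y \<in> Obj C; Z \<in> Obj C; T \<in> Obj C;
        f \<in> Hom C X Y; g \<in> Hom C Y Z; h \<in> Hom C Z T\<rbrakk> \<Longrightarrow> (h \<cdot> g) \<cdot> f = h \<cdot> (g \<cdot> f)"

definition is_inverse :: "('o, 'm, 'z) cat_scheme \<Rightarrow> 'o \<Rightarrow> 'o \<Rightarrow> 'm \<Rightarrow> 'm \<Rightarrow> bool" where
  "is_inverse C X Y f g \<longleftrightarrow>
     g \<in> Hom C Y X \<and> g \<cdot>\<^bsub>C\<^esub> f = Id C X \<and> f \<cdot>\<^bsub>C\<^esub> g = Id C Y"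

definition is_iso :: "('o, 'm, 'z) cat_scheme \<Rightarrow> 'o \<Rightarrow> 'o \<Rightarrow> 'm \<Rightarrow> bool" where
  "is_iso C X Y f \<longleftrightarrow> f \<in> Hom C X Y \<and> (\<exists>g. is_inverse C X Y f g)"

definition inverse_arr :: "('o, 'm, 'z) cat_scheme \<Rightarrow> 'o \<Rightarrow> 'o \<Rightarrow> 'm \<Rightarrow> 'm" where
  "inverse_arr C X Y f = (THE g. is_inverse C X Y f g)"

definition is_mono :: "('o, 'm, 'z) cat_scheme \<Rightarrow> 'o \<Rightarrow> 'o \<Rightarrow> 'm \<Rightarrow> bool" where
  "is_mono C X Y f \<longleftrightarrow> f \<in> Hom C X Y \<and>
     (\<forall>T\<in>Obj C. \<forall>g\<in>Hom C T X. \<forall>h\<in>Hom C T X. f \<cdot>\<^bsub>C\<^esub> g = f \<cdot>\<^bsub>C\<^esub> h \<longrightarrow> g = h)"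

definition is_epi :: "('o, 'm, 'z) cat_scheme \<Rightarrow> 'o \<Rightarrow> 'o \<Rightarrow> 'm \<Rightarrow> bool" where
  "is_epi C X Y f \<longleftrightarrow> f \<in> Hom C X Y \<and>
     (\<forall>T\<in>Obj C. \<forall>g\<in>Hom C Y T. \<forall>h\<in>Hom C Y T. g \<cdot>\<^bsub>C\<^esub> f = h \<cdot>\<^bsub>C\<^esub> f \<longrightarrow> g = h)"

record ('o, 'm) preadd_cat = "('o, 'm) cat" +
  Add :: "'m \<Rightarrow> 'm \<Rightarrow> 'm"  (infixl \<open>\<boxplus>\<index>\<close> 65)
  Zero :: "'o \<Rightarrow> 'o \<Rightarrow> 'm"

locale preadditive_category = category C
  for C :: "('o, 'm, 'z) preadd_cat_scheme" (structure) +
  assumes Hom_comm_group: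
      "\<lbrakk>X \<in> Obj C; Y \<in> Obj C\<rbrakk>
        \<Longrightarrow> comm_group \<lparr>carrier = Hom C X Y, monoid.mult = Add C, one = Zero C X Y\<rparr>"
    and Comp_Add:
      "\<lbrakk>X \<in> Obj C; Y \<in> Obj C; Z \<in> Obj C; f \<in> Hom C X Y; f' \<in> Hom C X Y; g \<in> Hom C Y Z\<rbrakk>
        \<Longrightarrow> g \<cdot> (f \<boxplus> f') = (g \<cdot> f) \<boxplus> (g \<cdot> f')"
    and Add_Comp:
      "\<lbrakk>X \<in> Obj C; Y \<in> Obj C; Z \<in> Obj C; f \<in> Hom C X Y; g \<in> Hom C Y Z; g' \<in> Hom C Y Z\<rbrakk>
        \<Longrightarrow> (g \<boxplus> g') \<cdot> f = (g \<cdot> f) \<boxplus> (g' \<cdot> f)"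

definition is_kernel ::
  "('o, 'm, 'z) preadd_cat_scheme \<Rightarrow> 'o \<Rightarrow> 'o \<Rightarrow> 'm \<Rightarrow> 'o \<Rightarrow> 'm \<Rightarrow> bool" where
  "is_kernel C X Y f K k \<longleftrightarrow>
     f \<in> Hom C X Y \<and> K \<in> Obj C \<and> k \<in> Hom C K X \<and> f \<cdot>\<^bsub>C\<^esub> k = Zero C K Y \<and>
     (\<forall>T\<in>Obj C. \<forall>g\<in>Hom C T X. f \<cdot>\<^bsub>C\<^esub> g = Zero C T Y
        \<longrightarrow> (\<exists>!h. h \<in> Hom C T K \<and> k \<cdot>\<^bsub>C\<^esub> h = g))"

definition is_cokernel ::
  "('o, 'm, 'z) preadd_cat_scheme \<Rightarrow> 'o \<Rightarrow> 'o \<Rightarrow> 'm \<Rightarrow> 'o \<Rightarrow> 'm \<Rightarrow> bool" where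
  "is_cokernel C X Y f Q q \<longleftrightarrow>
     f \<in> Hom C X Y \<and> Q \<in> Obj C \<and> q \<in> Hom C Y Q \<and> q \<cdot>\<^bsub>C\<^esub> f = Zero C X Q \<and>
     (\<forall>T\<in>Obj C. \<forall>g\<in>Hom C Y T. g \<cdot>\<^bsub>C\<^esub> f = Zero C X T
        \<longrightarrow> (\<exists>!h. h \<in> Hom C Q T \<and> h \<cdot>\<^bsub>C\<^esub> q = g))"

definition short_exact ::
  "('o, 'm, 'z) preadd_cat_scheme \<Rightarrow> 'o \<Rightarrow> 'o \<Rightarrow> 'o \<Rightarrow> 'm \<Rightarrow> 'm \<Rightarrow> bool" where
  "short_exact C X Y Z f g \<longleftrightarrow> is_kernel C Y Z g X f \<and> is_cokernel C X Y f Z g"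

locale abelian_category = preadditive_category C
  for C :: "('o, 'm, 'z) preadd_cat_scheme" (structure) +
  assumes zero_object:
      "\<exists>N\<in>Obj C. \<forall>X\<in>Obj C. (\<exists>!f. f \<in> Hom C X N) \<and> (\<exists>!f. f \<in> Hom C N X)"
    and biproduct:
      "\<lbrakk>X \<in> Obj C; Y \<in> Obj C\<rbrakk>
        \<Longrightarrow> \<exists>P\<in>Obj C. \<exists>i\<in>Hom C X P. \<exists>j\<in>Hom C Y P. \<exists>p\<in>Hom C P X. \<exists>q\<in>Hom C P Y.
              p \<cdot> i = Id C X \<and> q \<cdot> j = Id C Y \<and> p \<cdot> j = Zero C Y X \<and> q \<cdot> i = Zero C X Y \<and>
              (i \<cdot> p) \<boxplus> (j \<cdot> q) = Id C P"
    and kernel_exists: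
      "\<lbrakk>X \<in> Obj C; Y \<in> Obj C; f \<in> Hom C X Y\<rbrakk> \<Longrightarrow> \<exists>K k. is_kernel C X Y f K k"
    and cokernel_exists:
      "\<lbrakk>X \<in> Obj C; Y \<in> Obj C; f \<in> Hom C X Y\<rbrakk> \<Longrightarrow> \<exists>Q q. is_cokernel C X Y f Q q"
    and mono_is_kernel:
      "\<lbrakk>X \<in> Obj C; Y \<in> Obj C; is_mono C X Y f\<rbrakk> \<Longrightarrow> \<exists>Z\<in>Obj C. \<exists>g. is_kernel C Y Z g X f"
    and epi_is_cokernel:
      "\<lbrakk>X \<in> Obj C; Y \<in> Obj C; is_epi C X Y f\<rbrakk> \<Longrightarrow> \<exists>Z\<in>Obj C. \<exists>g. is_cokernel C Z X g Y f"


section \<open>Tannakian categories\<close>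

text \<open>
  Directions of the constraints:
  \<open>Assoc C X Y Z : X \<otimes> (Y \<otimes> Z) \<rightarrow> (X \<otimes> Y) \<otimes> Z\<close>, \<open>Comm C X Y : X \<otimes> Y \<rightarrow> Y \<otimes> X\<close> and
  \<open>UnitIso C X : X \<rightarrow> \<one> \<otimes> X\<close>.
\<close>

record ('o, 'm) tensor_cat = "('o, 'm) preadd_cat" +
  Tensor :: "'o \<Rightarrow> 'o \<Rightarrow> 'o"  (infixl \<open>\<otimes>\<^sub>o\<index>\<close> 80)
  TensorArr :: "'m \<Rightarrow> 'm \<Rightarrow> 'm"  (infixl \<open>\<otimes>\<^sub>m\<index>\<close> 80)
  UnitObj :: "'o"
  Assoc :: "'o \<Rightarrow> 'o \<Rightarrow> 'o \<Rightarrow> 'm"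
  Comm :: "'o \<Rightarrow> 'o \<Rightarrow> 'm"
  UnitIso :: "'o \<Rightarrow> 'm"

locale abelian_tensor_category = abelian_category C
  for C :: "('o, 'm, 'z) tensor_cat_scheme" (structure) +
  assumes Tensor_closed: "\<lbrakk>X \<in> Obj C; Y \<in> Obj C\<rbrakk> \<Longrightarrow> X \<otimes>\<^sub>o Y \<in> Obj C"
    and UnitObj_closed: "UnitObj C \<in> Obj C"
    and TensorArr_closed:
      "\<lbrakk>X \<in> Obj C; Y \<in> Obj C; X' \<in> Obj C; Y' \<in> Obj C; f \<in> Hom C X X'; g \<in> Hom C Y Y'\<rbrakk>
        \<Longrightarrow> f \<otimes>\<^sub>m g \<in> Hom C (X \<otimes>\<^sub>o Y) (X' \<otimes>\<^sub>o Y')"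
    and TensorArr_Id:
      "\<lbrakk>X \<in> Obj C; Y \<in> Obj C\<rbrakk> \<Longrightarrow> Id C X \<otimes>\<^sub>m Id C Y = Id C (X \<otimes>\<^sub>o Y)"
    and TensorArr_Comp:
      "\<lbrakk>X \<in> Obj C; X' \<in> Obj C; X'' \<in> Obj C; Y \<in> Obj C; Y' \<in> Obj C; Y'' \<in> Obj C;
        f \<in> Hom C X X'; f' \<in> Hom C X' X''; g \<in> Hom C Y Y'; g' \<in> Hom C Y' Y''\<rbrakk>
        \<Longrightarrow> (f' \<cdot> f) \<otimes>\<^sub>m (g' \<cdot> g) = (f' \<otimes>\<^sub>m g') \<cdot> (f \<otimes>\<^sub>m g)"
    and Add_TensorArr:
      "\<lbrakk>X \<in> Obj C; X' \<in> Obj C; Y \<in> Obj C; Y' \<in> Obj C;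
        f \<in> Hom C X X'; f' \<in> Hom C X X'; g \<in> Hom C Y Y'\<rbrakk>
        \<Longrightarrow> (f \<boxplus> f') \<otimes>\<^sub>m g = (f \<otimes>\<^sub>m g) \<boxplus> (f' \<otimes>\<^sub>m g)"
    and TensorArr_Add:
      "\<lbrakk>X \<in> Obj C; X' \<in> Obj C; Y \<in> Obj C; Y' \<in> Obj C;
        f \<in> Hom C X X'; g \<in> Hom C Y Y'; g' \<in> Hom C Y Y'\<rbrakk>
        \<Longrightarrow> f \<otimes>\<^sub>m (g \<boxplus> g') = (f \<otimes>\<^sub>m g) \<boxplus> (f \<otimes>\<^sub>m g')"
    and Assoc_iso:
      "\<lbrakk>X \<in> Obj C; Y \<in> Obj C; Z \<in> Obj C\<rbrakk>
        \<Longrightarrow> is_iso C (X \<otimes>\<^sub>o (Y \<otimes>\<^sub>o Z)) ((X \<otimes>\<^sub>o Y) \<otimes>\<^sub>o Z) (Assoc C X Y Z)"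
    and Assoc_natural:
      "\<lbrakk>X \<in> Obj C; X' \<in> Obj C; Y \<in> Obj C; Y' \<in> Obj C; Z \<in> Obj C; Z' \<in> Obj C;
        f \<in> Hom C X X'; g \<in> Hom C Y Y'; h \<in> Hom C Z Z'\<rbrakk>
        \<Longrightarrow> Assoc C X' Y' Z' \<cdot> (f \<otimes>\<^sub>m (g \<otimes>\<^sub>m h)) = ((f \<otimes>\<^sub>m g) \<otimes>\<^sub>m h) \<cdot> Assoc C X Y Z"
    and Comm_iso:
      "\<lbrakk>X \<in> Obj C; Y \<in> Obj C\<rbrakk> \<Longrightarrow> is_iso C (X \<otimes>\<^sub>o Y) (Y \<otimes>\<^sub>o X) (Comm C X Y)"
    and Comm_natural:
      "\<lbrakk>X \<in> Obj C; X' \<in> Obj C; Y \<in> Obj C; Y' \<in> Obj C; f \<in> Hom C X X'; g \<in> Hom C Y Y'\<rbrakk>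
        \<Longrightarrow> Comm C X' Y' \<cdot> (f \<otimes>\<^sub>m g) = (g \<otimes>\<^sub>m f) \<cdot> Comm C X Y"
    and UnitIso_iso:
      "X \<in> Obj C \<Longrightarrow> is_iso C X (UnitObj C \<otimes>\<^sub>o X) (UnitIso C X)"
    and UnitIso_natural:
      "\<lbrakk>X \<in> Obj C; X' \<in> Obj C; f \<in> Hom C X X'\<rbrakk>
        \<Longrightarrow> UnitIso C X' \<cdot> f = (Id C (UnitObj C) \<otimes>\<^sub>m f) \<cdot> UnitIso C X"
    and pentagon:
      "\<lbrakk>X \<in> Obj C; Y \<in> Obj C; Z \<in> Obj C; T \<in> Obj C\<rbrakk>
        \<Longrightarrow> Assoc C (X \<otimes>\<^sub>o Y) Z T \<cdot> Assoc C X Y (Z \<otimes>\<^sub>o T)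
           = (Assoc C X Y Z \<otimes>\<^sub>m Id C T) \<cdot> Assoc C X (Y \<otimes>\<^sub>o Z) T \<cdot> (Id C X \<otimes>\<^sub>m Assoc C Y Z T)"
    and symmetry:
      "\<lbrakk>X \<in> Obj C; Y \<in> Obj C\<rbrakk> \<Longrightarrow> Comm C Y X \<cdot> Comm C X Y = Id C (X \<otimes>\<^sub>o Y)"
    and hexagon:
      "\<lbrakk>X \<in> Obj C; Y \<in> Obj C; Z \<in> Obj C\<rbrakk>
        \<Longrightarrow> Assoc C Z X Y \<cdot> Comm C (X \<otimes>\<^sub>o Y) Z \<cdot> Assoc C X Y Z
           = (Comm C X Z \<otimes>\<^sub>m Id C Y) \<cdot> Assoc C X Z Y \<cdot> (Id C X \<otimes>\<^sub>m Comm C Y Z)"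
    and triangle:
      "\<lbrakk>X \<in> Obj C; Y \<in> Obj C\<rbrakk>
        \<Longrightarrow> Assoc C X (UnitObj C) Y \<cdot> (Id C X \<otimes>\<^sub>m UnitIso C Y)
           = (Comm C (UnitObj C) X \<cdot> UnitIso C X) \<otimes>\<^sub>m Id C Y"

text \<open>
  \<open>(H, e)\<close> represents the functor \<open>T \<mapsto> Hom (T \<otimes> X, Y)\<close>, with evaluation \<open>e : H \<otimes> X \<rightarrow> Y\<close>.
\<close>

definition is_internal_hom ::
  "('o, 'm, 'z) tensor_cat_scheme \<Rightarrow> 'o \<Rightarrow> 'o \<Rightarrow> 'o \<Rightarrow> 'm \<Rightarrow> bool" where
  "is_internal_hom C X Y H e \<longleftrightarrow>
     H \<in> Obj C \<and> e \<in> Hom C (H \<otimes>\<^sub>o\<^bsub>C\<^esub> X) Y \<and>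
     (\<forall>T\<in>Obj C. \<forall>f\<in>Hom C (T \<otimes>\<^sub>o\<^bsub>C\<^esub> X) Y.
        \<exists>!g. g \<in> Hom C T H \<and> e \<cdot>\<^bsub>C\<^esub> (g \<otimes>\<^sub>m\<^bsub>C\<^esub> Id C X) = f)"

definition transpose_arr ::
  "('o, 'm, 'z) tensor_cat_scheme \<Rightarrow> 'o \<Rightarrow> 'o \<Rightarrow> 'o \<Rightarrow> 'm \<Rightarrow> 'm \<Rightarrow> 'm" where
  "transpose_arr C T X H e f = (THE g. g \<in> Hom C T H \<and> e \<cdot>\<^bsub>C\<^esub> (g \<otimes>\<^sub>m\<^bsub>C\<^esub> Id C X) = f)"

text \<open>
  Internal Homs are unique up to a unique isomorphism compatible with the evaluations, so the
  conditions below do not depend on which internal Homs are taken; they are required for every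
  choice. The canonical map \<open>X \<rightarrow> X\<^sup>\<or>\<^sup>\<or>\<close> is the transpose of
  \<open>X \<otimes> X\<^sup>\<or> \<rightarrow> X\<^sup>\<or> \<otimes> X \<rightarrow> \<one>\<close>.
\<close>

definition reflexive :: "('o, 'm, 'z) tensor_cat_scheme \<Rightarrow> 'o \<Rightarrow> bool" where
  "reflexive C X \<longleftrightarrow>
     (\<forall>D e D' e'. is_internal_hom C X (UnitObj C) D e \<and> is_internal_hom C D (UnitObj C) D' e'
        \<longrightarrow> is_iso C X D' (transpose_arr C X D D' e' (e \<cdot>\<^bsub>C\<^esub> Comm C X D)))"

text \<open>The middle-four interchange \<open>(A \<otimes> B) \<otimes> (X \<otimes> Y) \<rightarrow> (A \<otimes> X) \<otimes> (B \<otimes> Y)\<close>.\<close>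

definition interchange ::
  "('o, 'm, 'z) tensor_cat_scheme \<Rightarrow> 'o \<Rightarrow> 'o \<Rightarrow> 'o \<Rightarrow> 'o \<Rightarrow> 'm" where
  "interchange C A B X Y =
     Assoc C A X (B \<otimes>\<^sub>o\<^bsub>C\<^esub> Y)
     \<cdot>\<^bsub>C\<^esub> (Id C A \<otimes>\<^sub>m\<^bsub>C\<^esub>
           inverse_arr C (X \<otimes>\<^sub>o\<^bsub>C\<^esub> (B \<otimes>\<^sub>o\<^bsub>C\<^esub> Y)) ((X \<otimes>\<^sub>o\<^bsub>C\<^esub> B) \<otimes>\<^sub>o\<^bsub>C\<^esub> Y) (Assoc C X B Y))
     \<cdot>\<^bsub>C\<^esub> (Id C A \<otimes>\<^sub>m\<^bsub>C\<^esub> (Comm C B X \<otimes>\<^sub>m\<^bsub>C\<^esub> Id C Y))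
     \<cdot>\<^bsub>C\<^esub> (Id C A \<otimes>\<^sub>m\<^bsub>C\<^esub> Assoc C B X Y)
     \<cdot>\<^bsub>C\<^esub> inverse_arr C (A \<otimes>\<^sub>o\<^bsub>C\<^esub> (B \<otimes>\<^sub>o\<^bsub>C\<^esub> (X \<otimes>\<^sub>o\<^bsub>C\<^esub> Y)))
          ((A \<otimes>\<^sub>o\<^bsub>C\<^esub> B) \<otimes>\<^sub>o\<^bsub>C\<^esub> (X \<otimes>\<^sub>o\<^bsub>C\<^esub> Y)) (Assoc C A B (X \<otimes>\<^sub>o\<^bsub>C\<^esub> Y))"

locale rigid_abelian_tensor_category = abelian_tensor_category C
  for C :: "('o, 'm, 'z) tensor_cat_scheme" (structure) +
  assumes internal_hom_exists:
      "\<lbrakk>X \<in> Obj C; Y \<in> Obj C\<rbrakk> \<Longrightarrow> \<exists>H e. is_internal_hom C X Y H e"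
    and all_reflexive: "X \<in> Obj C \<Longrightarrow> reflexive C X"
    and internal_hom_tensor:
      "\<lbrakk>X1 \<in> Obj C; Y1 \<in> Obj C; X2 \<in> Obj C; Y2 \<in> Obj C;
        is_internal_hom C X1 Y1 H1 e1; is_internal_hom C X2 Y2 H2 e2;
        is_internal_hom C (X1 \<otimes>\<^sub>o X2) (Y1 \<otimes>\<^sub>o Y2) H e\<rbrakk>
        \<Longrightarrow> is_iso C (H1 \<otimes>\<^sub>o H2) H
              (transpose_arr C (H1 \<otimes>\<^sub>o H2) (X1 \<otimes>\<^sub>o X2) H e
                 ((e1 \<otimes>\<^sub>m e2) \<cdot> interchange C H1 H2 X1 X2))"

definition End_ring :: "('o, 'm, 'z) tensor_cat_scheme \<Rightarrow> 'm ring" where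
  "End_ring C = \<lparr>carrier = Hom C (UnitObj C) (UnitObj C), monoid.mult = Comp C,
     one = Id C (UnitObj C), ring.zero = Zero C (UnitObj C) (UnitObj C), ring.add = Add C\<rparr>"

locale tannakian_category = rigid_abelian_tensor_category C
  for C :: "('o, 'm, 'z) tensor_cat_scheme" (structure) +
  assumes End_field: "field (End_ring C)"

text \<open>The action of \<open>a \<in> End \<one>\<close> on \<open>f : X \<rightarrow> Y\<close> is \<open>X \<cong> \<one> \<otimes> X \<rightarrow> \<one> \<otimes> Y \<cong> Y\<close>.\<close>

definition scale_arr :: "('o, 'm, 'z) tensor_cat_scheme \<Rightarrow> 'o \<Rightarrow> 'o \<Rightarrow> 'm \<Rightarrow> 'm \<Rightarrow> 'm" where
  "scale_arr C X Y a f =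
     inverse_arr C Y (UnitObj C \<otimes>\<^sub>o\<^bsub>C\<^esub> Y) (UnitIso C Y) \<cdot>\<^bsub>C\<^esub> (a \<otimes>\<^sub>m\<^bsub>C\<^esub> f) \<cdot>\<^bsub>C\<^esub> UnitIso C X"


section \<open>Tensor products of vector spaces\<close>

text \<open>
  The \<open>mult\<close> and \<open>one\<close> components of a \<^type>\<open>module\<close> record carry no information; they are
  filled with zeros.
\<close>

definition regular_module :: "('k, 'r) ring_scheme \<Rightarrow> ('k, 'k) module" where
  "regular_module K = \<lparr>carrier = carrier K, monoid.mult = (\<lambda>a b. \<zero>\<^bsub>K\<^esub>), one = \<zero>\<^bsub>K\<^esub>,
     ring.zero = \<zero>\<^bsub>K\<^esub>, ring.add = ring.add K, smult = monoid.mult K\<rparr>"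

definition free_module :: "('k, 'r) ring_scheme \<Rightarrow> 's set \<Rightarrow> ('k, 's \<Rightarrow> 'k) module" where
  "free_module K S = \<lparr>
     carrier = {a. (\<forall>x. a x \<in> carrier K) \<and> (\<forall>x. x \<notin> S \<longrightarrow> a x = \<zero>\<^bsub>K\<^esub>) \<and> finite {x. a x \<noteq> \<zero>\<^bsub>K\<^esub>}},
     monoid.mult = (\<lambda>a b x. \<zero>\<^bsub>K\<^esub>), one = (\<lambda>x. \<zero>\<^bsub>K\<^esub>),
     ring.zero = (\<lambda>x. \<zero>\<^bsub>K\<^esub>), ring.add = (\<lambda>a b x. a x \<oplus>\<^bsub>K\<^esub> b x),
     smult = (\<lambda>c a x. c \<otimes>\<^bsub>K\<^esub> a x)\<rparr>"

definition free_gen :: "('k, 'r) ring_scheme \<Rightarrow> 's \<Rightarrow> 's \<Rightarrow> 'k" where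
  "free_gen K s = (\<lambda>x. if x = s then \<one>\<^bsub>K\<^esub> else \<zero>\<^bsub>K\<^esub>)"

definition quotient_module :: "('k, 'v, 'z) module_scheme \<Rightarrow> 'v set \<Rightarrow> ('k, 'v set) module" where
  "quotient_module M N = \<lparr>carrier = a_rcosets\<^bsub>M\<^esub> N, monoid.mult = (\<lambda>A B. N), one = N,
     ring.zero = N, ring.add = set_add M, smult = (\<lambda>c A. \<Union>x\<in>A. N +>\<^bsub>M\<^esub> (c \<odot>\<^bsub>M\<^esub> x))\<rparr>"

definition bilinear_relations ::
  "('k, 'r) ring_scheme \<Rightarrow> ('k, 'v, 'y) module_scheme \<Rightarrow> ('k, 'w, 'z) module_scheme
     \<Rightarrow> ('v \<times> 'w \<Rightarrow> 'k) set" where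
  "bilinear_relations K V W =
     (let F = free_module K (carrier V \<times> carrier W); d = free_gen K in
       {d (v \<oplus>\<^bsub>V\<^esub> v', w) \<ominus>\<^bsub>F\<^esub> (d (v, w) \<oplus>\<^bsub>F\<^esub> d (v', w)) | v v' w.
          v \<in> carrier V \<and> v' \<in> carrier V \<and> w \<in> carrier W} \<union>
       {d (v, w \<oplus>\<^bsub>W\<^esub> w') \<ominus>\<^bsub>F\<^esub> (d (v, w) \<oplus>\<^bsub>F\<^esub> d (v, w')) | v w w'.
          v \<in> carrier V \<and> w \<in> carrier W \<and> w' \<in> carrier W} \<union>
       {d (a \<odot>\<^bsub>V\<^esub> v, w) \<ominus>\<^bsub>F\<^esub> (a \<odot>\<^bsub>F\<^esub> d (v, w)) | a v w.
          a \<in> carrier K \<and> v \<in> carrier V \<and> w \<in> carrier W} \<union>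
       {d (v, a \<odot>\<^bsub>W\<^esub> w) \<ominus>\<^bsub>F\<^esub> (a \<odot>\<^bsub>F\<^esub> d (v, w)) | a v w.
          a \<in> carrier K \<and> v \<in> carrier V \<and> w \<in> carrier W})"

definition bilinear_submodule ::
  "('k, 'r) ring_scheme \<Rightarrow> ('k, 'v, 'y) module_scheme \<Rightarrow> ('k, 'w, 'z) module_scheme
     \<Rightarrow> ('v \<times> 'w \<Rightarrow> 'k) set" where
  "bilinear_submodule K V W =
     LinearCombinations.module.span K (free_module K (carrier V \<times> carrier W))
       (bilinear_relations K V W)"

definition tensor_module ::
  "('k, 'r) ring_scheme \<Rightarrow> ('k, 'v, 'y) module_scheme \<Rightarrow> ('k, 'w, 'z) module_scheme
     \<Rightarrow> ('k, ('v \<times> 'w \<Rightarrow> 'k) set) module" where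
  "tensor_module K V W =
     quotient_module (free_module K (carrier V \<times> carrier W)) (bilinear_submodule K V W)"

definition pure_tensor ::
  "('k, 'r) ring_scheme \<Rightarrow> ('k, 'v, 'y) module_scheme \<Rightarrow> ('k, 'w, 'z) module_scheme
     \<Rightarrow> 'v \<Rightarrow> 'w \<Rightarrow> ('v \<times> 'w \<Rightarrow> 'k) set" where
  "pure_tensor K V W v w =
     bilinear_submodule K V W +>\<^bsub>free_module K (carrier V \<times> carrier W)\<^esub> free_gen K (v, w)"

definition linear_iso ::
  "('k, 'r) ring_scheme \<Rightarrow> ('k, 'v, 'y) module_scheme \<Rightarrow> ('k, 'w, 'z) module_scheme
     \<Rightarrow> ('v \<Rightarrow> 'w) \<Rightarrow> bool" where
  "linear_iso K V W f \<longleftrightarrow> linear_map K V W f \<and> bij_betw f (carrier V) (carrier W)"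


section \<open>Fibre functors\<close>

text \<open>
  A functor \<open>\<omega>\<close> from \<open>C\<close> to vector spaces over \<open>End \<one>\<close> is given by its object part \<open>W\<close> and its
  arrow part \<open>w\<close>; the map \<open>w f\<close> is only relevant on the carrier of the source space.
\<close>

locale vec_functor = category C
  for C :: "('o, 'm, 'z) tensor_cat_scheme" (structure) +
  fixes W :: "'o \<Rightarrow> ('m, 'v) module" and w :: "'m \<Rightarrow> 'v \<Rightarrow> 'v"
  assumes obj_vectorspace: "X \<in> Obj C \<Longrightarrow> vectorspace (End_ring C) (W X)"
    and obj_fin_dim: "X \<in> Obj C \<Longrightarrow> vectorspace.fin_dim (End_ring C) (W X)"
    and map_linear:
      "\<lbrakk>X \<in> Obj C; Y \<in> Obj C; f \<in> Hom C X Y\<rbrakk> \<Longrightarrow> linear_map (End_ring C) (W X) (W Y) (w f)"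
    and map_Id: "\<lbrakk>X \<in> Obj C; v \<in> carrier (W X)\<rbrakk> \<Longrightarrow> w (Id C X) v = v"
    and map_Comp:
      "\<lbrakk>X \<in> Obj C; Y \<in> Obj C; Z \<in> Obj C; f \<in> Hom C X Y; g \<in> Hom C Y Z; v \<in> carrier (W X)\<rbrakk>
        \<Longrightarrow> w (g \<cdot> f) v = w g (w f v)"

text \<open>
  Tensor functor data: natural isomorphisms \<open>c X Y : \<omega>(X) \<otimes> \<omega>(Y) \<rightarrow> \<omega>(X \<otimes> Y)\<close> and an isomorphism
  \<open>u : k \<rightarrow> \<omega>(\<one>)\<close>, compatible with the constraints. All maps in the diagrams are linear and the
  pure tensors generate, so commutativity is stated on pure tensors.
\<close>

locale tensor_structure = vec_functor C W w
  for C :: "('o, 'm, 'z) tensor_cat_scheme" (structure)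
    and W :: "'o \<Rightarrow> ('m, 'v) module" and w :: "'m \<Rightarrow> 'v \<Rightarrow> 'v" +
  fixes c :: "'o \<Rightarrow> 'o \<Rightarrow> ('v \<times> 'v \<Rightarrow> 'm) set \<Rightarrow> 'v" and u :: "'m \<Rightarrow> 'v"
  assumes tensor_iso:
      "\<lbrakk>X \<in> Obj C; Y \<in> Obj C\<rbrakk>
        \<Longrightarrow> linear_iso (End_ring C) (tensor_module (End_ring C) (W X) (W Y)) (W (X \<otimes>\<^sub>o Y)) (c X Y)"
    and tensor_natural:
      "\<lbrakk>X \<in> Obj C; X' \<in> Obj C; Y \<in> Obj C; Y' \<in> Obj C; f \<in> Hom C X X'; g \<in> Hom C Y Y';
        x \<in> carrier (W X); y \<in> carrier (W Y)\<rbrakk>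
        \<Longrightarrow> w (f \<otimes>\<^sub>m g) (c X Y (pure_tensor (End_ring C) (W X) (W Y) x y))
           = c X' Y' (pure_tensor (End_ring C) (W X') (W Y') (w f x) (w g y))"
    and tensor_assoc:
      "\<lbrakk>X \<in> Obj C; Y \<in> Obj C; Z \<in> Obj C;
        x \<in> carrier (W X); y \<in> carrier (W Y); z \<in> carrier (W Z)\<rbrakk>
        \<Longrightarrow> w (Assoc C X Y Z)
             (c X (Y \<otimes>\<^sub>o Z) (pure_tensor (End_ring C) (W X) (W (Y \<otimes>\<^sub>o Z)) x
                (c Y Z (pure_tensor (End_ring C) (W Y) (W Z) y z))))
           = c (X \<otimes>\<^sub>o Y) Z (pure_tensor (End_ring C) (W (X \<otimes>\<^sub>o Y)) (W Z)
                (c X Y (pure_tensor (End_ring C) (W X) (W Y) x y)) z)"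
    and tensor_comm:
      "\<lbrakk>X \<in> Obj C; Y \<in> Obj C; x \<in> carrier (W X); y \<in> carrier (W Y)\<rbrakk>
        \<Longrightarrow> w (Comm C X Y) (c X Y (pure_tensor (End_ring C) (W X) (W Y) x y))
           = c Y X (pure_tensor (End_ring C) (W Y) (W X) y x)"
    and unit_iso:
      "linear_iso (End_ring C) (regular_module (End_ring C)) (W (UnitObj C)) u"
    and tensor_unit:
      "\<lbrakk>X \<in> Obj C; x \<in> carrier (W X)\<rbrakk>
        \<Longrightarrow> w (UnitIso C X) x
           = c (UnitObj C) X (pure_tensor (End_ring C) (W (UnitObj C)) (W X) (u \<one>\<^bsub>End_ring C\<^esub>) x)"

locale fibre_functor = vec_functor C W w
  for C :: "('o, 'm, 'z) tensor_cat_scheme" (structure)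
    and W :: "'o \<Rightarrow> ('m, 'v) module" and w :: "'m \<Rightarrow> 'v \<Rightarrow> 'v" +
  assumes map_Add:
      "\<lbrakk>X \<in> Obj C; Y \<in> Obj C; f \<in> Hom C X Y; g \<in> Hom C X Y; v \<in> carrier (W X)\<rbrakk>
        \<Longrightarrow> w (f \<boxplus> g) v = w f v \<oplus>\<^bsub>W Y\<^esub> w g v"
    and map_scale:
      "\<lbrakk>X \<in> Obj C; Y \<in> Obj C; a \<in> carrier (End_ring C); f \<in> Hom C X Y; v \<in> carrier (W X)\<rbrakk>
        \<Longrightarrow> w (scale_arr C X Y a f) v = a \<odot>\<^bsub>W Y\<^esub> w f v"
    and exact:
      "\<lbrakk>X \<in> Obj C; Y \<in> Obj C; Z \<in> Obj C; short_exact C X Y Z f g\<rbrakk>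
        \<Longrightarrow> inj_on (w f) (carrier (W X)) \<and>
            w f ` carrier (W X) = {v \<in> carrier (W Y). w g v = \<zero>\<^bsub>W Z\<^esub>} \<and>
            w g ` carrier (W Y) = carrier (W Z)"
    and faithful:
      "\<lbrakk>X \<in> Obj C; Y \<in> Obj C; f \<in> Hom C X Y; g \<in> Hom C X Y;
        \<And>v. v \<in> carrier (W X) \<Longrightarrow> w f v = w g v\<rbrakk> \<Longrightarrow> f = g"
    and tensor_functor: "\<exists>c u. tensor_structure C W w c u"

definition neutral_tannakian_category ::
  "('o, 'm, 'z) tensor_cat_scheme \<Rightarrow> ('o \<Rightarrow> ('m, 'v) module) \<Rightarrow> ('m \<Rightarrow> 'v \<Rightarrow> 'v) \<Rightarrow> bool" where
  "neutral_tannakian_category C W w \<longleftrightarrow> tannakian_category C \<and> fibre_functor C W w"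


section \<open>Ultraproducts\<close>

definition nonprincipal_ultrafilter :: "'i filter \<Rightarrow> bool" where
  "nonprincipal_ultrafilter U \<longleftrightarrow>
     U \<noteq> bot \<and> (\<forall>P. eventually P U \<or> eventually (\<lambda>i. \<not> P i) U) \<and> (\<forall>i. U \<noteq> principal {i})"

definition uclass :: "'i filter \<Rightarrow> ('i \<Rightarrow> 'a) \<Rightarrow> ('i \<Rightarrow> 'a) set" where
  "uclass U x = {y. \<forall>\<^sub>F i in U. y i = x i}"

text \<open>
  Tuples need only have their entries in \<open>A i\<close> for almost every \<open>i\<close>; when all \<open>A i\<close> are nonempty
  this gives the same classes as tuples with every entry in \<open>A i\<close>.
\<close>

definition uprod :: "'i filter \<Rightarrow> ('i \<Rightarrow> 'a set) \<Rightarrow> ('i \<Rightarrow> 'a) set set" where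
  "uprod U A = {uclass U x | x. \<forall>\<^sub>F i in U. x i \<in> A i}"

text \<open>Componentwise operations on classes, written without choosing representatives.\<close>

definition ulift1 :: "'i filter \<Rightarrow> ('i \<Rightarrow> 'a \<Rightarrow> 'd) \<Rightarrow> ('i \<Rightarrow> 'a) set \<Rightarrow> ('i \<Rightarrow> 'd) set" where
  "ulift1 U f A = {z. \<exists>x\<in>A. \<forall>\<^sub>F i in U. z i = f i (x i)}"

definition ulift2 ::
  "'i filter \<Rightarrow> ('i \<Rightarrow> 'a \<Rightarrow> 'b \<Rightarrow> 'd) \<Rightarrow> ('i \<Rightarrow> 'a) set \<Rightarrow> ('i \<Rightarrow> 'b) set \<Rightarrow> ('i \<Rightarrow> 'd) set" where
  "ulift2 U f A B = {z. \<exists>x\<in>A. \<exists>y\<in>B. \<forall>\<^sub>F i in U. z i = f i (x i) (y i)}"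

definition ulift3 ::
  "'i filter \<Rightarrow> ('i \<Rightarrow> 'a \<Rightarrow> 'b \<Rightarrow> 'c \<Rightarrow> 'd)
     \<Rightarrow> ('i \<Rightarrow> 'a) set \<Rightarrow> ('i \<Rightarrow> 'b) set \<Rightarrow> ('i \<Rightarrow> 'c) set \<Rightarrow> ('i \<Rightarrow> 'd) set" where
  "ulift3 U f A B D = {z. \<exists>x\<in>A. \<exists>y\<in>B. \<exists>t\<in>D. \<forall>\<^sub>F i in U. z i = f i (x i) (y i) (t i)}"

lemma uclass_self: "x \<in> uclass U x"
  by (simp add: uclass_def)

lemma uclass_eq_iff: "uclass U x = uclass U y \<longleftrightarrow> (\<forall>\<^sub>F i in U. x i = y i)"
proof
  assume "uclass U x = uclass U y"
  then have "x \<in> uclass U y" using uclass_self[of x U] by simp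
  then show "\<forall>\<^sub>F i in U. x i = y i" by (simp add: uclass_def)
next
  assume *: "\<forall>\<^sub>F i in U. x i = y i"
  have "(\<forall>\<^sub>F i in U. z i = x i) \<longleftrightarrow> (\<forall>\<^sub>F i in U. z i = y i)" for z
    using * by (auto elim: eventually_elim2)
  then show "uclass U x = uclass U y" by (simp add: uclass_def)
qed

lemma ulift1_uclass: "ulift1 U f (uclass U x) = uclass U (\<lambda>i. f i (x i))"
proof (rule Set.set_eqI, rule iffI)
  fix z assume "z \<in> ulift1 U f (uclass U x)"
  then obtain x' where "\<forall>\<^sub>F i in U. x' i = x i" "\<forall>\<^sub>F i in U. z i = f i (x' i)"
    by (auto simp: ulift1_def uclass_def)
  then have "\<forall>\<^sub>F i in U. z i = f i (x i)" by eventually_elim simp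
  then show "z \<in> uclass U (\<lambda>i. f i (x i))" by (simp add: uclass_def)
next
  fix z assume "z \<in> uclass U (\<lambda>i. f i (x i))"
  then have "\<forall>\<^sub>F i in U. z i = f i (x i)" by (simp add: uclass_def)
  then show "z \<in> ulift1 U f (uclass U x)"
    unfolding ulift1_def by (intro CollectI bexI[OF _ uclass_self])
qed

lemma ulift2_uclass:
  "ulift2 U f (uclass U x) (uclass U y) = uclass U (\<lambda>i. f i (x i) (y i))"
proof (rule Set.set_eqI, rule iffI)
  fix z assume "z \<in> ulift2 U f (uclass U x) (uclass U y)"
  then obtain x' y' where "\<forall>\<^sub>F i in U. x' i = x i" "\<forall>\<^sub>F i in U. y' i = y i"
      "\<forall>\<^sub>F i in U. z i = f i (x' i) (y' i)"
    by (auto simp: ulift2_def uclass_def)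
  then have "\<forall>\<^sub>F i in U. z i = f i (x i) (y i)" by eventually_elim simp
  then show "z \<in> uclass U (\<lambda>i. f i (x i) (y i))" by (simp add: uclass_def)
next
  fix z assume "z \<in> uclass U (\<lambda>i. f i (x i) (y i))"
  then have "\<forall>\<^sub>F i in U. z i = f i (x i) (y i)" by (simp add: uclass_def)
  then show "z \<in> ulift2 U f (uclass U x) (uclass U y)"
    unfolding ulift2_def by (intro CollectI bexI[OF _ uclass_self])
qed

lemma ulift3_uclass:
  "ulift3 U f (uclass U x) (uclass U y) (uclass U t) = uclass U (\<lambda>i. f i (x i) (y i) (t i))"
proof (rule Set.set_eqI, rule iffI)
  fix z assume "z \<in> ulift3 U f (uclass U x) (uclass U y) (uclass U t)"
  then obtain x' y' t' where "\<forall>\<^sub>F i in U. x' i = x i" "\<forall>\<^sub>F i in U. y' i = y i"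
      "\<forall>\<^sub>F i in U. t' i = t i" "\<forall>\<^sub>F i in U. z i = f i (x' i) (y' i) (t' i)"
    by (auto simp: ulift3_def uclass_def)
  then have "\<forall>\<^sub>F i in U. z i = f i (x i) (y i) (t i)" by eventually_elim simp
  then show "z \<in> uclass U (\<lambda>i. f i (x i) (y i) (t i))" by (simp add: uclass_def)
next
  fix z assume "z \<in> uclass U (\<lambda>i. f i (x i) (y i) (t i))"
  then have "\<forall>\<^sub>F i in U. z i = f i (x i) (y i) (t i)" by (simp add: uclass_def)
  then show "z \<in> ulift3 U f (uclass U x) (uclass U y) (uclass U t)"
    unfolding ulift3_def by (intro CollectI bexI[OF _ uclass_self])
qed

definition ring_ultraproduct :: "'i filter \<Rightarrow> ('i \<Rightarrow> 'k ring) \<Rightarrow> ('i \<Rightarrow> 'k) set ring" where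
  "ring_ultraproduct U K = \<lparr>
     carrier = uprod U (\<lambda>i. carrier (K i)),
     monoid.mult = ulift2 U (\<lambda>i. monoid.mult (K i)),
     one = uclass U (\<lambda>i. \<one>\<^bsub>K i\<^esub>),
     ring.zero = uclass U (\<lambda>i. \<zero>\<^bsub>K i\<^esub>),
     ring.add = ulift2 U (\<lambda>i. ring.add (K i))\<rparr>"

definition vec_ultraproduct ::
  "'i filter \<Rightarrow> ('i \<Rightarrow> ('k, 'v) module) \<Rightarrow> (('i \<Rightarrow> 'k) set, ('i \<Rightarrow> 'v) set) module" where
  "vec_ultraproduct U V = \<lparr>
     carrier = uprod U (\<lambda>i. carrier (V i)),
     monoid.mult = ulift2 U (\<lambda>i. monoid.mult (V i)),
     one = uclass U (\<lambda>i. \<one>\<^bsub>V i\<^esub>),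
     ring.zero = uclass U (\<lambda>i. \<zero>\<^bsub>V i\<^esub>),
     ring.add = ulift2 U (\<lambda>i. ring.add (V i)),
     smult = ulift2 U (\<lambda>i. smult (V i))\<rparr>"

definition cat_ultraproduct ::
  "'i filter \<Rightarrow> ('i \<Rightarrow> ('o, 'm) tensor_cat) \<Rightarrow> (('i \<Rightarrow> 'o) set, ('i \<Rightarrow> 'm) set) tensor_cat" where
  "cat_ultraproduct U C = \<lparr>
     Obj = uprod U (\<lambda>i. Obj (C i)),
     Hom = (\<lambda>A B. {uclass U f | f X Y. A = uclass U X \<and> B = uclass U Y \<and>
                      (\<forall>\<^sub>F i in U. f i \<in> Hom (C i) (X i) (Y i))}),
     Comp = ulift2 U (\<lambda>i. Comp (C i)),
     Id = ulift1 U (\<lambda>i. Id (C i)),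
     Add = ulift2 U (\<lambda>i. Add (C i)),
     Zero = ulift2 U (\<lambda>i. Zero (C i)),
     Tensor = ulift2 U (\<lambda>i. Tensor (C i)),
     TensorArr = ulift2 U (\<lambda>i. TensorArr (C i)),
     UnitObj = uclass U (\<lambda>i. UnitObj (C i)),
     Assoc = ulift3 U (\<lambda>i. Assoc (C i)),
     Comm = ulift2 U (\<lambda>i. Comm (C i)),
     UnitIso = ulift1 U (\<lambda>i. UnitIso (C i))\<rparr>"

lemma uclass_in_Hom_iff:
  "uclass U f \<in> Hom (cat_ultraproduct U C) (uclass U X) (uclass U Y) \<longleftrightarrow>
     (\<forall>\<^sub>F i in U. f i \<in> Hom (C i) (X i) (Y i))"
proof
  assume "uclass U f \<in> Hom (cat_ultraproduct U C) (uclass U X) (uclass U Y)"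
  then obtain f' X' Y' where "\<forall>\<^sub>F i in U. f i = f' i" "\<forall>\<^sub>F i in U. X i = X' i"
      "\<forall>\<^sub>F i in U. Y i = Y' i" "\<forall>\<^sub>F i in U. f' i \<in> Hom (C i) (X' i) (Y' i)"
    by (auto simp: cat_ultraproduct_def uclass_eq_iff)
  then show "\<forall>\<^sub>F i in U. f i \<in> Hom (C i) (X i) (Y i)" by eventually_elim simp
next
  assume "\<forall>\<^sub>F i in U. f i \<in> Hom (C i) (X i) (Y i)"
  then show "uclass U f \<in> Hom (cat_ultraproduct U C) (uclass U X) (uclass U Y)"
    by (auto simp: cat_ultraproduct_def)
qed

definition restricted_ultraproduct ::
  "'i filter \<Rightarrow> ('i \<Rightarrow> ('o, 'm) tensor_cat) \<Rightarrow> ('i \<Rightarrow> 'o \<Rightarrow> ('m, 'v) module)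
     \<Rightarrow> (('i \<Rightarrow> 'o) set, ('i \<Rightarrow> 'm) set) tensor_cat" where
  "restricted_ultraproduct U C W = (cat_ultraproduct U C)
     \<lparr>Obj := {uclass U X | X. (\<forall>\<^sub>F i in U. X i \<in> Obj (C i)) \<and>
               (\<exists>n. \<forall>\<^sub>F i in U. vectorspace.dim (End_ring (C i)) (W i (X i)) \<le> n)}\<rparr>"

text \<open>
  The functor \<open>[X\<^sub>i] \<mapsto> \<Prod>\<^sub>U \<omega>\<^sub>i(X\<^sub>i)\<close>, \<open>[f\<^sub>i] \<mapsto> [\<omega>\<^sub>i(f\<^sub>i)]\<close>. Its object part is defined through a
  representative; \<open>ultra_obj_uclass\<close> shows that the choice is immaterial.
\<close>

definition ultra_obj ::
  "'i filter \<Rightarrow> ('i \<Rightarrow> 'o \<Rightarrow> ('m, 'v) module)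
     \<Rightarrow> ('i \<Rightarrow> 'o) set \<Rightarrow> (('i \<Rightarrow> 'm) set, ('i \<Rightarrow> 'v) set) module" where
  "ultra_obj U W A = (let X = (SOME X. A = uclass U X) in vec_ultraproduct U (\<lambda>i. W i (X i)))"

definition ultra_arr ::
  "'i filter \<Rightarrow> ('i \<Rightarrow> 'm \<Rightarrow> 'v \<Rightarrow> 'v) \<Rightarrow> ('i \<Rightarrow> 'm) set \<Rightarrow> ('i \<Rightarrow> 'v) set \<Rightarrow> ('i \<Rightarrow> 'v) set" where
  "ultra_arr U w = ulift2 U w"

lemma vec_ultraproduct_cong:
  fixes V V' :: "'i \<Rightarrow> ('k, 'v) module"
  assumes "\<forall>\<^sub>F i in U. V i = V' i"
  shows "vec_ultraproduct U V = vec_ultraproduct U V'"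
proof -
  have lift: "ulift2 U f = ulift2 U g" if "\<forall>\<^sub>F i in U. f i = g i"
    for f g :: "'i \<Rightarrow> 'x \<Rightarrow> 'y \<Rightarrow> 'z"
  proof -
    have "(\<forall>\<^sub>F i in U. z i = f i (x i) (y i)) \<longleftrightarrow> (\<forall>\<^sub>F i in U. z i = g i (x i) (y i))" for z x y
      by (rule eventually_cong[OF that]) simp
    then show ?thesis unfolding ulift2_def by presburger
  qed
  have cls: "uclass U f = uclass U g" if "\<forall>\<^sub>F i in U. f i = g i" for f g :: "'i \<Rightarrow> 'x"
    using that by (simp add: uclass_eq_iff)
  have car: "uprod U A = uprod U B" if "\<forall>\<^sub>F i in U. A i = B i" for A B :: "'i \<Rightarrow> 'x set"
  proof -
    have "(\<forall>\<^sub>F i in U. x i \<in> A i) \<longleftrightarrow> (\<forall>\<^sub>F i in U. x i \<in> B i)" for x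
      by (rule eventually_cong[OF that]) simp
    then show ?thesis unfolding uprod_def by presburger
  qed
  have field: "\<forall>\<^sub>F i in U. f (V i) = f (V' i)" for f :: "('k, 'v) module \<Rightarrow> 'x"
    using assms by (rule eventually_mono) simp
  show ?thesis
    unfolding vec_ultraproduct_def
    by (simp add: lift[OF field] cls[OF field] car[OF field])
qed

lemma ultra_obj_uclass: "ultra_obj U W (uclass U X) = vec_ultraproduct U (\<lambda>i. W i (X i))"
proof -
  define X' where "X' = (SOME X'. uclass U X = uclass U X')"
  have "uclass U X = uclass U X'"
    unfolding X'_def by (rule someI[of _ X]) (rule refl)
  then have "\<forall>\<^sub>F i in U. W i (X' i) = W i (X i)"
    by (auto simp: uclass_eq_iff elim: eventually_mono)
  then show ?thesis
    by (simp add: ultra_obj_def X'_def[symmetric] vec_ultraproduct_cong)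
qed

lemma ultra_arr_uclass:
  "ultra_arr U w (uclass U f) (uclass U v) = uclass U (\<lambda>i. w i (f i) (v i))"
  by (simp add: ultra_arr_def ulift2_uclass)

end

theory Submission
  imports Defs
begin

text \<open>
  All structure is componentwise, so an axiom that is a first-order statement about objects of
  \<open>\<Prod>\<^sub>R C\<^sub>i\<close> is inherited from the \<open>C\<^sub>i\<close>. What has to be shown is that each construction keeps
  dimensions bounded, and that kernels, cokernels and internal Homs of \<open>\<Prod>\<^sub>R C\<^sub>i\<close> are
  componentwise almost everywhere; the latter follows from the former by uniqueness up to
  isomorphism. For kernels and cokernels boundedness is exactness of \<open>\<omega>\<^sub>i\<close>. For internal Homs,
  \<open>X\<^sup>\<or> \<otimes> Y \<cong> Hom(X, Y)\<close>; with \<open>Y = X\<close>, the element of \<open>\<omega>(X\<^sup>\<or>) \<otimes> \<omega>(X)\<close> that corresponds to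
  the identity writes every \<open>x\<close> as \<open>\<Sum>\<^sub>j d\<^sub>j(x) y\<^sub>j\<close> for a basis \<open>d\<^sub>j\<close> of \<open>\<omega>(X\<^sup>\<or>)\<close>, whence
  \<open>dim \<omega>(X) \<le> dim \<omega>(X\<^sup>\<or>)\<close>, and reflexivity gives equality.
\<close>

section \<open>Finite families of vectors\<close>

text \<open>Three obstacles shape the argument. The axioms of exactness and rigidity speak of every
  kernel, cokernel and internal Hom of the restricted ultraproduct, not only of those assembled from
  components; hence each universal property needs a transfer in both directions. Monomorphisms and
  epimorphisms quantify over all test objects, so they are treated through the vanishing of a kernel
  or cokernel arrow, which is an equation between classes. Finally, the natural map from the tensor
  product of two ultraproducts of spaces to the ultraproduct of the tensor products reaches only
  classes of tensors of bounded rank; it is onto here because the rank is at most the dimension of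
  the left factor, which takes one value almost everywhere. The isomorphism
  \<open>X\<^sup>\<or> \<otimes> Y \<cong> Hom(X, Y)\<close> is an instance of the rigidity axiom,
  for the pairs \<open>(X, \<one>)\<close> and \<open>(\<one>, Y)\<close>. Wherever possible a class
  is first given a representative whose entries are legitimate at every index, so that the facts
  about the single categories apply without exception.\<close>

primrec nsum :: "('a, 'z) ring_scheme \<Rightarrow> (nat \<Rightarrow> 'a) \<Rightarrow> nat \<Rightarrow> 'a" where
  "nsum M f 0 = \<zero>\<^bsub>M\<^esub>"
| "nsum M f (Suc n) = nsum M f n \<oplus>\<^bsub>M\<^esub> f n"

lemma nsum_cong: "(\<And>j. j < n \<Longrightarrow> f j = g j) \<Longrightarrow> nsum M f n = nsum M g n"
  by (induction n) auto

lemma (in abelian_group) nsum_closed: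
  "(\<And>j. j < n \<Longrightarrow> f j \<in> carrier G) \<Longrightarrow> nsum G f n \<in> carrier G"
  by (induction n) auto

lemma (in abelian_group) nsum_zero:
  "(\<And>j. j < n \<Longrightarrow> f j = \<zero>) \<Longrightarrow> nsum G f n = \<zero>"
  by (induction n) auto

lemma (in abelian_group) nsum_add:
  assumes "\<And>j. j < n \<Longrightarrow> f j \<in> carrier G" "\<And>j. j < n \<Longrightarrow> g j \<in> carrier G"
  shows "nsum G (\<lambda>j. f j \<oplus> g j) n = nsum G f n \<oplus> nsum G g n"
  using assms
proof (induction n)
  case (Suc n)
  have "nsum G f n \<in> carrier G" "nsum G g n \<in> carrier G" "f n \<in> carrier G" "g n \<in> carrier G"
    using Suc.prems by (auto intro!: nsum_closed)
  with Suc show ?case by (simp add: a_ac)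
qed simp

lemma (in abelian_group) nsum_delta:
  assumes "v \<in> carrier G"
  shows "nsum G (\<lambda>j. if j = k then v else \<zero>) n = (if k < n then v else \<zero>)"
  using assms by (induction n) auto

lemma (in abelian_group) nsum_eq_finsum:
  "(\<And>j. j < n \<Longrightarrow> f j \<in> carrier G) \<Longrightarrow> nsum G f n = finsum G f {..<n}"
proof (induction n)
  case (Suc n)
  then show ?case
    by (simp add: lessThan_Suc a_comm Pi_def finsum_closed)
qed simp

lemma (in module) nsum_smult:
  assumes "a \<in> carrier R" "\<And>j. j < n \<Longrightarrow> f j \<in> carrier M"
  shows "nsum M (\<lambda>j. a \<odot>\<^bsub>M\<^esub> f j) n = a \<odot>\<^bsub>M\<^esub> nsum M f n"
  using assms
proof (induction n)
  case (Suc n)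
  have "nsum M f n \<in> carrier M" using Suc.prems by (auto intro!: M.nsum_closed)
  with Suc show ?case by (simp add: smult_r_distr)
qed simp

lemma (in mod_hom) nsum_hom:
  assumes "\<And>j. j < n \<Longrightarrow> g j \<in> carrier M"
  shows "f (nsum M g n) = nsum N (\<lambda>j. f (g j)) n"
  using assms
proof (induction n)
  case (Suc n)
  have "nsum M g n \<in> carrier M" using Suc.prems by (auto intro!: M.M.nsum_closed)
  with Suc show ?case by simp
qed simp

lemma (in submodule) nsum_in:
  "(\<And>j. j < n \<Longrightarrow> f j \<in> N) \<Longrightarrow> nsum M f n \<in> N"
  by (induction n) auto

text \<open>Repetitions and zero vectors are allowed, so the length \<open>n\<close> is only an
  upper bound for the dimension. One \<open>n\<close> can thus serve almost all components, and such
  families pass to an ultraproduct entry by entry.\<close>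

definition spanning :: "('k, 'r) ring_scheme \<Rightarrow> ('k, 'v, 'z) module_scheme \<Rightarrow> nat \<Rightarrow> (nat \<Rightarrow> 'v) \<Rightarrow> bool"
  where "spanning K V n b \<longleftrightarrow> (\<forall>j<n. b j \<in> carrier V) \<and>
    (\<forall>v\<in>carrier V. \<exists>a. (\<forall>j<n. a j \<in> carrier K) \<and> v = nsum V (\<lambda>j. a j \<odot>\<^bsub>V\<^esub> b j) n)"

definition independent :: "('k, 'r) ring_scheme \<Rightarrow> ('k, 'v, 'z) module_scheme \<Rightarrow> nat \<Rightarrow> (nat \<Rightarrow> 'v) \<Rightarrow> bool"
  where "independent K V n b \<longleftrightarrow>
    (\<forall>a. (\<forall>j<n. a j \<in> carrier K) \<longrightarrow> nsum V (\<lambda>j. a j \<odot>\<^bsub>V\<^esub> b j) n = \<zero>\<^bsub>V\<^esub>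
      \<longrightarrow> (\<forall>j<n. a j = \<zero>\<^bsub>K\<^esub>))"

lemma spanningE:
  assumes "spanning K V n b" "v \<in> carrier V"
  obtains a where "\<forall>j<n. a j \<in> carrier K" "v = nsum V (\<lambda>j. a j \<odot>\<^bsub>V\<^esub> b j) n"
proof -
  have "\<exists>a. (\<forall>j<n. a j \<in> carrier K) \<and> v = nsum V (\<lambda>j. a j \<odot>\<^bsub>V\<^esub> b j) n"
    using assms by (simp add: spanning_def)
  then obtain a where "(\<forall>j<n. a j \<in> carrier K) \<and> v = nsum V (\<lambda>j. a j \<odot>\<^bsub>V\<^esub> b j) n"
    by (rule exE)
  then show thesis using that[of a] by simp
qed

lemma spanning_closed: "spanning K V n b \<Longrightarrow> j < n \<Longrightarrow> b j \<in> carrier V"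
  by (simp add: spanning_def)

context vectorspace
begin

lemma spanning_gen:
  assumes "spanning K V n b"
  shows "gen_set (b ` {..<n})" "b ` {..<n} \<subseteq> carrier V"
proof -
  show sub: "b ` {..<n} \<subseteq> carrier V" using assms by (auto simp: spanning_def)
  interpret S: submodule K "span (b ` {..<n})" V by (rule span_is_submodule[OF sub])
  have "v \<in> span (b ` {..<n})" if v: "v \<in> carrier V" for v
  proof -
    obtain a where a: "\<forall>j<n. a j \<in> carrier K" "v = nsum V (\<lambda>j. a j \<odot>\<^bsub>V\<^esub> b j) n"
      using spanningE[OF assms v] by blast
    show ?thesis unfolding a(2)
      using a(1) in_own_span[OF sub] by (intro S.nsum_in S.smult_closed) auto
  qed
  then show "gen_set (b ` {..<n})" using S.subset by auto
qed

lemma spanning_fin_dim: "spanning K V n b \<Longrightarrow> fin_dim"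
  unfolding fin_dim_def using spanning_gen[of n b] by (intro exI[of _ "b ` {..<n}"]) simp

lemma spanning_dim_le:
  assumes "spanning K V n b" shows "dim \<le> n"
proof -
  have "dim \<le> card (b ` {..<n})" using spanning_gen[OF assms] by (intro gen_ge_dim) auto
  also have "\<dots> \<le> n" using card_image_le[of "{..<n}" b] by simp
  finally show ?thesis .
qed

text \<open>Bridge between the set-indexed \<open>lincomb\<close>, in which bases and dimensions are
  expressed, and the indexed sums \<open>nsum\<close>; \<open>h\<close> enumerates
  \<open>B\<close>.\<close>

lemma lincomb_nsum:
  assumes "bij_betw h {0..<n} B" "B \<subseteq> carrier V" "a \<in> B \<rightarrow> carrier K"
  shows "lincomb a B = nsum V (\<lambda>j. a (h j) \<odot>\<^bsub>V\<^esub> h j) n"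
proof -
  have B: "B = h ` {..<n}" and inj: "inj_on h {..<n}"
    using assms(1) by (auto simp: bij_betw_def lessThan_atLeast0)
  have "nsum V (\<lambda>j. a (h j) \<odot>\<^bsub>V\<^esub> h j) n = finsum V (\<lambda>j. a (h j) \<odot>\<^bsub>V\<^esub> h j) {..<n}"
    using assms B by (intro nsum_eq_finsum) auto
  also have "\<dots> = finsum V (\<lambda>v. a v \<odot>\<^bsub>V\<^esub> v) (h ` {..<n})"
    using assms B inj by (intro finsum_reindex[symmetric]) auto
  finally show ?thesis by (simp add: lincomb_def B)
qed

lemma basis_family_exists:
  assumes fin_dim
  obtains b where "spanning K V dim b" "independent K V dim b"
proof -
  obtain B where B: "finite B" "basis B" using finite_basis_exists[OF assms] by blast
  have dim: "dim = card B" using dim_basis B by blast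
  have sub: "B \<subseteq> carrier V" and li: "lin_indpt B" and gen: "gen_set B"
    using B by (auto simp: basis_def)
  obtain h where h: "bij_betw h {0..<dim} B"
    using ex_bij_betw_nat_finite[OF B(1)] dim by auto
  have hB: "h j \<in> B" if "j < dim" for j using h that by (auto simp: bij_betw_def)
  have "spanning K V dim h"
    unfolding spanning_def
  proof (intro conjI allI impI ballI)
    show "h j \<in> carrier V" if "j < dim" for j using hB that sub by auto
    fix v assume "v \<in> carrier V"
    then have "v \<in> span B" using gen by simp
    then obtain a where a: "a \<in> B \<rightarrow> carrier K" "lincomb a B = v"
      using finite_in_span[OF B(1) sub] by blast
    show "\<exists>a. (\<forall>j<dim. a j \<in> carrier K) \<and> v = nsum V (\<lambda>j. a j \<odot>\<^bsub>V\<^esub> h j) dim"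
      using a lincomb_nsum[OF h sub a(1)] hB by (intro exI[of _ "a \<circ> h"]) auto
  qed
  moreover have "independent K V dim h"
    unfolding independent_def
  proof (intro allI impI)
    fix a j assume a: "\<forall>j<dim. a j \<in> carrier K" and z: "nsum V (\<lambda>j. a j \<odot>\<^bsub>V\<^esub> h j) dim = \<zero>\<^bsub>V\<^esub>"
      and j: "j < dim"
    \<comment> \<open>\<open>lincomb\<close> takes its coefficients as a function of the vector, so
      \<open>a\<close> is composed with the inverse of the enumeration \<open>h\<close>.\<close>
    define g where "g = the_inv_into {0..<dim} h"
    have gh: "g (h j) = j" if "j < dim" for j
      using h that by (simp add: g_def the_inv_into_f_f bij_betw_def)
    have g: "g x < dim" if "x \<in> B" for x
      using h that gh by (auto simp: bij_betw_def)
    have ag: "a \<circ> g \<in> B \<rightarrow> carrier K" using a g by auto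
    have "lincomb (a \<circ> g) B = nsum V (\<lambda>j. a j \<odot>\<^bsub>V\<^esub> h j) dim"
      unfolding lincomb_nsum[OF h sub ag] by (intro nsum_cong) (simp add: gh)
    then have "a \<circ> g \<in> B \<rightarrow> {\<zero>\<^bsub>K\<^esub>}"
      using not_lindepD[OF li B(1) _ ag] z by auto
    then show "a j = \<zero>\<^bsub>K\<^esub>" using hB[OF j] gh[OF j] by force
  qed
  ultimately show thesis by (rule that)
qed

text \<open>A basis is padded with zero vectors. The dimensions in a bounded tuple of objects may
  vary, while \<open>spanning_ultraproduct\<close> asks for one length at almost every
  index.\<close>

lemma dim_le_spanning:
  assumes fin_dim "dim \<le> n"
  shows "\<exists>b. spanning K V n b"
proof -
  obtain b where b: "spanning K V dim b" using basis_family_exists[OF assms(1)] by blast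
  define b' where "b' j = (if j < dim then b j else \<zero>\<^bsub>V\<^esub>)" for j
  have "spanning K V n b'"
    unfolding spanning_def
  proof (intro conjI allI impI ballI)
    show "b' j \<in> carrier V" if "j < n" for j using b by (auto simp: b'_def spanning_def)
    fix v assume "v \<in> carrier V"
    then obtain a where a: "\<forall>j<dim. a j \<in> carrier K" "v = nsum V (\<lambda>j. a j \<odot>\<^bsub>V\<^esub> b j) dim"
      using b by (elim spanningE)
    define a' where "a' j = (if j < dim then a j else \<zero>\<^bsub>K\<^esub>)" for j
    have "nsum V (\<lambda>j. a' j \<odot>\<^bsub>V\<^esub> b' j) n = nsum V (\<lambda>j. a j \<odot>\<^bsub>V\<^esub> b j) dim"
      using assms(2)
    proof (induction n rule: dec_induct)
      case base
      show ?case by (intro nsum_cong) (simp add: a'_def b'_def)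
    next
      case (step m)
      have "nsum V (\<lambda>j. a j \<odot>\<^bsub>V\<^esub> b j) dim \<in> carrier V"
        using a b by (intro nsum_closed) (auto simp: spanning_def)
      with step show ?case by (simp add: a'_def b'_def)
    qed
    then show "\<exists>a. (\<forall>j<n. a j \<in> carrier K) \<and> v = nsum V (\<lambda>j. a j \<odot>\<^bsub>V\<^esub> b' j) n"
      using a by (intro exI[of _ a']) (auto simp: a'_def)
  qed
  then show ?thesis by blast
qed

end

lemma (in linear_map) spanning_surj:
  assumes "spanning K V n b" "T ` carrier V = carrier W"
  shows "spanning K W n (\<lambda>j. T (b j))"
  unfolding spanning_def
proof (intro conjI allI impI ballI)
  have b: "b j \<in> carrier V" if "j < n" for j using assms that by (auto simp: spanning_def)
  show "T (b j) \<in> carrier W" if "j < n" for j using b that by auto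
  fix v assume "v \<in> carrier W"
  then obtain v' where v': "v' \<in> carrier V" "v = T v'" using assms(2) by auto
  then obtain a where a: "\<forall>j<n. a j \<in> carrier K" "v' = nsum V (\<lambda>j. a j \<odot>\<^bsub>V\<^esub> b j) n"
    using assms(1) by (elim spanningE)
  have "v = nsum W (\<lambda>j. T (a j \<odot>\<^bsub>V\<^esub> b j)) n"
    unfolding v' a(2) using a b by (intro nsum_hom) auto
  also have "\<dots> = nsum W (\<lambda>j. a j \<odot>\<^bsub>W\<^esub> T (b j)) n"
    using a b by (intro nsum_cong) auto
  finally show "\<exists>a. (\<forall>j<n. a j \<in> carrier K) \<and> v = nsum W (\<lambda>j. a j \<odot>\<^bsub>W\<^esub> T (b j)) n"
    using a by blast
qed

lemma (in linear_map) dim_surj: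
  assumes "V.fin_dim" "T ` carrier V = carrier W"
  shows "W.dim \<le> V.dim"
proof -
  obtain b where "spanning K V V.dim b" using V.basis_family_exists[OF assms(1)] by blast
  then show ?thesis using W.spanning_dim_le spanning_surj[OF _ assms(2)] by blast
qed

text \<open>An injective map carries a basis of the source to an independent set of the same
  cardinality.\<close>

lemma (in linear_map) dim_inj:
  assumes "V.fin_dim" "W.fin_dim" "inj_on T (carrier V)"
  shows "V.dim \<le> W.dim"
proof -
  obtain B where B: "finite B" "V.basis B" using V.finite_basis_exists[OF assms(1)] by blast
  have sub: "B \<subseteq> carrier V" and li: "V.module.lin_indpt B" using B by (auto simp: V.basis_def)
  have injB: "inj_on T B" using assms(3) sub inj_on_subset by blast
  have "W.module.lin_indpt (T ` B)"
  proof (rule W.module.finite_lin_indpt2)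
    fix a assume a: "a \<in> T ` B \<rightarrow> carrier K" "W.module.lincomb a (T ` B) = \<zero>\<^bsub>W\<^esub>"
    have aT: "a \<circ> T \<in> B \<rightarrow> carrier K" using a by auto
    have "T (V.module.lincomb (a \<circ> T) B) = T \<zero>\<^bsub>V\<^esub>"
      using lincomb_linear_image[OF assms(3) sub a(1) B(1)] a(2) by simp
    moreover have "V.module.lincomb (a \<circ> T) B \<in> carrier V"
      using sub aT by (intro V.module.lincomb_closed) auto
    moreover have "\<zero>\<^bsub>V\<^esub> \<in> carrier V" by simp
    ultimately have "V.module.lincomb (a \<circ> T) B = \<zero>\<^bsub>V\<^esub>"
      using assms(3) by (meson inj_on_def)
    then have "a \<circ> T \<in> B \<rightarrow> {\<zero>\<^bsub>K\<^esub>}"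
      using V.not_lindepD[OF li B(1) _ aT] by auto
    then show "\<forall>v\<in>T ` B. a v = \<zero>\<^bsub>K\<^esub>" by auto
  qed (use B sub in auto)
  then have "card (T ` B) \<le> W.dim"
    using sub by (intro W.li_le_dim(2)[OF assms(2)]) auto
  then show ?thesis using V.dim_basis[OF B] card_image[OF injB] by simp
qed

section \<open>Free and quotient modules\<close>

lemma module_free_module:
  assumes "cring K" shows "module K (free_module K S)"
proof -
  interpret K: cring K by (rule assms)
  have fin_add: "finite {x. a x \<oplus>\<^bsub>K\<^esub> b x \<noteq> \<zero>\<^bsub>K\<^esub>}"
    if "finite {x. a x \<noteq> \<zero>\<^bsub>K\<^esub>}" "finite {x. b x \<noteq> \<zero>\<^bsub>K\<^esub>}" for a b :: "'c \<Rightarrow> 'a"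
    using finite_UnI[OF that] by (rule finite_subset[rotated]) auto
  have fin_mult: "finite {x. c \<otimes>\<^bsub>K\<^esub> a x \<noteq> \<zero>\<^bsub>K\<^esub>}"
    if "c \<in> carrier K" "finite {x. a x \<noteq> \<zero>\<^bsub>K\<^esub>}" for c and a :: "'c \<Rightarrow> 'a"
    using that(2) by (rule finite_subset[rotated]) (use that in auto)
  have fin_neg: "finite {x. \<ominus>\<^bsub>K\<^esub> a x \<noteq> \<zero>\<^bsub>K\<^esub>}"
    if "finite {x. a x \<noteq> \<zero>\<^bsub>K\<^esub>}" for a :: "'c \<Rightarrow> 'a"
    using that by (rule finite_subset[rotated]) auto
  show ?thesis
  proof (rule module_criteria; (intro allI impI ballI)?)
    show "cring K" by (rule assms)
    fix v assume v: "v \<in> carrier (free_module K S)"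
    show "\<exists>u\<in>carrier (free_module K S). v \<oplus>\<^bsub>free_module K S\<^esub> u = \<zero>\<^bsub>free_module K S\<^esub>"
      using v by (intro bexI[of _ "\<lambda>x. \<ominus>\<^bsub>K\<^esub> v x"]) (auto simp: free_module_def fin_neg K.r_neg)
  qed (auto simp: free_module_def fin_add fin_mult K.a_ac K.m_assoc K.l_distr K.r_distr)
qed

lemma free_gen_closed: "cring K \<Longrightarrow> s \<in> S \<Longrightarrow> free_gen K s \<in> carrier (free_module K S)"
  by (auto simp: free_module_def free_gen_def cring.cring_simprules)

text \<open>Induction on the support: one index \<open>s\<close> is removed by setting the value
  there to zero.\<close>

lemma free_module_induct [consumes 2, case_names zero add]:
  assumes K: "cring K" and a: "a \<in> carrier (free_module K S)"
    and zero: "P \<zero>\<^bsub>free_module K S\<^esub>"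
    and add: "\<And>a c s. a \<in> carrier (free_module K S) \<Longrightarrow> P a \<Longrightarrow> c \<in> carrier K \<Longrightarrow> s \<in> S
      \<Longrightarrow> P (a \<oplus>\<^bsub>free_module K S\<^esub> (c \<odot>\<^bsub>free_module K S\<^esub> free_gen K s))"
  shows "P a"
proof -
  interpret K: cring K by (rule K)
  have "P a" if "finite A" "{x. a x \<noteq> \<zero>\<^bsub>K\<^esub>} = A" "a \<in> carrier (free_module K S)" for A a
    using that
  proof (induction A arbitrary: a rule: finite_induct)
    case empty
    then have "a = \<zero>\<^bsub>free_module K S\<^esub>" by (auto simp: free_module_def)
    then show ?case using zero by simp
  next
    case (insert s A)
    define a' where "a' = a(s := \<zero>\<^bsub>K\<^esub>)"
    have s: "s \<in> S" using insert.prems insert.hyps by (auto simp: free_module_def)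
    have supp: "{x. a' x \<noteq> \<zero>\<^bsub>K\<^esub>} = A" using insert.prems insert.hyps by (auto simp: a'_def)
    have a': "a' \<in> carrier (free_module K S)"
      using insert.prems insert.hyps supp by (auto simp: free_module_def a'_def)
    have aK: "a x \<in> carrier K" for x using insert.prems by (auto simp: free_module_def)
    have "a = a' \<oplus>\<^bsub>free_module K S\<^esub> (a s \<odot>\<^bsub>free_module K S\<^esub> free_gen K s)"
      using aK by (auto simp: free_module_def free_gen_def a'_def fun_eq_iff)
    then show ?case using add[OF a' insert.IH[OF supp a'] aK s, of s] by simp
  qed
  then show ?thesis using a by (auto simp: free_module_def)
qed

text \<open>The linear extension of \<open>B\<close> from the generators. The sum runs over the
  support because the index set, later \<open>carrier V \<times> carrier W\<close>, may be
  infinite.\<close>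

definition free_lift :: "('k, 'r) ring_scheme \<Rightarrow> ('k, 'v, 'z) module_scheme \<Rightarrow> ('s \<Rightarrow> 'v) \<Rightarrow> ('s \<Rightarrow> 'k) \<Rightarrow> 'v"
  where "free_lift K Z B a = finsum Z (\<lambda>s. a s \<odot>\<^bsub>Z\<^esub> B s) {s. a s \<noteq> \<zero>\<^bsub>K\<^esub>}"

context module
begin

text \<open>The additional terms have coefficient zero. In this way the sums for different
  coefficient functions can run over one common finite set.\<close>

lemma free_lift_superset:
  assumes "a \<in> carrier (free_module R S)" "finite A" "{s. a s \<noteq> \<zero>\<^bsub>R\<^esub>} \<subseteq> A" "A \<subseteq> S"
    "\<And>s. s \<in> S \<Longrightarrow> B s \<in> carrier M"
  shows "free_lift R M B a = finsum M (\<lambda>s. a s \<odot>\<^bsub>M\<^esub> B s) A"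
  unfolding free_lift_def
  using assms by (intro M.add.finprod_mono_neutral_cong_left) (auto simp: free_module_def)

lemma free_lift_hom:
  assumes B: "\<And>s. s \<in> S \<Longrightarrow> B s \<in> carrier M"
  shows "mod_hom R (free_module R S) M (free_lift R M B)"
proof -
  let ?F = "free_module R S"
  have F: "module R ?F" by (rule module_free_module) (rule is_cring)
  interpret F: module R ?F by (rule F)
  have supp: "finite {s. a s \<noteq> \<zero>\<^bsub>R\<^esub>}" "{s. a s \<noteq> \<zero>\<^bsub>R\<^esub>} \<subseteq> S" "\<And>s. a s \<in> carrier R"
    if "a \<in> carrier ?F" for a using that by (auto simp: free_module_def)
  have closed: "free_lift R M B a \<in> carrier M" if "a \<in> carrier ?F" for a
    unfolding free_lift_def using supp[OF that] B by (intro finsum_closed) auto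
  have "free_lift R M B (a \<oplus>\<^bsub>?F\<^esub> b) = free_lift R M B a \<oplus>\<^bsub>M\<^esub> free_lift R M B b"
    if a: "a \<in> carrier ?F" and b: "b \<in> carrier ?F" for a b
  proof -
    define A where "A = {s. a s \<noteq> \<zero>\<^bsub>R\<^esub>} \<union> {s. b s \<noteq> \<zero>\<^bsub>R\<^esub>}"
    have A: "finite A" "A \<subseteq> S" using supp[OF a] supp[OF b] by (auto simp: A_def)
    have "free_lift R M B (a \<oplus>\<^bsub>?F\<^esub> b) = finsum M (\<lambda>s. (a \<oplus>\<^bsub>?F\<^esub> b) s \<odot>\<^bsub>M\<^esub> B s) A"
      using F.a_closed[OF a b] A B by (intro free_lift_superset) (auto simp: A_def free_module_def)
    also have "\<dots> = finsum M (\<lambda>s. a s \<odot>\<^bsub>M\<^esub> B s \<oplus>\<^bsub>M\<^esub> b s \<odot>\<^bsub>M\<^esub> B s) A"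
      using supp[OF a] supp[OF b] A B
      by (intro M.finsum_cong') (auto simp: free_module_def smult_l_distr subset_iff)
    also have "\<dots> = finsum M (\<lambda>s. a s \<odot>\<^bsub>M\<^esub> B s) A \<oplus>\<^bsub>M\<^esub> finsum M (\<lambda>s. b s \<odot>\<^bsub>M\<^esub> B s) A"
      using supp[OF a] supp[OF b] A B by (intro M.finsum_addf) auto
    also have "finsum M (\<lambda>s. a s \<odot>\<^bsub>M\<^esub> B s) A = free_lift R M B a"
      using a A B by (intro free_lift_superset[symmetric]) (auto simp: A_def)
    also have "finsum M (\<lambda>s. b s \<odot>\<^bsub>M\<^esub> B s) A = free_lift R M B b"
      using b A B by (intro free_lift_superset[symmetric]) (auto simp: A_def)
    finally show ?thesis .
  qed
  moreover have "free_lift R M B (c \<odot>\<^bsub>?F\<^esub> a) = c \<odot>\<^bsub>M\<^esub> free_lift R M B a"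
    if c: "c \<in> carrier R" and a: "a \<in> carrier ?F" for c a
  proof -
    let ?A = "{s. a s \<noteq> \<zero>\<^bsub>R\<^esub>}"
    have "free_lift R M B (c \<odot>\<^bsub>?F\<^esub> a) = finsum M (\<lambda>s. (c \<odot>\<^bsub>?F\<^esub> a) s \<odot>\<^bsub>M\<^esub> B s) ?A"
      using F.smult_closed[OF c a] supp[OF a] B c
      by (intro free_lift_superset) (auto simp: free_module_def)
    also have "\<dots> = finsum M (\<lambda>s. c \<odot>\<^bsub>M\<^esub> (a s \<odot>\<^bsub>M\<^esub> B s)) ?A"
      using supp[OF a] c B
      by (intro M.finsum_cong') (auto simp: free_module_def smult_assoc1 subset_iff)
    also have "\<dots> = c \<odot>\<^bsub>M\<^esub> free_lift R M B a"
      unfolding free_lift_def using supp[OF a] c B by (intro finsum_smult[symmetric]) auto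
    finally show ?thesis .
  qed
  ultimately have "free_lift R M B \<in> module_hom R ?F M"
    using closed by (auto simp: module_hom_def)
  then show ?thesis
    using F module_axioms by (simp add: mod_hom_def mod_hom_axioms_def)
qed

lemma free_lift_gen:
  assumes "\<And>s. s \<in> S \<Longrightarrow> B s \<in> carrier M" "s \<in> S"
  shows "free_lift R M B (free_gen R s) = B s"
proof -
  have "free_lift R M B (free_gen R s) = finsum M (\<lambda>t. free_gen R s t \<odot>\<^bsub>M\<^esub> B t) {s}"
    using assms by (intro free_lift_superset[of _ S] free_gen_closed is_cring)
      (auto simp: free_gen_def split: if_splits)
  then show ?thesis using assms by (simp add: free_gen_def)
qed

end

section \<open>Quotients by a submodule\<close>

locale quotient_setting = module K M + submodule K N M
  for K :: "('k, 'r) ring_scheme" and M :: "('k, 'v, 'z) module_scheme" and N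
begin

lemma abelian_subgroup_N: "abelian_subgroup N M"
proof (rule abelian_subgroupI3)
  show "additive_subgroup N M"
  proof (rule additive_subgroupI, rule M.add.subgroupI)
    show "N \<subseteq> carrier M" by (rule subset)
    show "N \<noteq> {}" using submodule.zero_closed[OF submodule_axioms] by blast
    show "\<ominus>\<^bsub>M\<^esub> v \<in> N" if "v \<in> N" for v
    proof -
      have "(\<ominus>\<^bsub>K\<^esub> \<one>\<^bsub>K\<^esub>) \<odot>\<^bsub>M\<^esub> v \<in> N"
        using that by (intro submodule.smult_closed[OF submodule_axioms]) simp_all
      then show ?thesis using that subset smult_minus_1[of v] by (metis subsetD)
    qed
  qed (use m_closed in auto)
qed (rule M.abelian_group_axioms)

sublocale N: abelian_subgroup N M by (rule abelian_subgroup_N)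

abbreviation Q where "Q \<equiv> quotient_module M N"

lemma carrier_Q: "A \<in> carrier Q \<longleftrightarrow> (\<exists>x\<in>carrier M. A = N +>\<^bsub>M\<^esub> x)"
  by (auto simp: quotient_module_def A_RCOSETS_def')

lemma coset_eq_iff:
  assumes "x \<in> carrier M" "y \<in> carrier M"
  shows "N +>\<^bsub>M\<^esub> x = N +>\<^bsub>M\<^esub> y \<longleftrightarrow> x \<ominus>\<^bsub>M\<^esub> y \<in> N"
proof -
  have "x \<in> N +>\<^bsub>M\<^esub> y \<longleftrightarrow> x \<ominus>\<^bsub>M\<^esub> y \<in> N"
    using N.a_rcos_module assms by (simp add: a_minus_def)
  moreover have "x \<in> N +>\<^bsub>M\<^esub> y \<longleftrightarrow> N +>\<^bsub>M\<^esub> x = N +>\<^bsub>M\<^esub> y"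
    using assms N.a_rcos_self N.a_repr_independence' by metis
  ultimately show ?thesis by simp
qed

lemma coset_add:
  "x \<in> carrier M \<Longrightarrow> y \<in> carrier M \<Longrightarrow> (N +>\<^bsub>M\<^esub> x) \<oplus>\<^bsub>Q\<^esub> (N +>\<^bsub>M\<^esub> y) = N +>\<^bsub>M\<^esub> (x \<oplus>\<^bsub>M\<^esub> y)"
  by (simp add: quotient_module_def N.a_rcos_sum)

text \<open>The scalar multiple in \<open>quotient_module\<close> is a union over all
  representatives of the coset. Two representatives differ by an element of \<open>N\<close>, hence
  so do their multiples, and the union is one of equal cosets.\<close>

lemma coset_smult:
  assumes "c \<in> carrier K" "x \<in> carrier M"
  shows "c \<odot>\<^bsub>Q\<^esub> (N +>\<^bsub>M\<^esub> x) = N +>\<^bsub>M\<^esub> (c \<odot>\<^bsub>M\<^esub> x)"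
proof -
  have "N +>\<^bsub>M\<^esub> (c \<odot>\<^bsub>M\<^esub> y) = N +>\<^bsub>M\<^esub> (c \<odot>\<^bsub>M\<^esub> x)" if "y \<in> N +>\<^bsub>M\<^esub> x" for y
  proof -
    obtain n where n: "n \<in> N" "y = n \<oplus>\<^bsub>M\<^esub> x"
      using \<open>y \<in> N +>\<^bsub>M\<^esub> x\<close> by (auto simp: a_r_coset_def')
    have nM: "n \<in> carrier M" using n subset by auto
    have "c \<odot>\<^bsub>M\<^esub> y \<ominus>\<^bsub>M\<^esub> c \<odot>\<^bsub>M\<^esub> x = c \<odot>\<^bsub>M\<^esub> n"
      using assms nM unfolding n(2)
      by (simp add: smult_r_distr M.minus_eq M.a_assoc M.r_neg)
    then show ?thesis using assms n nM by (simp add: coset_eq_iff)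
  qed
  moreover have "x \<in> N +>\<^bsub>M\<^esub> x" using assms N.a_rcos_self by auto
  ultimately have "(\<Union>y\<in>N +>\<^bsub>M\<^esub> x. N +>\<^bsub>M\<^esub> (c \<odot>\<^bsub>M\<^esub> y)) = N +>\<^bsub>M\<^esub> (c \<odot>\<^bsub>M\<^esub> x)"
    by blast
  then show ?thesis by (simp add: quotient_module_def)
qed

lemma coset_zero: "\<zero>\<^bsub>Q\<^esub> = N +>\<^bsub>M\<^esub> \<zero>\<^bsub>M\<^esub>"
  using subset by (simp add: quotient_module_def)

lemma module_quotient: "module K Q"
proof (rule module_criteria; (intro allI impI ballI)?)
  show "cring K" by (rule is_cring)
  show "\<zero>\<^bsub>Q\<^esub> \<in> carrier Q" by (auto simp: carrier_Q coset_zero)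
  fix A assume "A \<in> carrier Q"
  then obtain x where x: "x \<in> carrier M" "A = N +>\<^bsub>M\<^esub> x" by (auto simp: carrier_Q)
  show "\<exists>B\<in>carrier Q. A \<oplus>\<^bsub>Q\<^esub> B = \<zero>\<^bsub>Q\<^esub>"
    using x by (intro bexI[of _ "N +>\<^bsub>M\<^esub> (\<ominus>\<^bsub>M\<^esub> x)"])
      (auto simp: carrier_Q coset_zero coset_add M.r_neg)
qed (auto simp: carrier_Q coset_zero coset_add coset_smult M.a_ac
    smult_l_distr smult_r_distr smult_assoc1)

lemma coset_hom: "mod_hom K M Q (\<lambda>x. N +>\<^bsub>M\<^esub> x)"
  using module_axioms module_quotient
  by (auto simp: mod_hom_def mod_hom_axioms_def module_hom_def coset_add coset_smult carrier_Q)

text \<open>The map chooses a representative of each coset and applies \<open>f\<close>. Two choices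
  differ by an element of \<open>N\<close>, which \<open>f\<close> kills.\<close>

lemma quotient_lift:
  assumes "mod_hom K M Z f" "\<And>x. x \<in> N \<Longrightarrow> f x = \<zero>\<^bsub>Z\<^esub>"
  shows "\<exists>g. mod_hom K Q Z g \<and> (\<forall>x\<in>carrier M. g (N +>\<^bsub>M\<^esub> x) = f x)"
proof -
  interpret f: mod_hom K M Z f by (rule assms)
  define g where "g A = f (SOME x. x \<in> carrier M \<and> A = N +>\<^bsub>M\<^esub> x)" for A
  have g: "g (N +>\<^bsub>M\<^esub> x) = f x" if "x \<in> carrier M" for x
  proof -
    define y where "y = (SOME y. y \<in> carrier M \<and> N +>\<^bsub>M\<^esub> x = N +>\<^bsub>M\<^esub> y)"
    have y: "y \<in> carrier M" "N +>\<^bsub>M\<^esub> x = N +>\<^bsub>M\<^esub> y"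
      using someI[of "\<lambda>y. y \<in> carrier M \<and> N +>\<^bsub>M\<^esub> x = N +>\<^bsub>M\<^esub> y" x] that by (auto simp: y_def)
    then have "f (x \<ominus>\<^bsub>M\<^esub> y) = \<zero>\<^bsub>Z\<^esub>" using assms(2) that coset_eq_iff by blast
    then have "f x \<ominus>\<^bsub>Z\<^esub> f y = \<zero>\<^bsub>Z\<^esub>" using that y by simp
    then have "f x = f y" using that y by simp
    then show ?thesis by (simp add: g_def y_def)
  qed
  have "mod_hom K Q Z g"
    using module_quotient f.N.module_axioms
    by (auto simp: mod_hom_def mod_hom_axioms_def module_hom_def carrier_Q coset_add coset_smult g)
  then show ?thesis using g by blast
qed

end

section \<open>Tensor products\<close>

locale tensor_setting = V: module K V + W: module K W
  for K :: "('k, 'r) ring_scheme" and V :: "('k, 'v, 'y) module_scheme"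
    and W :: "('k, 'w, 'z) module_scheme"
begin

abbreviation F where "F \<equiv> free_module K (carrier V \<times> carrier W)"
abbreviation N where "N \<equiv> bilinear_submodule K V W"
abbreviation T where "T \<equiv> tensor_module K V W"
abbreviation pt where "pt \<equiv> pure_tensor K V W"

lemma module_F: "module K F"
  by (rule module_free_module) (rule V.is_cring)

sublocale F: module K F by (rule module_F)

lemma gen_closed: "v \<in> carrier V \<Longrightarrow> w \<in> carrier W \<Longrightarrow> free_gen K (v, w) \<in> carrier F"
  by (rule free_gen_closed[OF V.is_cring]) simp

lemma relations_subset: "bilinear_relations K V W \<subseteq> carrier F"
  unfolding bilinear_relations_def Let_def by (auto simp: gen_closed)

sublocale Q: quotient_setting K F N
  unfolding quotient_setting_def bilinear_submodule_def
  using module_F F.span_is_submodule[OF relations_subset] by auto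

lemma relations_in_N: "r \<in> bilinear_relations K V W \<Longrightarrow> r \<in> N"
  unfolding bilinear_submodule_def using F.in_own_span[OF relations_subset] by auto

lemma module_tensor: "module K T"
  unfolding tensor_module_def by (rule Q.module_quotient)

sublocale T: module K T by (rule module_tensor)

lemma pure_closed: "v \<in> carrier V \<Longrightarrow> w \<in> carrier W \<Longrightarrow> pt v w \<in> carrier T"
  unfolding tensor_module_def pure_tensor_def Q.carrier_Q using gen_closed by blast

lemma pure_add_left:
  assumes "v \<in> carrier V" "v' \<in> carrier V" "w \<in> carrier W"
  shows "pt (v \<oplus>\<^bsub>V\<^esub> v') w = pt v w \<oplus>\<^bsub>T\<^esub> pt v' w"
proof -
  have "free_gen K (v \<oplus>\<^bsub>V\<^esub> v', w) \<ominus>\<^bsub>F\<^esub> (free_gen K (v, w) \<oplus>\<^bsub>F\<^esub> free_gen K (v', w))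
      \<in> bilinear_relations K V W"
    unfolding bilinear_relations_def Let_def using assms by blast
  then have "free_gen K (v \<oplus>\<^bsub>V\<^esub> v', w) \<ominus>\<^bsub>F\<^esub> (free_gen K (v, w) \<oplus>\<^bsub>F\<^esub> free_gen K (v', w)) \<in> N"
    by (rule relations_in_N)
  then show ?thesis
    unfolding tensor_module_def pure_tensor_def
    using assms by (simp add: Q.coset_add gen_closed Q.coset_eq_iff)
qed

lemma pure_add_right:
  assumes "v \<in> carrier V" "w \<in> carrier W" "w' \<in> carrier W"
  shows "pt v (w \<oplus>\<^bsub>W\<^esub> w') = pt v w \<oplus>\<^bsub>T\<^esub> pt v w'"
proof -
  have "free_gen K (v, w \<oplus>\<^bsub>W\<^esub> w') \<ominus>\<^bsub>F\<^esub> (free_gen K (v, w) \<oplus>\<^bsub>F\<^esub> free_gen K (v, w'))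
      \<in> bilinear_relations K V W"
    unfolding bilinear_relations_def Let_def using assms by blast
  then have "free_gen K (v, w \<oplus>\<^bsub>W\<^esub> w') \<ominus>\<^bsub>F\<^esub> (free_gen K (v, w) \<oplus>\<^bsub>F\<^esub> free_gen K (v, w')) \<in> N"
    by (rule relations_in_N)
  then show ?thesis
    unfolding tensor_module_def pure_tensor_def
    using assms by (simp add: Q.coset_add gen_closed Q.coset_eq_iff)
qed

lemma pure_smult_left:
  assumes "a \<in> carrier K" "v \<in> carrier V" "w \<in> carrier W"
  shows "pt (a \<odot>\<^bsub>V\<^esub> v) w = a \<odot>\<^bsub>T\<^esub> pt v w"
proof -
  have "free_gen K (a \<odot>\<^bsub>V\<^esub> v, w) \<ominus>\<^bsub>F\<^esub> (a \<odot>\<^bsub>F\<^esub> free_gen K (v, w)) \<in> bilinear_relations K V W"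
    unfolding bilinear_relations_def Let_def using assms by blast
  then have "free_gen K (a \<odot>\<^bsub>V\<^esub> v, w) \<ominus>\<^bsub>F\<^esub> (a \<odot>\<^bsub>F\<^esub> free_gen K (v, w)) \<in> N"
    by (rule relations_in_N)
  then show ?thesis
    unfolding tensor_module_def pure_tensor_def
    using assms by (simp add: Q.coset_smult gen_closed Q.coset_eq_iff)
qed

lemma pure_smult_right:
  assumes "a \<in> carrier K" "v \<in> carrier V" "w \<in> carrier W"
  shows "pt v (a \<odot>\<^bsub>W\<^esub> w) = a \<odot>\<^bsub>T\<^esub> pt v w"
proof -
  have "free_gen K (v, a \<odot>\<^bsub>W\<^esub> w) \<ominus>\<^bsub>F\<^esub> (a \<odot>\<^bsub>F\<^esub> free_gen K (v, w)) \<in> bilinear_relations K V W"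
    unfolding bilinear_relations_def Let_def using assms by blast
  then have "free_gen K (v, a \<odot>\<^bsub>W\<^esub> w) \<ominus>\<^bsub>F\<^esub> (a \<odot>\<^bsub>F\<^esub> free_gen K (v, w)) \<in> N"
    by (rule relations_in_N)
  then show ?thesis
    unfolding tensor_module_def pure_tensor_def
    using assms by (simp add: Q.coset_smult gen_closed Q.coset_eq_iff)
qed

lemma pure_hom_left: "w \<in> carrier W \<Longrightarrow> mod_hom K V T (\<lambda>v. pt v w)"
  using V.module_axioms module_tensor
  by (auto simp: mod_hom_def mod_hom_axioms_def module_hom_def pure_closed pure_add_left pure_smult_left)

lemma pure_hom_right: "v \<in> carrier V \<Longrightarrow> mod_hom K W T (pt v)"
  using W.module_axioms module_tensor
  by (auto simp: mod_hom_def mod_hom_axioms_def module_hom_def pure_closed pure_add_right pure_smult_right)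

text \<open>There is no case for scalar multiples or for zero: a scalar is absorbed into the left
  factor of a pure tensor, and zero is the pure tensor of two zero vectors.\<close>

lemma tensor_induct [consumes 1, case_names pure add]:
  assumes t: "t \<in> carrier T"
    and pure: "\<And>v w. v \<in> carrier V \<Longrightarrow> w \<in> carrier W \<Longrightarrow> P (pt v w)"
    and add: "\<And>s t. s \<in> carrier T \<Longrightarrow> t \<in> carrier T \<Longrightarrow> P s \<Longrightarrow> P t \<Longrightarrow> P (s \<oplus>\<^bsub>T\<^esub> t)"
  shows "P t"
proof -
  interpret p: mod_hom K F T "\<lambda>x. N +>\<^bsub>F\<^esub> x"
    unfolding tensor_module_def by (rule Q.coset_hom)
  obtain x where x: "x \<in> carrier F" "t = N +>\<^bsub>F\<^esub> x"
    using t by (auto simp: tensor_module_def Q.carrier_Q)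
  have "P (N +>\<^bsub>F\<^esub> x)" using V.is_cring x(1)
  proof (induction x rule: free_module_induct)
    case zero
    interpret l: mod_hom K V T "\<lambda>v. pt v \<zero>\<^bsub>W\<^esub>" by (rule pure_hom_left) simp
    have "pt \<zero>\<^bsub>V\<^esub> \<zero>\<^bsub>W\<^esub> = \<zero>\<^bsub>T\<^esub>" by (rule l.f0_is_0)
    then show ?case using pure[of "\<zero>\<^bsub>V\<^esub>" "\<zero>\<^bsub>W\<^esub>"] p.f0_is_0 by simp
  next
    case (add x c s)
    obtain v w where s: "s = (v, w)" "v \<in> carrier V" "w \<in> carrier W" using add.hyps by auto
    have g: "free_gen K s \<in> carrier F" using s gen_closed by simp
    have "N +>\<^bsub>F\<^esub> (x \<oplus>\<^bsub>F\<^esub> c \<odot>\<^bsub>F\<^esub> free_gen K s) = (N +>\<^bsub>F\<^esub> x) \<oplus>\<^bsub>T\<^esub> (c \<odot>\<^bsub>T\<^esub> pt v w)"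
      using add.hyps g by (simp add: pure_tensor_def s(1))
    also have "c \<odot>\<^bsub>T\<^esub> pt v w = pt (c \<odot>\<^bsub>V\<^esub> v) w" using add.hyps s by (simp add: pure_smult_left)
    finally show ?case
      using add.hyps add.IH s assms(3)[of "N +>\<^bsub>F\<^esub> x" "pt (c \<odot>\<^bsub>V\<^esub> v) w"] pure[of "c \<odot>\<^bsub>V\<^esub> v" w]
      by (simp add: pure_closed)
  qed
  then show ?thesis by (simp add: x(2))
qed

lemma hom_ext:
  assumes "mod_hom K T Z f" "mod_hom K T Z g"
    and "\<And>v w. v \<in> carrier V \<Longrightarrow> w \<in> carrier W \<Longrightarrow> f (pt v w) = g (pt v w)" and "t \<in> carrier T"
  shows "f t = g t"
proof -
  interpret f: mod_hom K T Z f by (rule assms)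
  interpret g: mod_hom K T Z g by (rule assms)
  show ?thesis using \<open>t \<in> carrier T\<close> by (induction t rule: tensor_induct) (simp_all add: assms(3))
qed

definition bilinear_to :: "('k, 'x, 'u) module_scheme \<Rightarrow> ('v \<Rightarrow> 'w \<Rightarrow> 'x) \<Rightarrow> bool" where
  "bilinear_to Z B \<longleftrightarrow>
    (\<forall>w\<in>carrier W. (\<lambda>v. B v w) \<in> module_hom K V Z) \<and> (\<forall>v\<in>carrier V. B v \<in> module_hom K W Z)"

text \<open>The linear extension of \<open>B\<close> to the free module kills the four kinds of
  relations, hence the submodule that they span, and so descends to the quotient. This is the
  universal property of the tensor product.\<close>

lemma lift_exists:
  assumes Z: "module K Z" and B: "bilinear_to Z B"
  shows "\<exists>g. mod_hom K T Z g \<and> (\<forall>v\<in>carrier V. \<forall>w\<in>carrier W. g (pt v w) = B v w)"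
proof -
  interpret Z: module K Z by (rule Z)
  let ?B = "\<lambda>(v, w). B v w"
  have Bc: "B v w \<in> carrier Z" if "v \<in> carrier V" "w \<in> carrier W" for v w
    using B that by (auto simp: bilinear_to_def module_hom_def)
  then have Bc': "?B s \<in> carrier Z" if "s \<in> carrier V \<times> carrier W" for s using that by auto
  interpret L: mod_hom K F Z "free_lift K Z ?B" by (rule Z.free_lift_hom) (rule Bc')
  have gen: "free_lift K Z ?B (free_gen K (v, w)) = B v w" if "v \<in> carrier V" "w \<in> carrier W" for v w
    using Z.free_lift_gen[of "carrier V \<times> carrier W" ?B "(v, w)"] Bc that by auto
  have Badd: "B (v \<oplus>\<^bsub>V\<^esub> v') w = B v w \<oplus>\<^bsub>Z\<^esub> B v' w"
    if "v \<in> carrier V" "v' \<in> carrier V" "w \<in> carrier W" for v v' w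
    using B that by (auto simp: bilinear_to_def module_hom_def)
  have Badd': "B v (w \<oplus>\<^bsub>W\<^esub> w') = B v w \<oplus>\<^bsub>Z\<^esub> B v w'"
    if "v \<in> carrier V" "w \<in> carrier W" "w' \<in> carrier W" for v w w'
    using B that by (auto simp: bilinear_to_def module_hom_def)
  have Bsm: "B (a \<odot>\<^bsub>V\<^esub> v) w = a \<odot>\<^bsub>Z\<^esub> B v w" "B v (a \<odot>\<^bsub>W\<^esub> w) = a \<odot>\<^bsub>Z\<^esub> B v w"
    if "a \<in> carrier K" "v \<in> carrier V" "w \<in> carrier W" for a v w
    using B that by (auto simp: bilinear_to_def module_hom_def)
  have zero: "z \<ominus>\<^bsub>Z\<^esub> z = \<zero>\<^bsub>Z\<^esub>" if "z \<in> carrier Z" for z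
    using that by (simp add: Z.M.minus_eq Z.M.r_neg)
  have "bilinear_relations K V W \<subseteq> L.ker"
    unfolding bilinear_relations_def Let_def L.ker_def
    by (auto simp: gen_closed gen Badd Badd' Bsm Bc zero)
  then have "N \<subseteq> L.ker"
    unfolding bilinear_submodule_def by (rule F.span_is_subset) (rule L.ker_is_submodule)
  then have "\<exists>g. mod_hom K (quotient_module F N) Z g \<and>
      (\<forall>x\<in>carrier F. g (N +>\<^bsub>F\<^esub> x) = free_lift K Z ?B x)"
    by (intro Q.quotient_lift L.mod_hom_axioms) (auto simp: L.ker_def)
  then obtain g where g: "mod_hom K (quotient_module F N) Z g"
      "\<forall>x\<in>carrier F. g (N +>\<^bsub>F\<^esub> x) = free_lift K Z ?B x" by blast
  show ?thesis
    unfolding tensor_module_def pure_tensor_def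
    using g gen gen_closed by (intro exI[of _ g]) simp
qed

text \<open>In a pure tensor the left factor is expanded along \<open>b\<close> and the coefficients
  are moved into the right factor; sums are handled by adding the right factors.\<close>

lemma spanning_expansion:
  assumes b: "spanning K V n b" and t: "t \<in> carrier T"
  shows "\<exists>y. (\<forall>j<n. y j \<in> carrier W) \<and> t = nsum T (\<lambda>j. pt (b j) (y j)) n"
  using t
proof (induction t rule: tensor_induct)
  case (pure v w)
  obtain a where a: "\<forall>j<n. a j \<in> carrier K" "v = nsum V (\<lambda>j. a j \<odot>\<^bsub>V\<^esub> b j) n"
    using spanningE[OF b pure(1)] by blast
  interpret l: mod_hom K V T "\<lambda>v. pt v w" by (rule pure_hom_left) (rule pure)
  have "pt v w = nsum T (\<lambda>j. pt (a j \<odot>\<^bsub>V\<^esub> b j) w) n"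
    unfolding a(2) using a(1) spanning_closed[OF b] by (intro l.nsum_hom) auto
  also have "\<dots> = nsum T (\<lambda>j. pt (b j) (a j \<odot>\<^bsub>W\<^esub> w)) n"
    using a(1) spanning_closed[OF b] pure by (intro nsum_cong) (simp add: pure_smult_left pure_smult_right)
  finally show ?case using a(1) pure by (intro exI[of _ "\<lambda>j. a j \<odot>\<^bsub>W\<^esub> w"]) auto
next
  case (add s t)
  then obtain y z where y: "\<forall>j<n. y j \<in> carrier W" "s = nsum T (\<lambda>j. pt (b j) (y j)) n"
    and z: "\<forall>j<n. z j \<in> carrier W" "t = nsum T (\<lambda>j. pt (b j) (z j)) n" by blast
  have "s \<oplus>\<^bsub>T\<^esub> t = nsum T (\<lambda>j. pt (b j) (y j) \<oplus>\<^bsub>T\<^esub> pt (b j) (z j)) n"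
    unfolding y(2) z(2) using y(1) z(1) spanning_closed[OF b]
    by (intro T.M.nsum_add[symmetric]) (auto simp: pure_closed)
  also have "\<dots> = nsum T (\<lambda>j. pt (b j) (y j \<oplus>\<^bsub>W\<^esub> z j)) n"
    using y(1) z(1) spanning_closed[OF b] by (intro nsum_cong) (simp add: pure_add_right)
  finally show ?case using y(1) z(1) by (intro exI[of _ "\<lambda>j. y j \<oplus>\<^bsub>W\<^esub> z j"]) auto
qed

text \<open>The \<open>k\<close>-th coordinate along the basis gives a bilinear map that sends
  \<open>(v, w)\<close> to the \<open>k\<close>-th coordinate of \<open>v\<close> times
  \<open>w\<close>. The linear map that it induces on the tensor product takes the sum to
  \<open>y k\<close>.\<close>

lemma basis_expansion_zero:
  assumes b: "spanning K V n b" and i: "independent K V n b"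
    and y: "\<And>j. j < n \<Longrightarrow> y j \<in> carrier W" and z: "nsum T (\<lambda>j. pt (b j) (y j)) n = \<zero>\<^bsub>T\<^esub>" and k: "k < n"
  shows "y k = \<zero>\<^bsub>W\<^esub>"
proof -
  define co where "co v = (SOME a. (\<forall>j<n. a j \<in> carrier K) \<and> v = nsum V (\<lambda>j. a j \<odot>\<^bsub>V\<^esub> b j) n)" for v
  have bV: "b j \<in> carrier V" if "j < n" for j using spanning_closed[OF b that] .
  have co: "(\<forall>j<n. co v j \<in> carrier K) \<and> v = nsum V (\<lambda>j. co v j \<odot>\<^bsub>V\<^esub> b j) n" if "v \<in> carrier V" for v
  proof -
    have "\<exists>a. (\<forall>j<n. a j \<in> carrier K) \<and> v = nsum V (\<lambda>j. a j \<odot>\<^bsub>V\<^esub> b j) n"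
      using b that by (simp add: spanning_def)
    then show ?thesis unfolding co_def by (rule someI_ex)
  qed
  have co_sum: "nsum V (\<lambda>j. co v j \<odot>\<^bsub>V\<^esub> b j) n = v" if "v \<in> carrier V" for v
    by (rule conjunct2[OF co[OF that], symmetric])
  have coK: "co v j \<in> carrier K" if "v \<in> carrier V" "j < n" for v j
    using conjunct1[OF co[OF that(1)]] that(2) by blast
  have co_unique: "a j = co v j"
    if a: "\<forall>j<n. a j \<in> carrier K" and v: "v = nsum V (\<lambda>j. a j \<odot>\<^bsub>V\<^esub> b j) n" and j: "j < n" for a v j
  proof -
    have vV: "v \<in> carrier V" unfolding v using a bV by (intro V.M.nsum_closed) auto
    \<comment> \<open>The difference of two coefficient families for \<open>v\<close>. Subtraction
      is written as adding a multiple by minus one, so that \<open>nsum_add\<close> and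
      \<open>nsum_smult\<close> apply.\<close>
    let ?d = "\<lambda>j. a j \<oplus>\<^bsub>K\<^esub> (\<ominus>\<^bsub>K\<^esub> \<one>\<^bsub>K\<^esub>) \<otimes>\<^bsub>K\<^esub> co v j"
    have cK: "co v j \<in> carrier K" if "j < n" for j using coK[OF vV that] .
    have m1: "\<ominus>\<^bsub>K\<^esub> \<one>\<^bsub>K\<^esub> \<in> carrier K" by simp
    have "nsum V (\<lambda>j. ?d j \<odot>\<^bsub>V\<^esub> b j) n
        = nsum V (\<lambda>j. a j \<odot>\<^bsub>V\<^esub> b j \<oplus>\<^bsub>V\<^esub> (\<ominus>\<^bsub>K\<^esub> \<one>\<^bsub>K\<^esub>) \<odot>\<^bsub>V\<^esub> (co v j \<odot>\<^bsub>V\<^esub> b j)) n"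
      using a cK bV m1 by (intro nsum_cong) (simp only: V.smult_l_distr V.smult_assoc1 V.m_closed)
    also have "\<dots> = v \<oplus>\<^bsub>V\<^esub> (\<ominus>\<^bsub>K\<^esub> \<one>\<^bsub>K\<^esub>) \<odot>\<^bsub>V\<^esub> nsum V (\<lambda>j. co v j \<odot>\<^bsub>V\<^esub> b j) n"
      using a cK bV m1 v by (simp add: V.M.nsum_add V.nsum_smult)
    also have "nsum V (\<lambda>j. co v j \<odot>\<^bsub>V\<^esub> b j) n = v" by (rule co_sum[OF vV])
    also have "v \<oplus>\<^bsub>V\<^esub> (\<ominus>\<^bsub>K\<^esub> \<one>\<^bsub>K\<^esub>) \<odot>\<^bsub>V\<^esub> v = \<zero>\<^bsub>V\<^esub>"
      using vV V.smult_minus_1 by (simp add: V.M.r_neg)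
    finally have "nsum V (\<lambda>j. ?d j \<odot>\<^bsub>V\<^esub> b j) n = \<zero>\<^bsub>V\<^esub>" .
    moreover have "\<forall>j<n. ?d j \<in> carrier K" using a cK m1 by simp
    ultimately have "?d j = \<zero>\<^bsub>K\<^esub>"
      using i[unfolded independent_def, rule_format, of ?d j] j by blast
    then show ?thesis using a cK j by (simp add: V.R.l_minus V.R.minus_eq[symmetric])
  qed
  \<comment> \<open>The coordinates \<open>co\<close> come from a choice; they are nevertheless
    linear, since sums and multiples of valid coordinates are valid and coordinates are
    unique.\<close>
  have add: "co (v \<oplus>\<^bsub>V\<^esub> v') k = co v k \<oplus>\<^bsub>K\<^esub> co v' k" if "v \<in> carrier V" "v' \<in> carrier V" for v v'
  proof (rule co_unique[symmetric])
    show "\<forall>j<n. co v j \<oplus>\<^bsub>K\<^esub> co v' j \<in> carrier K" using coK that by simp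
    have "nsum V (\<lambda>j. (co v j \<oplus>\<^bsub>K\<^esub> co v' j) \<odot>\<^bsub>V\<^esub> b j) n
        = nsum V (\<lambda>j. co v j \<odot>\<^bsub>V\<^esub> b j \<oplus>\<^bsub>V\<^esub> co v' j \<odot>\<^bsub>V\<^esub> b j) n"
      using coK that bV by (intro nsum_cong) (simp add: V.smult_l_distr)
    also have "\<dots> = nsum V (\<lambda>j. co v j \<odot>\<^bsub>V\<^esub> b j) n \<oplus>\<^bsub>V\<^esub> nsum V (\<lambda>j. co v' j \<odot>\<^bsub>V\<^esub> b j) n"
      using coK that bV by (intro V.M.nsum_add) auto
    finally show "v \<oplus>\<^bsub>V\<^esub> v' = nsum V (\<lambda>j. (co v j \<oplus>\<^bsub>K\<^esub> co v' j) \<odot>\<^bsub>V\<^esub> b j) n"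
      by (simp only: co_sum that)
  qed (rule k)
  have smult: "co (a \<odot>\<^bsub>V\<^esub> v) k = a \<otimes>\<^bsub>K\<^esub> co v k" if "a \<in> carrier K" "v \<in> carrier V" for a v
  proof (rule co_unique[symmetric])
    show "\<forall>j<n. a \<otimes>\<^bsub>K\<^esub> co v j \<in> carrier K" using coK that by simp
    have "nsum V (\<lambda>j. (a \<otimes>\<^bsub>K\<^esub> co v j) \<odot>\<^bsub>V\<^esub> b j) n = nsum V (\<lambda>j. a \<odot>\<^bsub>V\<^esub> (co v j \<odot>\<^bsub>V\<^esub> b j)) n"
      using coK that bV by (intro nsum_cong) (simp add: V.smult_assoc1)
    also have "\<dots> = a \<odot>\<^bsub>V\<^esub> nsum V (\<lambda>j. co v j \<odot>\<^bsub>V\<^esub> b j) n"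
      using coK that bV by (intro V.nsum_smult) auto
    finally show "a \<odot>\<^bsub>V\<^esub> v = nsum V (\<lambda>j. (a \<otimes>\<^bsub>K\<^esub> co v j) \<odot>\<^bsub>V\<^esub> b j) n"
      by (simp only: co_sum that)
  qed (rule k)
  have cK: "co v k \<in> carrier K" if "v \<in> carrier V" for v using coK[OF that k] .
  have "bilinear_to W (\<lambda>v w. co v k \<odot>\<^bsub>W\<^esub> w)"
    by (auto simp: bilinear_to_def module_hom_def cK add smult W.smult_l_distr W.smult_r_distr
        W.smult_assoc1[symmetric] V.m_comm)
  then obtain g where g: "mod_hom K T W g"
      "\<And>v w. v \<in> carrier V \<Longrightarrow> w \<in> carrier W \<Longrightarrow> g (pt v w) = co v k \<odot>\<^bsub>W\<^esub> w"
    using lift_exists[OF W.module_axioms] by blast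
  interpret g: mod_hom K T W g by (rule g)
  have cob: "co (b j) k = (if j = k then \<one>\<^bsub>K\<^esub> else \<zero>\<^bsub>K\<^esub>)" if "j < n" for j
  proof (rule co_unique[symmetric, of "\<lambda>k. if j = k then \<one>\<^bsub>K\<^esub> else \<zero>\<^bsub>K\<^esub>"])
    have "nsum V (\<lambda>k. (if j = k then \<one>\<^bsub>K\<^esub> else \<zero>\<^bsub>K\<^esub>) \<odot>\<^bsub>V\<^esub> b k) n
        = nsum V (\<lambda>k. if k = j then b j else \<zero>\<^bsub>V\<^esub>) n"
      using bV by (intro nsum_cong) auto
    then show "b j = nsum V (\<lambda>k. (if j = k then \<one>\<^bsub>K\<^esub> else \<zero>\<^bsub>K\<^esub>) \<odot>\<^bsub>V\<^esub> b k) n"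
      using that bV by (simp add: V.M.nsum_delta)
  qed (use k in auto)
  have "\<zero>\<^bsub>W\<^esub> = g (nsum T (\<lambda>j. pt (b j) (y j)) n)" by (simp add: z)
  also have "\<dots> = nsum W (\<lambda>j. g (pt (b j) (y j))) n"
    using bV y by (intro g.nsum_hom) (auto simp: pure_closed)
  also have "\<dots> = nsum W (\<lambda>j. if j = k then y k else \<zero>\<^bsub>W\<^esub>) n"
    using bV y by (intro nsum_cong) (auto simp: g cob)
  also have "\<dots> = y k" using k y by (simp add: W.M.nsum_delta)
  finally show ?thesis by simp
qed

end

lemma vectorspace_tensor:
  assumes "vectorspace K V" "vectorspace K W"
  shows "vectorspace K (tensor_module K V W)"
proof -
  interpret V: vectorspace K V by (rule assms)
  interpret W: vectorspace K W by (rule assms)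
  interpret tensor_setting K V W by unfold_locales
  show ?thesis using module_tensor V.field_axioms by (simp add: vectorspace_def)
qed

text \<open>Expanding both factors along bases shows that the pure tensors of basis vectors span;
  there are at most as many of them as pairs of indices.\<close>

lemma tensor_fin_dim:
  assumes V: "vectorspace K V" "vectorspace.fin_dim K V" and W: "vectorspace K W" "vectorspace.fin_dim K W"
  shows "vectorspace.fin_dim K (tensor_module K V W)"
    "vectorspace.dim K (tensor_module K V W) \<le> vectorspace.dim K V * vectorspace.dim K W"
proof -
  interpret V: vectorspace K V by (rule V)
  interpret W: vectorspace K W by (rule W)
  interpret tensor_setting K V W by unfold_locales
  interpret TT: vectorspace K T by (rule vectorspace_tensor[OF V(1) W(1)])
  obtain b where b: "spanning K V V.dim b" using V.basis_family_exists[OF V(2)] by blast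
  obtain d where d: "spanning K W W.dim d" using W.basis_family_exists[OF W(2)] by blast
  let ?A = "(\<lambda>(i, j). pt (b i) (d j)) ` ({..<V.dim} \<times> {..<W.dim})"
  have A: "?A \<subseteq> carrier T"
    using spanning_closed[OF b] spanning_closed[OF d] by (auto simp: pure_closed)
  interpret S: submodule K "T.span ?A" T by (rule T.span_is_submodule[OF A])
  have "t \<in> T.span ?A" if t: "t \<in> carrier T" for t
  proof -
    obtain y where y: "\<forall>j<V.dim. y j \<in> carrier W" "t = nsum T (\<lambda>j. pt (b j) (y j)) V.dim"
      using spanning_expansion[OF b t] by blast
    have "pt (b i) (y i) \<in> T.span ?A" if i: "i < V.dim" for i
    proof -
      obtain a where a: "\<forall>j<W.dim. a j \<in> carrier K" "y i = nsum W (\<lambda>j. a j \<odot>\<^bsub>W\<^esub> d j) W.dim"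
        using spanningE[OF d] y i by blast
      interpret r: mod_hom K W T "pt (b i)" by (rule pure_hom_right) (rule spanning_closed[OF b i])
      have "pt (b i) (y i) = nsum T (\<lambda>j. pt (b i) (a j \<odot>\<^bsub>W\<^esub> d j)) W.dim"
        unfolding a(2) using a(1) spanning_closed[OF d] by (intro r.nsum_hom) auto
      also have "\<dots> \<in> T.span ?A"
        using a(1) spanning_closed[OF d] T.in_own_span[OF A] i
        by (intro S.nsum_in) (auto intro!: S.smult_closed)
      finally show ?thesis .
    qed
    then show ?thesis unfolding y(2) by (intro S.nsum_in) auto
  qed
  then have gen: "T.span ?A = carrier T" using S.subset by auto
  have fin: "finite ?A" by auto
  show "TT.fin_dim" unfolding TT.fin_dim_def using A gen fin by (intro exI[of _ ?A]) simp
  have "TT.dim \<le> card ?A" by (rule TT.gen_ge_dim[OF fin A gen])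
  also have "\<dots> \<le> card ({..<V.dim} \<times> {..<W.dim})" by (rule card_image_le) auto
  finally show "TT.dim \<le> V.dim * W.dim" by simp
qed

section \<open>Abelian and tensor categories\<close>

context category
begin

lemma is_inverse_unique:
  assumes "X \<in> Obj C" "Y \<in> Obj C" "f \<in> Hom C X Y" "is_inverse C X Y f g" "is_inverse C X Y f g'"
  shows "g = g'"
proof -
  have "g = g \<cdot> (f \<cdot> g')" using assms Comp_Id[of Y X g] by (simp add: is_inverse_def)
  also have "\<dots> = (g \<cdot> f) \<cdot> g'"
    using assms by (intro Comp_assoc[symmetric, of Y X Y X]) (auto simp: is_inverse_def)
  also have "\<dots> = g'" using assms Id_Comp[of Y X g'] by (simp add: is_inverse_def)
  finally show ?thesis .
qed

lemma inverse_arr_eq: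
  assumes "X \<in> Obj C" "Y \<in> Obj C" "f \<in> Hom C X Y" "is_inverse C X Y f g"
  shows "inverse_arr C X Y f = g"
  unfolding inverse_arr_def using assms is_inverse_unique[OF assms(1-3)] by blast

lemma is_inverse_inverse_arr:
  assumes "X \<in> Obj C" "Y \<in> Obj C" "is_iso C X Y f"
  shows "is_inverse C X Y f (inverse_arr C X Y f)"
  using assms inverse_arr_eq[OF assms(1,2)] by (auto simp: is_iso_def)

end

section \<open>Kernels and cokernels in preadditive and abelian categories\<close>

context preadditive_category
begin

lemma Zero_closed: "X \<in> Obj C \<Longrightarrow> Y \<in> Obj C \<Longrightarrow> Zero C X Y \<in> Hom C X Y"
  using comm_group.axioms(2)[OF Hom_comm_group, THEN group.is_monoid, THEN monoid.one_closed] by simp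

lemma Add_closed:
  "X \<in> Obj C \<Longrightarrow> Y \<in> Obj C \<Longrightarrow> f \<in> Hom C X Y \<Longrightarrow> g \<in> Hom C X Y \<Longrightarrow> f \<boxplus> g \<in> Hom C X Y"
  using comm_group.axioms(2)[OF Hom_comm_group, THEN group.is_monoid, THEN monoid.m_closed] by simp

text \<open>Cancellation in the group of arrows. It turns the distributive laws into the rules for
  composing with zero arrows.\<close>

lemma Add_cancel_Zero:
  assumes "X \<in> Obj C" "Y \<in> Obj C" "f \<in> Hom C X Y" "f \<boxplus> f = f"
  shows "f = Zero C X Y"
proof -
  interpret G: comm_group "\<lparr>carrier = Hom C X Y, monoid.mult = Add C, one = Zero C X Y\<rparr>"
    by (rule Hom_comm_group) fact+
  show ?thesis using G.l_cancel_one[of f f] assms by simp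
qed

lemma Zero_Add: "X \<in> Obj C \<Longrightarrow> Y \<in> Obj C \<Longrightarrow> f \<in> Hom C X Y \<Longrightarrow> Zero C X Y \<boxplus> f = f"
  using comm_group.axioms(2)[OF Hom_comm_group, THEN group.is_monoid, THEN monoid.l_one] by simp

lemma Comp_Zero:
  assumes "X \<in> Obj C" "Y \<in> Obj C" "Z \<in> Obj C" "g \<in> Hom C Y Z"
  shows "g \<cdot> Zero C X Y = Zero C X Z"
proof -
  have z: "Zero C X Y \<in> Hom C X Y" using assms by (simp add: Zero_closed)
  have "(g \<cdot> Zero C X Y) \<boxplus> (g \<cdot> Zero C X Y) = g \<cdot> Zero C X Y"
    using Comp_Add[OF assms(1-3) z z assms(4)] Zero_Add[OF assms(1,2) z] by simp
  then show ?thesis using assms z Comp_closed by (intro Add_cancel_Zero) auto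
qed

lemma Zero_Comp:
  assumes "X \<in> Obj C" "Y \<in> Obj C" "Z \<in> Obj C" "f \<in> Hom C X Y"
  shows "Zero C Y Z \<cdot> f = Zero C X Z"
proof -
  have z: "Zero C Y Z \<in> Hom C Y Z" using assms by (simp add: Zero_closed)
  have "(Zero C Y Z \<cdot> f) \<boxplus> (Zero C Y Z \<cdot> f) = Zero C Y Z \<cdot> f"
    using Add_Comp[OF assms(1-3) assms(4) z z] Zero_Add[OF assms(2,3) z] by simp
  then show ?thesis using assms z Comp_closed by (intro Add_cancel_Zero) auto
qed

lemma kernel_mono:
  assumes "is_kernel C X Y f K k" "X \<in> Obj C" "Y \<in> Obj C" "T \<in> Obj C"
    and g: "g \<in> Hom C T K" "h \<in> Hom C T K" "k \<cdot> g = k \<cdot> h"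
  shows "g = h"
proof -
  have k: "f \<in> Hom C X Y" "K \<in> Obj C" "k \<in> Hom C K X" "f \<cdot> k = Zero C K Y"
    using assms(1) by (auto simp: is_kernel_def)
  have kg: "k \<cdot> g \<in> Hom C T X" using assms k Comp_closed by blast
  have "f \<cdot> (k \<cdot> g) = (f \<cdot> k) \<cdot> g" using assms k by (intro Comp_assoc[symmetric]) auto
  also have "\<dots> = Zero C T Y" using assms k by (simp add: Zero_Comp)
  finally have "\<exists>!h. h \<in> Hom C T K \<and> k \<cdot> h = k \<cdot> g" using assms kg unfolding is_kernel_def by blast
  then show ?thesis using g by auto
qed

lemma cokernel_epi:
  assumes "is_cokernel C X Y f Q q" "X \<in> Obj C" "Y \<in> Obj C" "T \<in> Obj C"
    and g: "g \<in> Hom C Q T" "h \<in> Hom C Q T" "g \<cdot> q = h \<cdot> q"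
  shows "g = h"
proof -
  have q: "f \<in> Hom C X Y" "Q \<in> Obj C" "q \<in> Hom C Y Q" "q \<cdot> f = Zero C X Q"
    using assms(1) by (auto simp: is_cokernel_def)
  have gq: "g \<cdot> q \<in> Hom C Y T" using assms q Comp_closed by blast
  have "(g \<cdot> q) \<cdot> f = g \<cdot> (q \<cdot> f)" using assms q by (intro Comp_assoc) auto
  also have "\<dots> = Zero C X T" using assms q by (simp add: Comp_Zero)
  finally have "\<exists>!h. h \<in> Hom C Q T \<and> h \<cdot> q = g \<cdot> q" using assms gq unfolding is_cokernel_def by blast
  then show ?thesis using g by auto
qed

text \<open>\<open>g\<close> kills \<open>k\<close>, so it factors through \<open>q\<close>. An
  arrow that \<open>q\<close> kills is therefore killed by \<open>g\<close> and lifts to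
  \<open>K\<close>.\<close>

lemma kernel_of_cokernel:
  assumes "is_kernel C X Y g K k" "X \<in> Obj C" "Y \<in> Obj C" "is_cokernel C K X k Q q"
  shows "is_kernel C X Q q K k"
proof -
  have k: "g \<in> Hom C X Y" "K \<in> Obj C" "k \<in> Hom C K X" "g \<cdot> k = Zero C K Y"
    using assms(1) by (auto simp: is_kernel_def)
  have q: "Q \<in> Obj C" "q \<in> Hom C X Q" "q \<cdot> k = Zero C K Q"
    using assms(4) by (auto simp: is_cokernel_def)
  obtain h where h: "h \<in> Hom C Q Y" "h \<cdot> q = g"
    using assms(3,4) k unfolding is_cokernel_def by blast
  have "\<exists>!s. s \<in> Hom C T K \<and> k \<cdot> s = t"
    if T: "T \<in> Obj C" and t: "t \<in> Hom C T X" and z: "q \<cdot> t = Zero C T Q" for T t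
  proof -
    have "g \<cdot> t = h \<cdot> (q \<cdot> t)" unfolding h(2)[symmetric] using assms q h T t by (intro Comp_assoc) auto
    also have "\<dots> = Zero C T Y" using z assms q h T by (simp add: Comp_Zero)
    finally show ?thesis using assms(1) T t unfolding is_kernel_def by blast
  qed
  then show ?thesis using k q by (simp add: is_kernel_def)
qed

text \<open>\<open>q\<close> kills \<open>f\<close>, so \<open>f\<close> factors through
  \<open>k\<close>. An arrow that vanishes on \<open>k\<close> therefore vanishes on
  \<open>f\<close> and factors through \<open>q\<close>.\<close>

lemma cokernel_of_kernel:
  assumes "is_cokernel C X Y f Q q" "X \<in> Obj C" "Y \<in> Obj C" "is_kernel C Y Q q K k"
  shows "is_cokernel C K Y k Q q"
proof -
  have q: "f \<in> Hom C X Y" "Q \<in> Obj C" "q \<in> Hom C Y Q" "q \<cdot> f = Zero C X Q"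
    using assms(1) by (auto simp: is_cokernel_def)
  have k: "K \<in> Obj C" "k \<in> Hom C K Y" "q \<cdot> k = Zero C K Q"
    using assms(4) by (auto simp: is_kernel_def)
  obtain h where h: "h \<in> Hom C X K" "k \<cdot> h = f"
    using assms(2,4) q unfolding is_kernel_def by blast
  have "\<exists>!s. s \<in> Hom C Q T \<and> s \<cdot> q = t"
    if T: "T \<in> Obj C" and t: "t \<in> Hom C Y T" and z: "t \<cdot> k = Zero C K T" for T t
  proof -
    have "t \<cdot> f = (t \<cdot> k) \<cdot> h"
      unfolding h(2)[symmetric] using assms k h T t by (intro Comp_assoc[symmetric]) auto
    also have "\<dots> = Zero C X T" using z assms k h T by (simp add: Zero_Comp)
    finally show ?thesis using assms(1) T t unfolding is_cokernel_def by blast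
  qed
  then show ?thesis using k q by (simp add: is_cokernel_def)
qed

text \<open>Factorisations through \<open>L\<close> are those through \<open>K\<close> composed with
  \<open>b\<close>. The lemma serves to recognise a given arrow as a kernel in a component once it
  is isomorphic to the kernel chosen there.\<close>

lemma kernel_transport:
  assumes K: "is_kernel C X Y f K k" and X: "X \<in> Obj C" "Y \<in> Obj C"
    and L: "L \<in> Obj C" "a \<in> Hom C L K" "b \<in> Hom C K L" "a \<cdot> b = Id C K" "b \<cdot> a = Id C L"
  shows "is_kernel C X Y f L (k \<cdot> a)"
proof -
  have k: "f \<in> Hom C X Y" "K \<in> Obj C" "k \<in> Hom C K X" "f \<cdot> k = Zero C K Y"
    using K by (auto simp: is_kernel_def)
  have "f \<cdot> (k \<cdot> a) = (f \<cdot> k) \<cdot> a" using X L k by (intro Comp_assoc[symmetric]) auto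
  then have z: "f \<cdot> (k \<cdot> a) = Zero C L Y" using X L k by (simp add: Zero_Comp)
  have "\<exists>!h. h \<in> Hom C T L \<and> (k \<cdot> a) \<cdot> h = g"
    if T: "T \<in> Obj C" and g: "g \<in> Hom C T X" "f \<cdot> g = Zero C T Y" for T g
  proof -
    obtain h where h: "h \<in> Hom C T K" "k \<cdot> h = g" using K T g unfolding is_kernel_def by blast
    have bh: "b \<cdot> h \<in> Hom C T L" using L T k h Comp_closed by blast
    have "(k \<cdot> a) \<cdot> (b \<cdot> h) = k \<cdot> (a \<cdot> (b \<cdot> h))" using X L T k bh by (intro Comp_assoc) auto
    also have "a \<cdot> (b \<cdot> h) = (a \<cdot> b) \<cdot> h" using L T k h by (intro Comp_assoc[symmetric]) auto
    also have "k \<cdot> \<dots> = g" using L T k h by (simp add: Id_Comp)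
    finally have e: "(k \<cdot> a) \<cdot> (b \<cdot> h) = g" .
    have "h' = b \<cdot> h" if h': "h' \<in> Hom C T L" "(k \<cdot> a) \<cdot> h' = g" for h'
    proof -
      have "k \<cdot> (a \<cdot> h') = k \<cdot> h"
        using Comp_assoc[OF T L(1) k(2) X(1) h'(1) L(2) k(3)] h' h by simp
      moreover have "a \<cdot> h' \<in> Hom C T K" using L T k h' Comp_closed by blast
      ultimately have "a \<cdot> h' = h" using kernel_mono[OF K X T] h by blast
      then have "b \<cdot> h = (b \<cdot> a) \<cdot> h'" using Comp_assoc[OF T L(1) k(2) L(1) h'(1) L(2,3)] by simp
      then show ?thesis using L T h' by (simp add: Id_Comp)
    qed
    then show ?thesis using e bh by blast
  qed
  moreover have "k \<cdot> a \<in> Hom C L X" using X L k Comp_closed by blast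
  ultimately show ?thesis using k L z by (simp add: is_kernel_def)
qed

lemma cokernel_transport:
  assumes K: "is_cokernel C X Y f Q q" and X: "X \<in> Obj C" "Y \<in> Obj C"
    and L: "L \<in> Obj C" "a \<in> Hom C Q L" "b \<in> Hom C L Q" "b \<cdot> a = Id C Q" "a \<cdot> b = Id C L"
  shows "is_cokernel C X Y f L (a \<cdot> q)"
proof -
  have q: "f \<in> Hom C X Y" "Q \<in> Obj C" "q \<in> Hom C Y Q" "q \<cdot> f = Zero C X Q"
    using K by (auto simp: is_cokernel_def)
  have "(a \<cdot> q) \<cdot> f = a \<cdot> (q \<cdot> f)" using X L q by (intro Comp_assoc) auto
  then have z: "(a \<cdot> q) \<cdot> f = Zero C X L" using X L q by (simp add: Comp_Zero)
  have "\<exists>!h. h \<in> Hom C L T \<and> h \<cdot> (a \<cdot> q) = g"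
    if T: "T \<in> Obj C" and g: "g \<in> Hom C Y T" "g \<cdot> f = Zero C X T" for T g
  proof -
    obtain h where h: "h \<in> Hom C Q T" "h \<cdot> q = g" using K T g unfolding is_cokernel_def by blast
    have hb: "h \<cdot> b \<in> Hom C L T" using L T q h Comp_closed by blast
    have "(h \<cdot> b) \<cdot> (a \<cdot> q) = ((h \<cdot> b) \<cdot> a) \<cdot> q"
      using X L T q hb by (intro Comp_assoc[symmetric]) auto
    also have "(h \<cdot> b) \<cdot> a = h \<cdot> (b \<cdot> a)" using L T q h by (intro Comp_assoc) auto
    also have "\<dots> \<cdot> q = g" using L T q h by (simp add: Comp_Id)
    finally have e: "(h \<cdot> b) \<cdot> (a \<cdot> q) = g" .
    have "h' = h \<cdot> b" if h': "h' \<in> Hom C L T" "h' \<cdot> (a \<cdot> q) = g" for h'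
    proof -
      have "(h' \<cdot> a) \<cdot> q = h \<cdot> q"
        using Comp_assoc[OF X(2) q(2) L(1) T q(3) L(2) h'(1)] h' h by simp
      moreover have "h' \<cdot> a \<in> Hom C Q T" using L T q h' Comp_closed by blast
      ultimately have "h' \<cdot> a = h" using cokernel_epi[OF K X T] h by blast
      then have "h \<cdot> b = h' \<cdot> (a \<cdot> b)" using Comp_assoc[OF L(1) q(2) L(1) T L(3,2) h'(1)] by simp
      then show ?thesis using L T h' by (simp add: Comp_Id)
    qed
    then show ?thesis using e hb by blast
  qed
  moreover have "a \<cdot> q \<in> Hom C Y L" using X L q Comp_closed by blast
  ultimately show ?thesis using q L z by (simp add: is_cokernel_def)
qed

text \<open>If \<open>g\<close> and \<open>h\<close> have the same composite with \<open>f\<close>,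
  their difference factors through the kernel arrow and so is zero. The criterion is an equation for
  one arrow and passes between classes and components, unlike the quantifier over test objects in
  \<open>is_mono\<close>.\<close>

lemma mono_if_kernel_Zero:
  assumes K: "is_kernel C X Y f K (Zero C K X)" and X: "X \<in> Obj C" "Y \<in> Obj C"
  shows "is_mono C X Y f"
  unfolding is_mono_def
proof (intro conjI ballI impI)
  show f: "f \<in> Hom C X Y" using K by (simp add: is_kernel_def)
  fix T g h assume T: "T \<in> Obj C" and g: "g \<in> Hom C T X" and h: "h \<in> Hom C T X" and e: "f \<cdot> g = f \<cdot> h"
  interpret G: comm_group "\<lparr>carrier = Hom C T X, monoid.mult = Add C, one = Zero C T X\<rparr>"
    by (rule Hom_comm_group) fact+
  obtain h' where h': "h' \<in> Hom C T X" "h \<boxplus> h' = Zero C T X"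
    using G.r_inv_ex[of h] h by auto
  have gh: "g \<boxplus> h' \<in> Hom C T X" using T X g h' by (simp add: Add_closed)
  have "f \<cdot> (g \<boxplus> h') = f \<cdot> (h \<boxplus> h')" using Comp_Add[OF T X g h'(1) f] Comp_Add[OF T X h h'(1) f] e by simp
  also have "\<dots> = Zero C T Y" using T X f h' by (simp add: Comp_Zero)
  finally obtain t where "t \<in> Hom C T K" "Zero C K X \<cdot> t = g \<boxplus> h'"
    using K T gh unfolding is_kernel_def by blast
  moreover have "K \<in> Obj C" using K by (simp add: is_kernel_def)
  ultimately have "g \<boxplus> h' = h \<boxplus> h'" using T X h' Zero_Comp by simp
  then show "g = h" using G.right_cancel[of h' g h] g h h' by simp
qed

lemma epi_if_cokernel_Zero:
  assumes K: "is_cokernel C X Y f Q (Zero C Y Q)" and X: "X \<in> Obj C" "Y \<in> Obj C"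
  shows "is_epi C X Y f"
  unfolding is_epi_def
proof (intro conjI ballI impI)
  show f: "f \<in> Hom C X Y" using K by (simp add: is_cokernel_def)
  fix T g h assume T: "T \<in> Obj C" and g: "g \<in> Hom C Y T" and h: "h \<in> Hom C Y T" and e: "g \<cdot> f = h \<cdot> f"
  interpret G: comm_group "\<lparr>carrier = Hom C Y T, monoid.mult = Add C, one = Zero C Y T\<rparr>"
    by (rule Hom_comm_group) fact+
  obtain h' where h': "h' \<in> Hom C Y T" "h \<boxplus> h' = Zero C Y T"
    using G.r_inv_ex[of h] h by auto
  have gh: "g \<boxplus> h' \<in> Hom C Y T" using T X g h' by (simp add: Add_closed)
  have "(g \<boxplus> h') \<cdot> f = (h \<boxplus> h') \<cdot> f" using Add_Comp[OF X T f g h'(1)] Add_Comp[OF X T f h h'(1)] e by simp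
  also have "\<dots> = Zero C X T" using T X f h' by (simp add: Zero_Comp)
  finally obtain t where "t \<in> Hom C Q T" "t \<cdot> Zero C Y Q = g \<boxplus> h'"
    using K T gh unfolding is_cokernel_def by blast
  moreover have "Q \<in> Obj C" using K by (simp add: is_cokernel_def)
  ultimately have "g \<boxplus> h' = h \<boxplus> h'" using T X h' Comp_Zero by simp
  then show "g = h" using G.right_cancel[of h' g h] g h h' by simp
qed

end

context abelian_category
begin

lemma mono_short_exact:
  assumes "X \<in> Obj C" "Y \<in> Obj C" "is_mono C X Y f" "is_cokernel C X Y f Q q"
  shows "short_exact C X Y Q f q"
  using mono_is_kernel[OF assms(1-3)] kernel_of_cokernel assms unfolding short_exact_def by blast

lemma epi_short_exact:
  assumes "X \<in> Obj C" "Y \<in> Obj C" "is_epi C X Y f" "is_kernel C X Y f K k"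
  shows "short_exact C K X Y k f"
  using epi_is_cokernel[OF assms(1-3)] cokernel_of_kernel assms unfolding short_exact_def by blast

text \<open>Exactness of a fibre functor is stated for short exact sequences; completing a kernel by
  its cokernel makes it applicable to kernels of arbitrary arrows.\<close>

lemma kernel_short_exact:
  assumes "X \<in> Obj C" "Y \<in> Obj C" "is_kernel C X Y f K k"
  obtains Q q where "short_exact C K X Q k q" "Q \<in> Obj C"
proof -
  have k: "K \<in> Obj C" "k \<in> Hom C K X" using assms by (auto simp: is_kernel_def)
  obtain Q q where q: "is_cokernel C K X k Q q" using cokernel_exists k assms by blast
  then have "is_kernel C X Q q K k" using assms kernel_of_cokernel by blast
  with q that show thesis by (auto simp: short_exact_def is_cokernel_def)
qed

lemma cokernel_short_exact:
  assumes "X \<in> Obj C" "Y \<in> Obj C" "is_cokernel C X Y f Q q"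
  obtains K k where "short_exact C K Y Q k q" "K \<in> Obj C"
proof -
  have q: "Q \<in> Obj C" "q \<in> Hom C Y Q" using assms by (auto simp: is_cokernel_def)
  obtain K k where k: "is_kernel C Y Q q K k" using kernel_exists q assms by blast
  then have "is_cokernel C K Y k Q q" using assms cokernel_of_kernel by blast
  with k that show thesis by (auto simp: short_exact_def is_kernel_def)
qed

end

lemma (in abelian_tensor_category) transpose_arr_props:
  assumes "is_internal_hom C X Y H e" "T \<in> Obj C" "f \<in> Hom C (T \<otimes>\<^sub>o X) Y"
  shows "transpose_arr C T X H e f \<in> Hom C T H"
    "e \<cdot> (transpose_arr C T X H e f \<otimes>\<^sub>m Id C X) = f"
proof -
  have "\<exists>!g. g \<in> Hom C T H \<and> e \<cdot> (g \<otimes>\<^sub>m Id C X) = f" using assms by (auto simp: is_internal_hom_def)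
  from theI'[OF this] show "transpose_arr C T X H e f \<in> Hom C T H"
    "e \<cdot> (transpose_arr C T X H e f \<otimes>\<^sub>m Id C X) = f"
    by (simp_all add: transpose_arr_def)
qed

lemma (in abelian_tensor_category) transpose_arr_eq:
  assumes "is_internal_hom C X Y H e" "T \<in> Obj C" "f \<in> Hom C (T \<otimes>\<^sub>o X) Y"
    "g \<in> Hom C T H" "e \<cdot> (g \<otimes>\<^sub>m Id C X) = f"
  shows "transpose_arr C T X H e f = g"
  using transpose_arr_props[OF assms(1-3)] assms unfolding is_internal_hom_def by blast

text \<open>The transposes for \<open>L\<close> are those for \<open>H\<close> composed with
  \<open>b\<close>. As with kernels, this carries the universal property from a chosen internal Hom
  to a given one.\<close>

lemma (in abelian_tensor_category) internal_hom_transport: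
  assumes H: "is_internal_hom C X Y H e" and X: "X \<in> Obj C" "Y \<in> Obj C"
    and L: "L \<in> Obj C" "a \<in> Hom C L H" "b \<in> Hom C H L" "a \<cdot> b = Id C H" "b \<cdot> a = Id C L"
  shows "is_internal_hom C X Y L (e \<cdot> (a \<otimes>\<^sub>m Id C X))"
proof -
  have h: "H \<in> Obj C" "e \<in> Hom C (H \<otimes>\<^sub>o X) Y" using H by (auto simp: is_internal_hom_def)
  have aX: "a \<otimes>\<^sub>m Id C X \<in> Hom C (L \<otimes>\<^sub>o X) (H \<otimes>\<^sub>o X)"
    using X L h by (intro TensorArr_closed Id_closed) auto
  have assoc: "(e \<cdot> (a \<otimes>\<^sub>m Id C X)) \<cdot> (g \<otimes>\<^sub>m Id C X) = e \<cdot> ((a \<cdot> g) \<otimes>\<^sub>m Id C X)"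
    if T: "T \<in> Obj C" and g: "g \<in> Hom C T L" for T g
  proof -
    have gX: "g \<otimes>\<^sub>m Id C X \<in> Hom C (T \<otimes>\<^sub>o X) (L \<otimes>\<^sub>o X)"
      using X L T g by (intro TensorArr_closed Id_closed) auto
    have "(a \<cdot> g) \<otimes>\<^sub>m (Id C X \<cdot> Id C X) = (a \<otimes>\<^sub>m Id C X) \<cdot> (g \<otimes>\<^sub>m Id C X)"
      using X L T g h by (intro TensorArr_Comp[of T L H X X X]) (auto simp: Id_closed)
    moreover have "Id C X \<cdot> Id C X = Id C X" using X by (simp add: Id_Comp Id_closed)
    moreover have "(e \<cdot> (a \<otimes>\<^sub>m Id C X)) \<cdot> (g \<otimes>\<^sub>m Id C X) = e \<cdot> ((a \<otimes>\<^sub>m Id C X) \<cdot> (g \<otimes>\<^sub>m Id C X))"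
      using X L T h aX gX by (intro Comp_assoc) (auto simp: Tensor_closed)
    ultimately show ?thesis by simp
  qed
  have "\<exists>!g. g \<in> Hom C T L \<and> (e \<cdot> (a \<otimes>\<^sub>m Id C X)) \<cdot> (g \<otimes>\<^sub>m Id C X) = f"
    if T: "T \<in> Obj C" and f: "f \<in> Hom C (T \<otimes>\<^sub>o X) Y" for T f
  proof -
    have ex1: "\<exists>!g. g \<in> Hom C T H \<and> e \<cdot> (g \<otimes>\<^sub>m Id C X) = f"
      using H T f unfolding is_internal_hom_def by blast
    then obtain g where g: "g \<in> Hom C T H" "e \<cdot> (g \<otimes>\<^sub>m Id C X) = f" by blast
    have bg: "b \<cdot> g \<in> Hom C T L" using L T h g Comp_closed by blast
    have "a \<cdot> (b \<cdot> g) = g"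
      using Comp_assoc[OF T h(1) L(1) h(1) g(1) L(3,2)] L T h g by (simp add: Id_Comp)
    then have e: "(e \<cdot> (a \<otimes>\<^sub>m Id C X)) \<cdot> ((b \<cdot> g) \<otimes>\<^sub>m Id C X) = f" using assoc[OF T bg] g by simp
    have "g' = b \<cdot> g" if g': "g' \<in> Hom C T L" "(e \<cdot> (a \<otimes>\<^sub>m Id C X)) \<cdot> (g' \<otimes>\<^sub>m Id C X) = f" for g'
    proof -
      have "a \<cdot> g' \<in> Hom C T H" using L T h g' Comp_closed by blast
      then have "a \<cdot> g' = g" using ex1 g assoc[OF T g'(1)] g'(2) by auto
      then have "b \<cdot> g = (b \<cdot> a) \<cdot> g'" using Comp_assoc[OF T L(1) h(1) L(1) g'(1) L(2,3)] by simp
      then show ?thesis using L T g' by (simp add: Id_Comp)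
    qed
    then show ?thesis using e bg by blast
  qed
  moreover have "e \<cdot> (a \<otimes>\<^sub>m Id C X) \<in> Hom C (L \<otimes>\<^sub>o X) Y"
    using X L h aX Comp_closed Tensor_closed by blast
  ultimately show ?thesis using L by (simp add: is_internal_hom_def)
qed

section \<open>Fibre functors and dimensions\<close>

lemma linear_map_mod_hom: "linear_map K V W f \<Longrightarrow> mod_hom K V W f"
  by (rule linear_map.axioms(3))

lemma mod_hom_comp:
  assumes "mod_hom K A B f" "mod_hom K B D g" shows "mod_hom K A D (\<lambda>x. g (f x))"
proof -
  interpret f: mod_hom K A B f by (rule assms)
  interpret g: mod_hom K B D g by (rule assms)
  show ?thesis
    using f.M.module_axioms g.N.module_axioms by (auto simp: mod_hom_def mod_hom_axioms_def module_hom_def)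
qed

lemma mod_hom_nsum:
  "mod_hom K A B f \<Longrightarrow> (\<And>j. j < n \<Longrightarrow> g j \<in> carrier A) \<Longrightarrow> f (nsum A g n) = nsum B (\<lambda>j. f (g j)) n"
  by (rule mod_hom.nsum_hom)

lemma (in abelian_group) nsum_split:
  assumes "\<And>j. j < n + m \<Longrightarrow> f j \<in> carrier G"
  shows "nsum G f (n + m) = nsum G f n \<oplus> nsum G (\<lambda>j. f (n + j)) m"
  using assms
proof (induction m)
  case 0
  then show ?case using nsum_closed[of n f] by simp
next
  case (Suc m)
  have "nsum G f n \<in> carrier G" "nsum G (\<lambda>j. f (n + j)) m \<in> carrier G" "f (n + m) \<in> carrier G"
    using Suc.prems by (auto intro!: nsum_closed)
  with Suc show ?case by (simp add: a_assoc)
qed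

locale neutral_tannakian = tannakian_category C + fibre_functor C W w
  for C :: "('o, 'm) tensor_cat" (structure) and W :: "'o \<Rightarrow> ('m, 'v) module" and w :: "'m \<Rightarrow> 'v \<Rightarrow> 'v"
begin

abbreviation K where "K \<equiv> End_ring C"
abbreviation dm where "dm X \<equiv> vectorspace.dim K (W X)"

lemma w_closed: "X \<in> Obj C \<Longrightarrow> Y \<in> Obj C \<Longrightarrow> f \<in> Hom C X Y \<Longrightarrow> v \<in> carrier (W X) \<Longrightarrow> w f v \<in> carrier (W Y)"
  using map_linear[THEN linear_map_mod_hom, THEN mod_hom.f_im] by blast

lemma w_Zero:
  assumes "X \<in> Obj C" "Y \<in> Obj C" "v \<in> carrier (W X)"
  shows "w (Zero C X Y) v = \<zero>\<^bsub>W Y\<^esub>"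
proof -
  interpret Y: vectorspace K "W Y" by (rule obj_vectorspace) fact
  have z: "Zero C X Y \<in> Hom C X Y" using assms by (simp add: Zero_closed)
  have c: "w (Zero C X Y) v \<in> carrier (W Y)" using assms z w_closed by blast
  have "w (Zero C X Y) v \<oplus>\<^bsub>W Y\<^esub> w (Zero C X Y) v = w (Zero C X Y) v"
    using map_Add[OF assms(1,2) z z assms(3)] Zero_Add[OF assms(1,2) z] by simp
  then show ?thesis using c by simp
qed

lemma inj_dim_le:
  assumes "X \<in> Obj C" "Y \<in> Obj C" "f \<in> Hom C X Y" "inj_on (w f) (carrier (W X))"
  shows "dm X \<le> dm Y"
  using linear_map.dim_inj[OF map_linear] assms obj_fin_dim by blast

lemma surj_dim_le:
  assumes "X \<in> Obj C" "Y \<in> Obj C" "f \<in> Hom C X Y" "w f ` carrier (W X) = carrier (W Y)"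
  shows "dm Y \<le> dm X"
  using linear_map.dim_surj[OF map_linear] assms obj_fin_dim by blast

lemma kernel_dim_le:
  assumes "X \<in> Obj C" "Y \<in> Obj C" "is_kernel C X Y f K' k"
  shows "dm K' \<le> dm X"
proof -
  obtain Q q where q: "short_exact C K' X Q k q" "Q \<in> Obj C" using kernel_short_exact[OF assms] by blast
  have k: "K' \<in> Obj C" "k \<in> Hom C K' X" using assms(3) by (auto simp: is_kernel_def)
  show ?thesis using exact[OF k(1) assms(1) q(2,1)] inj_dim_le[OF k(1) assms(1) k(2)] by blast
qed

lemma cokernel_dim_le:
  assumes "X \<in> Obj C" "Y \<in> Obj C" "is_cokernel C X Y f Q q"
  shows "dm Q \<le> dm Y"
proof -
  obtain K' k where k: "short_exact C K' Y Q k q" "K' \<in> Obj C" using cokernel_short_exact[OF assms] by blast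
  have q: "Q \<in> Obj C" "q \<in> Hom C Y Q" using assms(3) by (auto simp: is_cokernel_def)
  show ?thesis using exact[OF k(2) assms(2) q(1) k(1)] surj_dim_le[OF assms(2) q] by blast
qed

lemma w_inverse:
  assumes "X \<in> Obj C" "Y \<in> Obj C" "is_iso C X Y f" "v \<in> carrier (W X)"
  shows "w (inverse_arr C X Y f) (w f v) = v"
proof -
  have i: "is_inverse C X Y f (inverse_arr C X Y f)" using assms is_inverse_inverse_arr by blast
  have f: "f \<in> Hom C X Y" using assms by (simp add: is_iso_def)
  have "w (inverse_arr C X Y f) (w f v) = w (inverse_arr C X Y f \<cdot> f) v"
    using i f assms by (intro map_Comp[symmetric]) (auto simp: is_inverse_def)
  also have "\<dots> = v" using i assms map_Id by (simp add: is_inverse_def)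
  finally show ?thesis .
qed

lemma iso_surj:
  assumes "X \<in> Obj C" "Y \<in> Obj C" "is_iso C X Y f"
  shows "w f ` carrier (W X) = carrier (W Y)"
proof -
  have i: "is_inverse C X Y f (inverse_arr C X Y f)" using assms is_inverse_inverse_arr by blast
  have f: "f \<in> Hom C X Y" using assms by (simp add: is_iso_def)
  have "w f (w (inverse_arr C X Y f) v) = v" if "v \<in> carrier (W Y)" for v
  proof -
    have "w f (w (inverse_arr C X Y f) v) = w (f \<cdot> inverse_arr C X Y f) v"
      using i f assms that by (intro map_Comp[symmetric]) (auto simp: is_inverse_def)
    then show ?thesis using i assms that map_Id by (simp add: is_inverse_def)
  qed
  moreover have "w (inverse_arr C X Y f) v \<in> carrier (W X)" if "v \<in> carrier (W Y)" for v
    using i assms that w_closed by (simp add: is_inverse_def)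
  ultimately show ?thesis using w_closed[OF assms(1,2) f] by force
qed

lemma iso_dim_le: "X \<in> Obj C \<Longrightarrow> Y \<in> Obj C \<Longrightarrow> is_iso C X Y f \<Longrightarrow> dm Y \<le> dm X"
  using surj_dim_le[OF _ _ _ iso_surj] unfolding is_iso_def by blast

text \<open>On such an object the identity is the zero arrow, so every vector of the fibre is
  zero.\<close>

lemma zero_object_dim:
  assumes N: "N \<in> Obj C" "\<And>X. X \<in> Obj C \<Longrightarrow> \<exists>!f. f \<in> Hom C X N"
  shows "dm N = 0"
proof -
  interpret N: vectorspace K "W N" by (rule obj_vectorspace) (rule N)
  have "Id C N = Zero C N N" using N(2)[OF N(1)] N(1) Zero_closed Id_closed by blast
  then have "v = \<zero>\<^bsub>W N\<^esub>" if "v \<in> carrier (W N)" for v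
    using map_Id[OF N(1) that] w_Zero[OF N(1,1) that] by simp
  then have "spanning K (W N) 0 (\<lambda>_. \<zero>\<^bsub>W N\<^esub>)" by (auto simp: spanning_def)
  then show ?thesis using N.spanning_dim_le by blast
qed

text \<open>Applied to a vector of the fibre of \<open>P\<close>, the decomposition of the identity
  writes it as a sum of an image under \<open>w i\<close> and an image under \<open>w j\<close>; the
  images of two bases together span.\<close>

lemma biproduct_dim_le:
  assumes "X \<in> Obj C" "Y \<in> Obj C" "P \<in> Obj C"
    and i: "i \<in> Hom C X P" "j \<in> Hom C Y P" "p \<in> Hom C P X" "q \<in> Hom C P Y"
      "(i \<cdot> p) \<boxplus> (j \<cdot> q) = Id C P"
  shows "dm P \<le> dm X + dm Y"
proof -
  interpret X: vectorspace K "W X" by (rule obj_vectorspace) fact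
  interpret Y: vectorspace K "W Y" by (rule obj_vectorspace) fact
  interpret P: vectorspace K "W P" by (rule obj_vectorspace) fact
  interpret I: mod_hom K "W X" "W P" "w i" by (rule linear_map_mod_hom[OF map_linear]) fact+
  interpret J: mod_hom K "W Y" "W P" "w j" by (rule linear_map_mod_hom[OF map_linear]) fact+
  obtain b where b: "spanning K (W X) (dm X) b" using X.basis_family_exists[OF obj_fin_dim] assms(1) by blast
  obtain d where d: "spanning K (W Y) (dm Y) d" using Y.basis_family_exists[OF obj_fin_dim] assms(2) by blast
  let ?n = "dm X" and ?m = "dm Y"
  \<comment> \<open>Concatenation of the two families: indices below \<open>?n\<close> belong to
    \<open>X\<close>, the remaining ones, shifted by \<open>?n\<close>, to \<open>Y\<close>.\<close>
  let ?g = "\<lambda>k. if k < ?n then w i (b k) else w j (d (k - ?n))"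
  have bc: "b k \<in> carrier (W X)" if "k < ?n" for k using spanning_closed[OF b that] .
  have dc: "d k \<in> carrier (W Y)" if "k < ?m" for k using spanning_closed[OF d that] .
  have gc: "?g k \<in> carrier (W P)" if "k < ?n + ?m" for k using that bc dc by auto
  have "\<exists>a. (\<forall>k<?n + ?m. a k \<in> carrier K) \<and> v = nsum (W P) (\<lambda>k. a k \<odot>\<^bsub>W P\<^esub> ?g k) (?n + ?m)"
    if v: "v \<in> carrier (W P)" for v
  proof -
    have pv: "w p v \<in> carrier (W X)" and qv: "w q v \<in> carrier (W Y)"
      using assms v w_closed by blast+
    obtain a where a: "\<forall>k<?n. a k \<in> carrier K" "w p v = nsum (W X) (\<lambda>k. a k \<odot>\<^bsub>W X\<^esub> b k) ?n"
      using spanningE[OF b pv] by blast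
    obtain e where e: "\<forall>k<?m. e k \<in> carrier K" "w q v = nsum (W Y) (\<lambda>k. e k \<odot>\<^bsub>W Y\<^esub> d k) ?m"
      using spanningE[OF d qv] by blast
    let ?a = "\<lambda>k. if k < ?n then a k else e (k - ?n)"
    have ac: "?a k \<in> carrier K" if "k < ?n + ?m" for k using that a e by auto
    have 1: "w i (w p v) = nsum (W P) (\<lambda>k. ?a k \<odot>\<^bsub>W P\<^esub> ?g k) ?n"
    proof -
      have "w i (w p v) = nsum (W P) (\<lambda>k. w i (a k \<odot>\<^bsub>W X\<^esub> b k)) ?n"
        unfolding a(2) using a(1) bc by (intro I.nsum_hom) auto
      also have "\<dots> = nsum (W P) (\<lambda>k. ?a k \<odot>\<^bsub>W P\<^esub> ?g k) ?n"
        using a(1) bc by (intro nsum_cong) auto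
      finally show ?thesis .
    qed
    have 2: "w j (w q v) = nsum (W P) (\<lambda>k. ?a (?n + k) \<odot>\<^bsub>W P\<^esub> ?g (?n + k)) ?m"
    proof -
      have "w j (w q v) = nsum (W P) (\<lambda>k. w j (e k \<odot>\<^bsub>W Y\<^esub> d k)) ?m"
        unfolding e(2) using e(1) dc by (intro J.nsum_hom) auto
      also have "\<dots> = nsum (W P) (\<lambda>k. ?a (?n + k) \<odot>\<^bsub>W P\<^esub> ?g (?n + k)) ?m"
        using e(1) dc by (intro nsum_cong) auto
      finally show ?thesis .
    qed
    have "v = w ((i \<cdot> p) \<boxplus> (j \<cdot> q)) v" using i map_Id[OF assms(3) v] by simp
    also have "\<dots> = w (i \<cdot> p) v \<oplus>\<^bsub>W P\<^esub> w (j \<cdot> q) v"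
      using assms v Comp_closed by (intro map_Add[of P P]) blast+
    also have "w (i \<cdot> p) v = w i (w p v)" using assms v by (intro map_Comp) auto
    also have "w (j \<cdot> q) v = w j (w q v)" using assms v by (intro map_Comp) auto
    also have "w i (w p v) \<oplus>\<^bsub>W P\<^esub> w j (w q v) = nsum (W P) (\<lambda>k. ?a k \<odot>\<^bsub>W P\<^esub> ?g k) (?n + ?m)"
      unfolding 1 2 using ac gc by (intro P.M.nsum_split[symmetric]) auto
    finally show ?thesis using ac by (intro exI[of _ ?a]) blast
  qed
  then have "spanning K (W P) (?n + ?m) ?g" using gc unfolding spanning_def by blast
  then show ?thesis by (rule P.spanning_dim_le)
qed

text \<open>\<open>f : X \<rightarrow> Y\<close> sends the element \<open>x\<close> of \<open>\<omega>(X)\<close> to \<open>y\<close>. By faithfulness, diagrams can be checked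
  on elements, and the rules for this predicate evaluate composites.\<close>

definition sends :: "'m \<Rightarrow> 'o \<Rightarrow> 'o \<Rightarrow> 'v \<Rightarrow> 'v \<Rightarrow> bool" where
  "sends f X Y x y \<longleftrightarrow>
    X \<in> Obj C \<and> Y \<in> Obj C \<and> f \<in> Hom C X Y \<and> x \<in> carrier (W X) \<and> w f x = y"

lemma sendsI:
  "X \<in> Obj C \<Longrightarrow> Y \<in> Obj C \<Longrightarrow> f \<in> Hom C X Y \<Longrightarrow> x \<in> carrier (W X) \<Longrightarrow> sends f X Y x (w f x)"
  by (simp add: sends_def)

lemma sendsD: "sends f X Y x y \<Longrightarrow> w f x = y"
  by (simp add: sends_def)

lemma sends_closed: "sends f X Y x y \<Longrightarrow> y \<in> carrier (W Y)"
  using w_closed by (auto simp: sends_def)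

lemma sends_Comp: "sends f X Y x y \<Longrightarrow> sends g Y Z y z \<Longrightarrow> sends (g \<cdot> f) X Z x z"
  using Comp_closed map_Comp by (auto simp: sends_def)

lemma sends_Id: "X \<in> Obj C \<Longrightarrow> x \<in> carrier (W X) \<Longrightarrow> sends (Id C X) X X x x"
  using Id_closed map_Id by (auto simp: sends_def)

lemma sends_inverse:
  assumes "is_iso C X Y f" "sends f X Y x y"
  shows "sends (inverse_arr C X Y f) Y X y x"
  using assms w_inverse[of X Y f x] is_inverse_inverse_arr[of X Y f] sends_closed[OF assms(2)]
  by (auto simp: sends_def is_inverse_def)

end

locale neutral_tannakian_tensor = neutral_tannakian C W w + tensor_structure C W w c u
  for C :: "('o, 'm) tensor_cat" (structure) and W :: "'o \<Rightarrow> ('m, 'v) module"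
    and w :: "'m \<Rightarrow> 'v \<Rightarrow> 'v" and c u
begin

abbreviation one where "one \<equiv> u \<one>\<^bsub>K\<^esub>"
abbreviation tp where "tp X Y x y \<equiv> c X Y (pure_tensor K (W X) (W Y) x y)"

lemma tensor_set: "X \<in> Obj C \<Longrightarrow> Y \<in> Obj C \<Longrightarrow> tensor_setting K (W X) (W Y)"
  using obj_vectorspace[of X] obj_vectorspace[of Y] by (simp add: tensor_setting_def vectorspace_def)

lemma c_linear:
  "X \<in> Obj C \<Longrightarrow> Y \<in> Obj C \<Longrightarrow> linear_map K (tensor_module K (W X) (W Y)) (W (X \<otimes>\<^sub>o Y)) (c X Y)"
  using tensor_iso by (simp add: linear_iso_def)

lemmas c_hom = c_linear[THEN linear_map_mod_hom]

lemma c_surj: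
  "X \<in> Obj C \<Longrightarrow> Y \<in> Obj C \<Longrightarrow> c X Y ` carrier (tensor_module K (W X) (W Y)) = carrier (W (X \<otimes>\<^sub>o Y))"
  using tensor_iso by (simp add: linear_iso_def bij_betw_def)

lemma u_hom: "mod_hom K (regular_module K) (W (UnitObj C)) u"
  using unit_iso by (simp add: linear_iso_def linear_map_mod_hom)

lemma one_closed: "one \<in> carrier (W (UnitObj C))"
proof -
  interpret K: field K by (rule End_field)
  show ?thesis using mod_hom.f_im[OF u_hom] by (simp add: regular_module_def)
qed

text \<open>\<open>u\<close> is a linear bijection defined on \<open>K\<close>, so the fibre of the
  unit object is the line through \<open>one\<close>. Values of functionals are read off as scalars
  in this way.\<close>

lemma unit_elem:
  assumes "z \<in> carrier (W (UnitObj C))"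
  obtains a where "a \<in> carrier K" "z = a \<odot>\<^bsub>W (UnitObj C)\<^esub> one"
proof -
  interpret K: field K by (rule End_field)
  interpret u: mod_hom K "regular_module K" "W (UnitObj C)" u by (rule u_hom)
  obtain a where a: "a \<in> carrier K" "z = u a"
    using unit_iso assms by (auto simp: linear_iso_def bij_betw_def regular_module_def)
  have "u (a \<odot>\<^bsub>regular_module K\<^esub> \<one>\<^bsub>K\<^esub>) = a \<odot>\<^bsub>W (UnitObj C)\<^esub> one"
    using a by (intro u.f_smult) (auto simp: regular_module_def)
  then show thesis using a that by (simp add: regular_module_def)
qed

lemma tp_closed:
  assumes "X \<in> Obj C" "Y \<in> Obj C" "x \<in> carrier (W X)" "y \<in> carrier (W Y)"
  shows "tp X Y x y \<in> carrier (W (X \<otimes>\<^sub>o Y))"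
  using mod_hom.f_im[OF c_hom] tensor_setting.pure_closed[OF tensor_set] assms by blast

lemma tp_hom_left:
  assumes "X \<in> Obj C" "Y \<in> Obj C" "y \<in> carrier (W Y)"
  shows "mod_hom K (W X) (W (X \<otimes>\<^sub>o Y)) (\<lambda>x. tp X Y x y)"
  using mod_hom_comp[OF tensor_setting.pure_hom_left[OF tensor_set] c_hom] assms by blast

lemma tp_hom_right:
  assumes "X \<in> Obj C" "Y \<in> Obj C" "x \<in> carrier (W X)"
  shows "mod_hom K (W Y) (W (X \<otimes>\<^sub>o Y)) (tp X Y x)"
  using mod_hom_comp[OF tensor_setting.pure_hom_right[OF tensor_set] c_hom] assms by blast

lemma sends_tensor:
  assumes "sends f X X' x x'" "sends g Y Y' y y'"
  shows "sends (f \<otimes>\<^sub>m g) (X \<otimes>\<^sub>o Y) (X' \<otimes>\<^sub>o Y') (tp X Y x y) (tp X' Y' x' y')"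
  using assms tensor_natural[of X X' Y Y' f g x y] TensorArr_closed Tensor_closed tp_closed
  by (auto simp: sends_def)

lemma sends_Assoc:
  assumes "X \<in> Obj C" "Y \<in> Obj C" "Z \<in> Obj C" "x \<in> carrier (W X)" "y \<in> carrier (W Y)" "z \<in> carrier (W Z)"
  shows "sends (Assoc C X Y Z) (X \<otimes>\<^sub>o (Y \<otimes>\<^sub>o Z)) ((X \<otimes>\<^sub>o Y) \<otimes>\<^sub>o Z)
    (tp X (Y \<otimes>\<^sub>o Z) x (tp Y Z y z)) (tp (X \<otimes>\<^sub>o Y) Z (tp X Y x y) z)"
  using assms tensor_assoc[OF assms] Tensor_closed tp_closed Assoc_iso
  by (simp add: sends_def is_iso_def)

lemma sends_Comm:
  assumes "X \<in> Obj C" "Y \<in> Obj C" "x \<in> carrier (W X)" "y \<in> carrier (W Y)"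
  shows "sends (Comm C X Y) (X \<otimes>\<^sub>o Y) (Y \<otimes>\<^sub>o X) (tp X Y x y) (tp Y X y x)"
  using assms tensor_comm[OF assms] Tensor_closed tp_closed Comm_iso
  by (simp add: sends_def is_iso_def)

lemma sends_UnitIso:
  assumes "X \<in> Obj C" "x \<in> carrier (W X)"
  shows "sends (UnitIso C X) X (UnitObj C \<otimes>\<^sub>o X) x (tp (UnitObj C) X one x)"
  using assms tensor_unit[OF assms] Tensor_closed UnitObj_closed tp_closed one_closed UnitIso_iso
  by (simp add: sends_def is_iso_def)

text \<open>The map \<open>c X Y\<close> is onto and pure tensors generate, so two linear maps on
  the fibre of the tensor product agree once they agree on the elements \<open>tp X Y x y\<close>;
  faithfulness does the rest. The hypothesis has the shape in which the rules for
  \<open>sends\<close> deliver values.\<close>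

lemma arr_ext_tensor:
  assumes X: "X \<in> Obj C" "Y \<in> Obj C" "Z \<in> Obj C" "f \<in> Hom C (X \<otimes>\<^sub>o Y) Z" "g \<in> Hom C (X \<otimes>\<^sub>o Y) Z"
    and eq: "\<And>x y. x \<in> carrier (W X) \<Longrightarrow> y \<in> carrier (W Y) \<Longrightarrow>
      \<exists>z. sends f (X \<otimes>\<^sub>o Y) Z (tp X Y x y) z \<and> sends g (X \<otimes>\<^sub>o Y) Z (tp X Y x y) z"
  shows "f = g"
proof (rule faithful[OF Tensor_closed[OF X(1,2)] X(3-5)])
  fix v assume "v \<in> carrier (W (X \<otimes>\<^sub>o Y))"
  then obtain t where t: "t \<in> carrier (tensor_module K (W X) (W Y))" "v = c X Y t"
    using c_surj[OF X(1,2)] by auto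
  have hom: "mod_hom K (tensor_module K (W X) (W Y)) (W Z) (\<lambda>t. w h (c X Y t))"
    if "h \<in> Hom C (X \<otimes>\<^sub>o Y) Z" for h
    using that X Tensor_closed by (intro mod_hom_comp[OF c_hom linear_map_mod_hom[OF map_linear]]) auto
  have "w f (c X Y t) = w g (c X Y t)"
  proof (rule tensor_setting.hom_ext[OF tensor_set[OF X(1,2)] hom hom _ t(1)])
    fix x y assume "x \<in> carrier (W X)" "y \<in> carrier (W Y)"
    then show "w f (tp X Y x y) = w g (tp X Y x y)" using eq[of x y] by (auto simp: sends_def)
  qed (use X in auto)
  then show "w f v = w g v" by (simp add: t)
qed

lemma tensor_dim_le:
  assumes "X \<in> Obj C" "Y \<in> Obj C" shows "dm (X \<otimes>\<^sub>o Y) \<le> dm X * dm Y"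
proof -
  let ?T = "tensor_module K (W X) (W Y)"
  note vs = obj_vectorspace[OF assms(1)] obj_fin_dim[OF assms(1)]
    obj_vectorspace[OF assms(2)] obj_fin_dim[OF assms(2)]
  have "dm (X \<otimes>\<^sub>o Y) \<le> vectorspace.dim K ?T"
    using linear_map.dim_surj[OF c_linear tensor_fin_dim(1)[OF vs] c_surj] assms by blast
  also have "\<dots> \<le> dm X * dm Y" by (rule tensor_fin_dim(2)[OF vs])
  finally show ?thesis .
qed

lemma unit_dim_le: "dm (UnitObj C) \<le> 1"
proof -
  interpret U: vectorspace K "W (UnitObj C)" by (rule obj_vectorspace) (rule UnitObj_closed)
  have "spanning K (W (UnitObj C)) 1 (\<lambda>_. one)"
    unfolding spanning_def
  proof (intro conjI ballI allI impI)
    fix v assume "v \<in> carrier (W (UnitObj C))"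
    then obtain a where a: "a \<in> carrier K" "v = a \<odot>\<^bsub>W (UnitObj C)\<^esub> one" by (rule unit_elem)
    then have "v = nsum (W (UnitObj C)) (\<lambda>j. a \<odot>\<^bsub>W (UnitObj C)\<^esub> one) 1" using one_closed by simp
    then show "\<exists>b. (\<forall>j<1. b j \<in> carrier K) \<and> v = nsum (W (UnitObj C)) (\<lambda>j. b j \<odot>\<^bsub>W (UnitObj C)\<^esub> one) 1"
      using a(1) by (intro exI[of _ "\<lambda>_. a"]) simp
  qed (rule one_closed)
  then show ?thesis by (rule U.spanning_dim_le)
qed

end

section \<open>Duals and internal Homs\<close>

context neutral_tannakian_tensor
begin

lemma tp_smult_left:
  assumes "X \<in> Obj C" "Y \<in> Obj C" "a \<in> carrier K" "x \<in> carrier (W X)" "y \<in> carrier (W Y)"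
  shows "tp X Y (a \<odot>\<^bsub>W X\<^esub> x) y = a \<odot>\<^bsub>W (X \<otimes>\<^sub>o Y)\<^esub> tp X Y x y"
proof -
  interpret mod_hom K "W X" "W (X \<otimes>\<^sub>o Y)" "\<lambda>x. tp X Y x y" by (rule tp_hom_left) fact+
  show ?thesis using assms by (intro f_smult)
qed

lemma tp_smult_right:
  assumes "X \<in> Obj C" "Y \<in> Obj C" "a \<in> carrier K" "x \<in> carrier (W X)" "y \<in> carrier (W Y)"
  shows "tp X Y x (a \<odot>\<^bsub>W Y\<^esub> y) = a \<odot>\<^bsub>W (X \<otimes>\<^sub>o Y)\<^esub> tp X Y x y"
proof -
  interpret mod_hom K "W Y" "W (X \<otimes>\<^sub>o Y)" "tp X Y x" by (rule tp_hom_right) fact+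
  show ?thesis using assms by (intro f_smult)
qed

text \<open>The five factors of the interchange are evaluated one after the other, starting from the
  rightmost: rebracket, swap \<open>b\<close> and \<open>x\<close>, rebracket again.\<close>

lemma sends_interchange:
  assumes "A \<in> Obj C" "B \<in> Obj C" "X \<in> Obj C" "Y \<in> Obj C"
    "a \<in> carrier (W A)" "b \<in> carrier (W B)" "x \<in> carrier (W X)" "y \<in> carrier (W Y)"
  shows "sends (interchange C A B X Y) ((A \<otimes>\<^sub>o B) \<otimes>\<^sub>o (X \<otimes>\<^sub>o Y)) ((A \<otimes>\<^sub>o X) \<otimes>\<^sub>o (B \<otimes>\<^sub>o Y))
    (tp (A \<otimes>\<^sub>o B) (X \<otimes>\<^sub>o Y) (tp A B a b) (tp X Y x y)) (tp (A \<otimes>\<^sub>o X) (B \<otimes>\<^sub>o Y) (tp A X a x) (tp B Y b y))"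
proof -
  note side = assms Tensor_closed tp_closed Assoc_iso
  have 1: "sends (inverse_arr C (A \<otimes>\<^sub>o (B \<otimes>\<^sub>o (X \<otimes>\<^sub>o Y))) ((A \<otimes>\<^sub>o B) \<otimes>\<^sub>o (X \<otimes>\<^sub>o Y)) (Assoc C A B (X \<otimes>\<^sub>o Y)))
      ((A \<otimes>\<^sub>o B) \<otimes>\<^sub>o (X \<otimes>\<^sub>o Y)) (A \<otimes>\<^sub>o (B \<otimes>\<^sub>o (X \<otimes>\<^sub>o Y)))
      (tp (A \<otimes>\<^sub>o B) (X \<otimes>\<^sub>o Y) (tp A B a b) (tp X Y x y))
      (tp A (B \<otimes>\<^sub>o (X \<otimes>\<^sub>o Y)) a (tp B (X \<otimes>\<^sub>o Y) b (tp X Y x y)))"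
    by (intro sends_inverse sends_Assoc side)
  have 2: "sends (Id C A \<otimes>\<^sub>m Assoc C B X Y) (A \<otimes>\<^sub>o (B \<otimes>\<^sub>o (X \<otimes>\<^sub>o Y))) (A \<otimes>\<^sub>o ((B \<otimes>\<^sub>o X) \<otimes>\<^sub>o Y))
      (tp A (B \<otimes>\<^sub>o (X \<otimes>\<^sub>o Y)) a (tp B (X \<otimes>\<^sub>o Y) b (tp X Y x y)))
      (tp A ((B \<otimes>\<^sub>o X) \<otimes>\<^sub>o Y) a (tp (B \<otimes>\<^sub>o X) Y (tp B X b x) y))"
    by (intro sends_tensor sends_Id sends_Assoc side)
  have 3: "sends (Id C A \<otimes>\<^sub>m (Comm C B X \<otimes>\<^sub>m Id C Y)) (A \<otimes>\<^sub>o ((B \<otimes>\<^sub>o X) \<otimes>\<^sub>o Y)) (A \<otimes>\<^sub>o ((X \<otimes>\<^sub>o B) \<otimes>\<^sub>o Y))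
      (tp A ((B \<otimes>\<^sub>o X) \<otimes>\<^sub>o Y) a (tp (B \<otimes>\<^sub>o X) Y (tp B X b x) y))
      (tp A ((X \<otimes>\<^sub>o B) \<otimes>\<^sub>o Y) a (tp (X \<otimes>\<^sub>o B) Y (tp X B x b) y))"
    by (intro sends_tensor sends_Id sends_Comm side)
  have 4: "sends (Id C A \<otimes>\<^sub>m inverse_arr C (X \<otimes>\<^sub>o (B \<otimes>\<^sub>o Y)) ((X \<otimes>\<^sub>o B) \<otimes>\<^sub>o Y) (Assoc C X B Y))
      (A \<otimes>\<^sub>o ((X \<otimes>\<^sub>o B) \<otimes>\<^sub>o Y)) (A \<otimes>\<^sub>o (X \<otimes>\<^sub>o (B \<otimes>\<^sub>o Y)))
      (tp A ((X \<otimes>\<^sub>o B) \<otimes>\<^sub>o Y) a (tp (X \<otimes>\<^sub>o B) Y (tp X B x b) y))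
      (tp A (X \<otimes>\<^sub>o (B \<otimes>\<^sub>o Y)) a (tp X (B \<otimes>\<^sub>o Y) x (tp B Y b y)))"
    by (intro sends_tensor sends_Id sends_inverse sends_Assoc side)
  have 5: "sends (Assoc C A X (B \<otimes>\<^sub>o Y)) (A \<otimes>\<^sub>o (X \<otimes>\<^sub>o (B \<otimes>\<^sub>o Y))) ((A \<otimes>\<^sub>o X) \<otimes>\<^sub>o (B \<otimes>\<^sub>o Y))
      (tp A (X \<otimes>\<^sub>o (B \<otimes>\<^sub>o Y)) a (tp X (B \<otimes>\<^sub>o Y) x (tp B Y b y)))
      (tp (A \<otimes>\<^sub>o X) (B \<otimes>\<^sub>o Y) (tp A X a x) (tp B Y b y))"
    by (intro sends_Assoc side)
  show ?thesis unfolding interchange_def by (rule sends_Comp[OF sends_Comp[OF sends_Comp[OF sends_Comp[OF 1 2] 3] 4] 5])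
qed

text \<open>The right unit constraint from \<open>X \<otimes> \<one>\<close> to \<open>X\<close>,
  obtained from the left one by commutativity.\<close>

definition rho where
  "rho X = inverse_arr C X (UnitObj C \<otimes>\<^sub>o X) (UnitIso C X) \<cdot> Comm C X (UnitObj C)"

definition rho_inv where
  "rho_inv X = Comm C (UnitObj C) X \<cdot> UnitIso C X"

lemma sends_rho:
  "X \<in> Obj C \<Longrightarrow> x \<in> carrier (W X) \<Longrightarrow> sends (rho X) (X \<otimes>\<^sub>o UnitObj C) X (tp X (UnitObj C) x one) x"
  unfolding rho_def
  by (rule sends_Comp[OF sends_Comm sends_inverse[OF UnitIso_iso sends_UnitIso]])
    (auto intro: UnitObj_closed one_closed)

lemma sends_rho_inv:
  "X \<in> Obj C \<Longrightarrow> x \<in> carrier (W X) \<Longrightarrow> sends (rho_inv X) X (X \<otimes>\<^sub>o UnitObj C) x (tp X (UnitObj C) x one)"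
  unfolding rho_inv_def
  by (rule sends_Comp[OF sends_UnitIso sends_Comm]) (auto intro: UnitObj_closed one_closed)

lemma tensor_unit_elem:
  assumes X: "X \<in> Obj C" and z: "z \<in> carrier (W (X \<otimes>\<^sub>o UnitObj C))"
  obtains x where "x \<in> carrier (W X)" "z = tp X (UnitObj C) x one"
proof -
  have "w (UnitIso C X) ` carrier (W X) = carrier (W (UnitObj C \<otimes>\<^sub>o X))"
    using X UnitObj_closed Tensor_closed UnitIso_iso by (intro iso_surj)
  moreover have "w (Comm C (UnitObj C) X) ` carrier (W (UnitObj C \<otimes>\<^sub>o X)) = carrier (W (X \<otimes>\<^sub>o UnitObj C))"
    using X UnitObj_closed Tensor_closed Comm_iso by (intro iso_surj)
  ultimately obtain x where x: "x \<in> carrier (W X)" "z = w (Comm C (UnitObj C) X) (w (UnitIso C X) x)"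
    using z by (metis imageE)
  then have "z = tp X (UnitObj C) x one"
    using sendsD[OF sends_UnitIso[OF X x(1)]] sendsD[OF sends_Comm[OF UnitObj_closed X one_closed x(1)]]
    by simp
  with x that show thesis by blast
qed

lemma rho_closed: "X \<in> Obj C \<Longrightarrow> rho X \<in> Hom C (X \<otimes>\<^sub>o UnitObj C) X"
  using Comm_iso[of X "UnitObj C"] is_inverse_inverse_arr[OF _ _ UnitIso_iso, of X]
    Comp_closed[of "X \<otimes>\<^sub>o UnitObj C" "UnitObj C \<otimes>\<^sub>o X" X] UnitObj_closed Tensor_closed
  by (auto simp: rho_def is_iso_def is_inverse_def)

lemma rho_inv_closed: "X \<in> Obj C \<Longrightarrow> rho_inv X \<in> Hom C X (X \<otimes>\<^sub>o UnitObj C)"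
  using Comm_iso[of "UnitObj C" X] UnitIso_iso[of X]
    Comp_closed[of X "UnitObj C \<otimes>\<^sub>o X" "X \<otimes>\<^sub>o UnitObj C"] UnitObj_closed Tensor_closed
  by (auto simp: rho_inv_def is_iso_def)

text \<open>An arrow out of \<open>T \<otimes> \<one>\<close> is the same as an arrow out of
  \<open>T\<close>. All verifications take place on the elements \<open>t \<otimes> one\<close>,
  which by \<open>tensor_unit_elem\<close> exhaust the fibre of
  \<open>T \<otimes> \<one>\<close>.\<close>

lemma unit_internal_hom:
  assumes Y: "Y \<in> Obj C" shows "is_internal_hom C (UnitObj C) Y Y (rho Y)"
  unfolding is_internal_hom_def
proof (intro conjI ballI)
  let ?I = "UnitObj C"
  fix T f assume T: "T \<in> Obj C" and f: "f \<in> Hom C (T \<otimes>\<^sub>o ?I) Y"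
  \<comment> \<open>The transpose of \<open>f\<close>: the right unit constraint is undone
    first.\<close>
  define g where "g = f \<cdot> rho_inv T"
  have TI: "T \<otimes>\<^sub>o ?I \<in> Obj C" using T UnitObj_closed by (rule Tensor_closed)
  have g: "g \<in> Hom C T Y" unfolding g_def using T TI Y f rho_inv_closed Comp_closed by blast
  have send_g: "sends g T Y t (w f (tp T ?I t one))" if "t \<in> carrier (W T)" for t
    unfolding g_def using T TI Y f that
    by (intro sends_Comp[OF sends_rho_inv] sendsI tp_closed UnitObj_closed one_closed)
  have eval: "sends (rho Y \<cdot> (h \<otimes>\<^sub>m Id C ?I)) (T \<otimes>\<^sub>o ?I) Y (tp T ?I t one) (w h t)"
    if h: "h \<in> Hom C T Y" and t: "t \<in> carrier (W T)" for h t
    using h t T Y w_closed[OF T Y h t]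
    by (intro sends_Comp[OF sends_tensor sends_rho] sendsI sends_Id UnitObj_closed one_closed)
  have ext: "h = h'" if "h \<in> Hom C (T \<otimes>\<^sub>o ?I) Y" "h' \<in> Hom C (T \<otimes>\<^sub>o ?I) Y"
    and "\<And>t. t \<in> carrier (W T) \<Longrightarrow> w h (tp T ?I t one) = w h' (tp T ?I t one)" for h h'
    using TI Y that(1,2) by (rule faithful) (metis tensor_unit_elem[OF T] that(3))
  have cl: "rho Y \<cdot> (h \<otimes>\<^sub>m Id C ?I) \<in> Hom C (T \<otimes>\<^sub>o ?I) Y" if "h \<in> Hom C T Y" for h
    using that T Y UnitObj_closed Tensor_closed TensorArr_closed Id_closed rho_closed Comp_closed by meson
  show "\<exists>!g. g \<in> Hom C T Y \<and> rho Y \<cdot> (g \<otimes>\<^sub>m Id C ?I) = f"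
  proof (rule ex1I[of _ g])
    show "g \<in> Hom C T Y \<and> rho Y \<cdot> (g \<otimes>\<^sub>m Id C ?I) = f"
    proof
      show "rho Y \<cdot> (g \<otimes>\<^sub>m Id C ?I) = f"
        by (rule ext[OF cl[OF g] f]) (simp add: sendsD[OF eval[OF g]] sendsD[OF send_g])
    qed (rule g)
    fix h assume h: "h \<in> Hom C T Y \<and> rho Y \<cdot> (h \<otimes>\<^sub>m Id C ?I) = f"
    have "w h t = w g t" if "t \<in> carrier (W T)" for t
      using sendsD[OF eval[of h t]] sendsD[OF send_g[OF that]] h that by simp
    then show "h = g" using faithful[OF T Y _ g, of h] h by blast
  qed
qed (use Y rho_closed in auto)

definition unit_shift_eval where
  "unit_shift_eval H X Y e = UnitIso C Y \<cdot> e \<cdot> (Id C H \<otimes>\<^sub>m rho X)"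

lemma sends_unit_shift_eval:
  assumes "X \<in> Obj C" "Y \<in> Obj C" "H \<in> Obj C" "e \<in> Hom C (H \<otimes>\<^sub>o X) Y"
    "h \<in> carrier (W H)" "x \<in> carrier (W X)"
  shows "sends (unit_shift_eval H X Y e) (H \<otimes>\<^sub>o (X \<otimes>\<^sub>o UnitObj C)) (UnitObj C \<otimes>\<^sub>o Y)
    (tp H (X \<otimes>\<^sub>o UnitObj C) h (tp X (UnitObj C) x one)) (tp (UnitObj C) Y one (w e (tp H X h x)))"
proof -
  have "H \<otimes>\<^sub>o X \<in> Obj C" "tp H X h x \<in> carrier (W (H \<otimes>\<^sub>o X))"
    using assms Tensor_closed tp_closed by auto
  moreover from this have "w e (tp H X h x) \<in> carrier (W Y)" using assms w_closed by blast
  ultimately show ?thesis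
    unfolding unit_shift_eval_def
    using assms by (intro sends_Comp[OF sends_Comp[OF sends_tensor[OF sends_Id sends_rho] sendsI] sends_UnitIso])
qed

text \<open>The rigidity axiom for the pairs \<open>(X, \<one>)\<close> and
  \<open>(\<one>, Y)\<close> has an internal Hom from \<open>X \<otimes> \<one>\<close> to
  \<open>\<one> \<otimes> Y\<close> as its target. Since the axiom holds for every choice of
  internal Homs, \<open>H\<close> itself can be that target, with its evaluation shifted by the unit
  constraints.\<close>

lemma unit_shift_internal_hom:
  assumes H: "is_internal_hom C X Y H e" and X: "X \<in> Obj C" and Y: "Y \<in> Obj C"
  shows "is_internal_hom C (X \<otimes>\<^sub>o UnitObj C) (UnitObj C \<otimes>\<^sub>o Y) H (unit_shift_eval H X Y e)"
  unfolding is_internal_hom_def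
proof (intro conjI ballI)
  let ?I = "UnitObj C" let ?e = "unit_shift_eval H X Y e"
  let ?XI = "X \<otimes>\<^sub>o ?I" and ?IY = "?I \<otimes>\<^sub>o Y"
  have I: "?I \<in> Obj C" by (rule UnitObj_closed)
  have XI: "?XI \<in> Obj C" and IY: "?IY \<in> Obj C" using X Y I Tensor_closed by auto
  show Hc: "H \<in> Obj C" using H by (simp add: is_internal_hom_def)
  have e: "e \<in> Hom C (H \<otimes>\<^sub>o X) Y" using H by (simp add: is_internal_hom_def)
  have U: "UnitIso C Y \<in> Hom C Y ?IY" using UnitIso_iso[OF Y] by (simp add: is_iso_def)
  have "Id C H \<otimes>\<^sub>m rho X \<in> Hom C (H \<otimes>\<^sub>o ?XI) (H \<otimes>\<^sub>o X)"
    using Hc X XI by (intro TensorArr_closed Id_closed rho_closed)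
  then show ec: "?e \<in> Hom C (H \<otimes>\<^sub>o ?XI) ?IY"
    unfolding unit_shift_eval_def using e U Hc X Y XI IY Tensor_closed Comp_closed by meson
  fix T f assume T: "T \<in> Obj C" and f: "f \<in> Hom C (T \<otimes>\<^sub>o ?XI) ?IY"
  have TX: "T \<otimes>\<^sub>o X \<in> Obj C" and TXI: "T \<otimes>\<^sub>o ?XI \<in> Obj C" using T X XI Tensor_closed by auto
  let ?V = "inverse_arr C Y ?IY (UnitIso C Y)"
  have V: "?V \<in> Hom C ?IY Y"
    using is_inverse_inverse_arr[OF Y IY UnitIso_iso[OF Y]] by (simp add: is_inverse_def)
  \<comment> \<open>\<open>f\<close> with both unit constraints undone. Its transpose with respect
    to \<open>e\<close> is the transpose of \<open>f\<close> with respect to the shifted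
    evaluation.\<close>
  define f' where "f' = ?V \<cdot> f \<cdot> (Id C T \<otimes>\<^sub>m rho_inv X)"
  have "Id C T \<otimes>\<^sub>m rho_inv X \<in> Hom C (T \<otimes>\<^sub>o X) (T \<otimes>\<^sub>o ?XI)"
    using T X XI by (intro TensorArr_closed Id_closed rho_inv_closed)
  then have f': "f' \<in> Hom C (T \<otimes>\<^sub>o X) Y" unfolding f'_def using f V TX TXI Y IY Comp_closed by meson
  have send_f': "sends f' (T \<otimes>\<^sub>o X) Y (tp T X t x) (w ?V (w f (tp T ?XI t (tp X ?I x one))))"
    if t: "t \<in> carrier (W T)" and x: "x \<in> carrier (W X)" for t x
  proof -
    have z: "tp T ?XI t (tp X ?I x one) \<in> carrier (W (T \<otimes>\<^sub>o ?XI))"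
      using T X XI I t x one_closed tp_closed by simp
    show ?thesis unfolding f'_def
      using T X Y XI IY TXI V f t x z w_closed[OF TXI IY f z]
      by (intro sends_Comp[OF sends_Comp[OF sends_tensor[OF sends_Id sends_rho_inv] sendsI] sendsI])
  qed
  have eval: "sends (?e \<cdot> (h \<otimes>\<^sub>m Id C ?XI)) (T \<otimes>\<^sub>o ?XI) ?IY (tp T ?XI t (tp X ?I x one))
      (tp ?I Y one (w e (tp H X (w h t) x)))"
    if h: "h \<in> Hom C T H" and t: "t \<in> carrier (W T)" and x: "x \<in> carrier (W X)" for h t x
    using T X Y XI Hc I e h t x w_closed[OF T Hc h t] one_closed tp_closed
    by (intro sends_Comp[OF sends_tensor[OF sendsI sends_Id] sends_unit_shift_eval])
  have eval0: "sends (e \<cdot> (h \<otimes>\<^sub>m Id C X)) (T \<otimes>\<^sub>o X) Y (tp T X t x) (w e (tp H X (w h t) x))"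
    if h: "h \<in> Hom C T H" and t: "t \<in> carrier (W T)" and x: "x \<in> carrier (W X)" for h t x
    using T X Y Hc e h t x w_closed[OF T Hc h t] Tensor_closed tp_closed
    by (intro sends_Comp[OF sends_tensor[OF sendsI sends_Id] sendsI])
  have cl0: "e \<cdot> (h \<otimes>\<^sub>m Id C X) \<in> Hom C (T \<otimes>\<^sub>o X) Y" if "h \<in> Hom C T H" for h
    using that e T X Y Hc TX Tensor_closed TensorArr_closed Id_closed Comp_closed by meson
  have cl: "?e \<cdot> (h \<otimes>\<^sub>m Id C ?XI) \<in> Hom C (T \<otimes>\<^sub>o ?XI) ?IY" if "h \<in> Hom C T H" for h
    using that ec T XI IY Hc TXI Tensor_closed TensorArr_closed Id_closed Comp_closed by meson
  have unitV: "w ?V (tp ?I Y one y) = y" if "y \<in> carrier (W Y)" for y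
    using sendsD[OF sends_inverse[OF UnitIso_iso[OF Y] sends_UnitIso[OF Y that]]] .
  have unitV': "tp ?I Y one (w ?V z) = z" if z: "z \<in> carrier (W ?IY)" for z
  proof -
    have "z \<in> w (UnitIso C Y) ` carrier (W Y)" using iso_surj[OF Y IY UnitIso_iso[OF Y]] z by simp
    then obtain y where y: "y \<in> carrier (W Y)" "z = w (UnitIso C Y) y" by blast
    then have "z = tp ?I Y one y" using sendsD[OF sends_UnitIso[OF Y y(1)]] by simp
    then show ?thesis using unitV[OF y(1)] by simp
  qed
  have ex1: "\<exists>!g. g \<in> Hom C T H \<and> e \<cdot> (g \<otimes>\<^sub>m Id C X) = f'"
    using H T f' unfolding is_internal_hom_def by blast
  then obtain g where g: "g \<in> Hom C T H" "e \<cdot> (g \<otimes>\<^sub>m Id C X) = f'" by blast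
  show "\<exists>!g. g \<in> Hom C T H \<and> ?e \<cdot> (g \<otimes>\<^sub>m Id C ?XI) = f"
  proof (rule ex1I[of _ g])
    show "g \<in> Hom C T H \<and> ?e \<cdot> (g \<otimes>\<^sub>m Id C ?XI) = f"
    proof
      show "?e \<cdot> (g \<otimes>\<^sub>m Id C ?XI) = f"
      proof (rule arr_ext_tensor[OF T XI IY cl[OF g(1)] f])
        fix t z assume t: "t \<in> carrier (W T)" and z: "z \<in> carrier (W ?XI)"
        obtain x where x: "x \<in> carrier (W X)" "z = tp X ?I x one" by (rule tensor_unit_elem[OF X z])
        have fz: "w f (tp T ?XI t z) \<in> carrier (W ?IY)" using T XI TXI IY f t z w_closed tp_closed by blast
        have "w e (tp H X (w g t) x) = w ?V (w f (tp T ?XI t z))"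
          using sendsD[OF eval0[OF g(1) t x(1)]] sendsD[OF send_f'[OF t x(1)]] g(2) x(2) by simp
        then have "sends (?e \<cdot> (g \<otimes>\<^sub>m Id C ?XI)) (T \<otimes>\<^sub>o ?XI) ?IY (tp T ?XI t z) (w f (tp T ?XI t z))"
          using eval[OF g(1) t x(1)] unitV'[OF fz] x(2) by simp
        then show "\<exists>y. sends (?e \<cdot> (g \<otimes>\<^sub>m Id C ?XI)) (T \<otimes>\<^sub>o ?XI) ?IY (tp T ?XI t z) y \<and>
            sends f (T \<otimes>\<^sub>o ?XI) ?IY (tp T ?XI t z) y"
          using sendsI[OF TXI IY f tp_closed[OF T XI t z]] by blast
      qed
    qed (rule g(1))
    fix h assume h: "h \<in> Hom C T H \<and> ?e \<cdot> (h \<otimes>\<^sub>m Id C ?XI) = f"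
    have "e \<cdot> (h \<otimes>\<^sub>m Id C X) = f'"
    proof (rule arr_ext_tensor[OF T X Y cl0 f'])
      fix t x assume t: "t \<in> carrier (W T)" and x: "x \<in> carrier (W X)"
      have y: "w e (tp H X (w h t) x) \<in> carrier (W Y)"
        using eval0[of h t x] h t x sends_closed by blast
      have "w f (tp T ?XI t (tp X ?I x one)) = tp ?I Y one (w e (tp H X (w h t) x))"
        using sendsD[OF eval[of h t x]] h t x by simp
      then have "sends f' (T \<otimes>\<^sub>o X) Y (tp T X t x) (w e (tp H X (w h t) x))"
        using send_f'[OF t x] unitV[OF y] by simp
      then show "\<exists>y. sends (e \<cdot> (h \<otimes>\<^sub>m Id C X)) (T \<otimes>\<^sub>o X) Y (tp T X t x) y \<and> sends f' (T \<otimes>\<^sub>o X) Y (tp T X t x) y"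
        using eval0 h t x by blast
    qed (use h in blast)
    then show "h = g" using ex1 g h by blast
  qed
qed

text \<open>Here \<open>m\<close> is the canonical map \<open>Hom(X, \<one>) \<otimes> Hom(\<one>, Y) \<rightarrow> Hom(X \<otimes> \<one>, \<one> \<otimes> Y)\<close>, with
  \<open>Hom(\<one>, Y) = Y\<close>.\<close>

lemma dual_tensor_iso:
  assumes X: "X \<in> Obj C" and Y: "Y \<in> Obj C"
    and D: "is_internal_hom C X (UnitObj C) D e" and H: "is_internal_hom C X Y H h"
  obtains m where "is_iso C (D \<otimes>\<^sub>o Y) H m"
    "\<And>d y x a. \<lbrakk>d \<in> carrier (W D); y \<in> carrier (W Y); x \<in> carrier (W X); a \<in> carrier K;
        w e (tp D X d x) = a \<odot>\<^bsub>W (UnitObj C)\<^esub> one\<rbrakk>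
      \<Longrightarrow> w h (tp H X (w m (tp D Y d y)) x) = a \<odot>\<^bsub>W Y\<^esub> y"
proof -
  let ?I = "UnitObj C" let ?h = "unit_shift_eval H X Y h"
  let ?XI = "X \<otimes>\<^sub>o ?I" and ?IY = "?I \<otimes>\<^sub>o Y" and ?DY = "D \<otimes>\<^sub>o Y"
  have I: "?I \<in> Obj C" by (rule UnitObj_closed)
  have Dc: "D \<in> Obj C" "e \<in> Hom C (D \<otimes>\<^sub>o X) ?I" using D by (auto simp: is_internal_hom_def)
  have Hc: "H \<in> Obj C" "h \<in> Hom C (H \<otimes>\<^sub>o X) Y" using H by (auto simp: is_internal_hom_def)
  have XI: "?XI \<in> Obj C" and IY: "?IY \<in> Obj C" and DY: "?DY \<in> Obj C"
    using X Y I Dc Tensor_closed by auto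
  note H' = unit_shift_internal_hom[OF H X Y]
  let ?f = "(e \<otimes>\<^sub>m rho Y) \<cdot> interchange C D Y X ?I"
  define m where "m = transpose_arr C ?DY ?XI H ?h ?f"
  have iso: "is_iso C ?DY H m"
    unfolding m_def by (rule internal_hom_tensor[OF X I I Y D unit_internal_hom[OF Y] H'])
  have m: "m \<in> Hom C ?DY H" using iso by (simp add: is_iso_def)
  have sf: "sends ?f (?DY \<otimes>\<^sub>o ?XI) ?IY (tp ?DY ?XI (tp D Y d y) (tp X ?I x one)) (tp ?I Y (w e (tp D X d x)) y)"
    if "d \<in> carrier (W D)" "y \<in> carrier (W Y)" "x \<in> carrier (W X)" for d y x
    using that X Y I Dc one_closed Tensor_closed tp_closed
    by (intro sends_Comp[OF sends_interchange sends_tensor[OF sendsI sends_rho]]) auto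
  \<comment> \<open>The predicate \<open>sends\<close> contains the typing of its arrow, so
    evaluating at zero vectors is enough to obtain source and target of \<open>?f\<close>.\<close>
  have "?f \<in> Hom C (?DY \<otimes>\<^sub>o ?XI) ?IY"
    using sf[of "\<zero>\<^bsub>W D\<^esub>" "\<zero>\<^bsub>W Y\<^esub>" "\<zero>\<^bsub>W X\<^esub>"] X Y Dc obj_vectorspace
    by (auto simp: sends_def vectorspace_def module_def abelian_group_def abelian_monoid.zero_closed)
  then have eq: "?h \<cdot> (m \<otimes>\<^sub>m Id C ?XI) = ?f"
    unfolding m_def by (rule transpose_arr_props(2)[OF H' DY])
  have "w h (tp H X (w m (tp D Y d y)) x) = a \<odot>\<^bsub>W Y\<^esub> y"
    if d: "d \<in> carrier (W D)" and y: "y \<in> carrier (W Y)" and x: "x \<in> carrier (W X)" and a: "a \<in> carrier K"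
      and ev: "w e (tp D X d x) = a \<odot>\<^bsub>W ?I\<^esub> one" for d y x a
  proof -
    have t: "tp D Y d y \<in> carrier (W ?DY)" using Dc Y d y tp_closed by blast
    have mt: "w m (tp D Y d y) \<in> carrier (W H)" by (rule w_closed[OF DY Hc(1) m t])
    let ?y = "w h (tp H X (w m (tp D Y d y)) x)"
    have hy: "?y \<in> carrier (W Y)"
      by (rule w_closed[OF Tensor_closed[OF Hc(1) X] Y Hc(2) tp_closed[OF Hc(1) X mt x]])
    \<comment> \<open>Both sides of the transpose equation are evaluated at
      \<open>d \<otimes> y\<close> and \<open>x \<otimes> one\<close>. One side gives
      \<open>one \<otimes> ?y\<close>, the other \<open>a\<close> times
      \<open>one \<otimes> y\<close>; the unit isomorphism of \<open>Y\<close> is then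
      inverted.\<close>
    have "sends (?h \<cdot> (m \<otimes>\<^sub>m Id C ?XI)) (?DY \<otimes>\<^sub>o ?XI) ?IY (tp ?DY ?XI (tp D Y d y) (tp X ?I x one)) (tp ?I Y one ?y)"
      using X Y I XI DY Hc m t mt x one_closed tp_closed
      by (intro sends_Comp[OF sends_tensor[OF sendsI sends_Id] sends_unit_shift_eval])
    then have "tp ?I Y one ?y = tp ?I Y (a \<odot>\<^bsub>W ?I\<^esub> one) y"
      unfolding eq using sf[OF d y x] ev by (simp add: sends_def)
    also have "\<dots> = tp ?I Y one (a \<odot>\<^bsub>W Y\<^esub> y)"
      using a y Y I one_closed by (simp add: tp_smult_left tp_smult_right)
    finally have eq': "tp ?I Y one ?y = tp ?I Y one (a \<odot>\<^bsub>W Y\<^esub> y)" .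
    have ay: "a \<odot>\<^bsub>W Y\<^esub> y \<in> carrier (W Y)"
      using vectorspace.axioms(1)[OF obj_vectorspace[OF Y]] a y by (rule module.smult_closed)
    note inv = sendsD[OF sends_inverse[OF UnitIso_iso[OF Y] sends_UnitIso[OF Y]]]
    have "?y = w (inverse_arr C Y ?IY (UnitIso C Y)) (tp ?I Y one ?y)" by (rule inv[OF hy, symmetric])
    also have "\<dots> = a \<odot>\<^bsub>W Y\<^esub> y" unfolding eq' by (rule inv[OF ay])
    finally show ?thesis .
  qed
  with iso that show thesis by blast
qed

lemma dim_le_dual:
  assumes X: "X \<in> Obj C" and D: "is_internal_hom C X (UnitObj C) D e"
  shows "dm X \<le> dm D"
proof -
  let ?I = "UnitObj C"
  have I: "?I \<in> Obj C" by (rule UnitObj_closed)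
  obtain H h where H: "is_internal_hom C X X H h" using internal_hom_exists[OF X X] by blast
  obtain m where iso: "is_iso C (D \<otimes>\<^sub>o X) H m" and m:
      "\<And>d y x a. \<lbrakk>d \<in> carrier (W D); y \<in> carrier (W X); x \<in> carrier (W X); a \<in> carrier K;
        w e (tp D X d x) = a \<odot>\<^bsub>W ?I\<^esub> one\<rbrakk> \<Longrightarrow> w h (tp H X (w m (tp D X d y)) x) = a \<odot>\<^bsub>W X\<^esub> y"
    by (rule dual_tensor_iso[OF X X D H]) blast
  have Dc: "D \<in> Obj C" "e \<in> Hom C (D \<otimes>\<^sub>o X) ?I" using D by (auto simp: is_internal_hom_def)
  have Hc: "H \<in> Obj C" "h \<in> Hom C (H \<otimes>\<^sub>o X) X" using H by (auto simp: is_internal_hom_def)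
  have DX: "D \<otimes>\<^sub>o X \<in> Obj C" and HX: "H \<otimes>\<^sub>o X \<in> Obj C" and IX: "?I \<otimes>\<^sub>o X \<in> Obj C"
    using X I Dc Hc Tensor_closed by auto
  have mc: "m \<in> Hom C (D \<otimes>\<^sub>o X) H" using iso by (simp add: is_iso_def)
  interpret X: vectorspace K "W X" by (rule obj_vectorspace) fact
  interpret D: vectorspace K "W D" by (rule obj_vectorspace) fact
  interpret tensor_setting K "W D" "W X" by (rule tensor_set) fact+
  let ?V = "inverse_arr C X (?I \<otimes>\<^sub>o X) (UnitIso C X)"
  have V: "?V \<in> Hom C (?I \<otimes>\<^sub>o X) X"
    using is_inverse_inverse_arr[OF X IX UnitIso_iso[OF X]] by (simp add: is_inverse_def)
  \<comment> \<open>\<open>dl\<close> is the transpose of the isomorphism from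
    \<open>\<one> \<otimes> X\<close> to \<open>X\<close>; its value at \<open>one\<close> is the
    element of the fibre of \<open>H\<close> that acts on the fibre of \<open>X\<close> as the
    identity.\<close>
  obtain dl where dl: "dl \<in> Hom C ?I H" "h \<cdot> (dl \<otimes>\<^sub>m Id C X) = ?V"
    using H I V unfolding is_internal_hom_def by blast
  have dl1: "w dl one \<in> carrier (W H)" by (rule w_closed[OF I Hc(1) dl(1) one_closed])
  have id: "w h (tp H X (w dl one) x) = x" if x: "x \<in> carrier (W X)" for x
  proof -
    have "sends (h \<cdot> (dl \<otimes>\<^sub>m Id C X)) (?I \<otimes>\<^sub>o X) X (tp ?I X one x) (w h (tp H X (w dl one) x))"
      using X I Hc HX dl dl1 x one_closed tp_closed
      by (intro sends_Comp[OF sends_tensor[OF sendsI sends_Id] sendsI])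
    then show ?thesis
      unfolding dl(2) using sends_inverse[OF UnitIso_iso[OF X] sends_UnitIso[OF X x]] by (simp add: sends_def)
  qed
  \<comment> \<open>Pulled back along the isomorphisms \<open>m\<close> and \<open>c\<close>, this
    element becomes a tensor \<open>t\<close>, which is expanded along a basis of the fibre of
    \<open>D\<close>. The vectors \<open>y j\<close> are fixed before any \<open>x\<close> is
    considered.\<close>
  obtain v where v: "v \<in> carrier (W (D \<otimes>\<^sub>o X))" "w dl one = w m v"
    using iso_surj[OF DX Hc(1) iso] dl1 by (metis imageE)
  obtain t where t: "t \<in> carrier T" "v = c D X t" using c_surj[OF Dc(1) X] v(1) by (metis imageE)
  obtain b where b: "spanning K (W D) (dm D) b" using D.basis_family_exists[OF obj_fin_dim] Dc(1) by blast
  obtain y where y: "\<forall>j<dm D. y j \<in> carrier (W X)" "t = nsum T (\<lambda>j. pt (b j) (y j)) (dm D)"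
    using spanning_expansion[OF b t(1)] by blast
  have bc: "b j \<in> carrier (W D)" if "j < dm D" for j using spanning_closed[OF b that] .
  have "\<exists>a. (\<forall>j<dm D. a j \<in> carrier K) \<and> x = nsum (W X) (\<lambda>j. a j \<odot>\<^bsub>W X\<^esub> y j) (dm D)"
    if x: "x \<in> carrier (W X)" for x
  proof -
    have "\<exists>a. a \<in> carrier K \<and> w e (tp D X (b j) x) = a \<odot>\<^bsub>W ?I\<^esub> one" if j: "j < dm D" for j
    proof -
      have "w e (tp D X (b j) x) \<in> carrier (W ?I)"
        using Dc DX I X bc[OF j] x tp_closed w_closed by metis
      then show ?thesis using unit_elem by metis
    qed
    \<comment> \<open>\<open>a j\<close> is the value at \<open>x\<close> of the functional given by
      \<open>b j\<close>, read off in the line through \<open>one\<close>.\<close>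
    then obtain a where a: "\<And>j. j < dm D \<Longrightarrow> a j \<in> carrier K"
        "\<And>j. j < dm D \<Longrightarrow> w e (tp D X (b j) x) = a j \<odot>\<^bsub>W ?I\<^esub> one"
      by metis
    \<comment> \<open>The action on the fixed vector \<open>x\<close> is linear in the tensor, as a
      composite of four linear maps, and so can be applied to the expansion of \<open>t\<close> term
      by term.\<close>
    have hom: "mod_hom K T (W X) (\<lambda>t. w h (tp H X (w m (c D X t)) x))"
      using mod_hom_comp[OF mod_hom_comp[OF mod_hom_comp[OF c_hom[OF Dc(1) X]
          linear_map_mod_hom[OF map_linear[OF DX Hc(1) mc]]] tp_hom_left[OF Hc(1) X x]]
          linear_map_mod_hom[OF map_linear[OF HX X Hc(2)]]] .
    have "x = w h (tp H X (w m (c D X t)) x)" using id[OF x] v t by simp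
    also have "\<dots> = nsum (W X) (\<lambda>j. w h (tp H X (w m (tp D X (b j) (y j))) x)) (dm D)"
      unfolding y(2) using y(1) bc by (intro mod_hom_nsum[OF hom]) (simp add: pure_closed)
    also have "\<dots> = nsum (W X) (\<lambda>j. a j \<odot>\<^bsub>W X\<^esub> y j) (dm D)"
      using y(1) bc a x by (intro nsum_cong m) auto
    finally show ?thesis using a(1) by blast
  qed
  then have "spanning K (W X) (dm D) y" using y(1) unfolding spanning_def by blast
  then show ?thesis by (rule X.spanning_dim_le)
qed

lemma dual_dim_le:
  assumes X: "X \<in> Obj C" and D: "is_internal_hom C X (UnitObj C) D e"
  shows "dm D \<le> dm X"
proof -
  have Dc: "D \<in> Obj C" using D by (auto simp: is_internal_hom_def)
  obtain D' e' where D': "is_internal_hom C D (UnitObj C) D' e'"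
    using internal_hom_exists[OF Dc UnitObj_closed] by blast
  have D'c: "D' \<in> Obj C" using D' by (auto simp: is_internal_hom_def)
  have "dm D \<le> dm D'" by (rule dim_le_dual[OF Dc D'])
  also have "\<dots> \<le> dm X"
    using all_reflexive[OF X] D D' iso_dim_le[OF X D'c] unfolding reflexive_def by blast
  finally show ?thesis .
qed

lemma internal_hom_dim_le:
  assumes X: "X \<in> Obj C" and Y: "Y \<in> Obj C" and H: "is_internal_hom C X Y H h"
  shows "dm H \<le> dm X * dm Y"
proof -
  obtain D e where D: "is_internal_hom C X (UnitObj C) D e"
    using internal_hom_exists[OF X UnitObj_closed] by blast
  have Dc: "D \<in> Obj C" and Hc: "H \<in> Obj C" using D H by (auto simp: is_internal_hom_def)
  obtain m where "is_iso C (D \<otimes>\<^sub>o Y) H m" by (rule dual_tensor_iso[OF X Y D H]) blast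
  then have "dm H \<le> dm (D \<otimes>\<^sub>o Y)" using iso_dim_le Dc Hc Y Tensor_closed by blast
  also have "\<dots> \<le> dm D * dm Y" by (rule tensor_dim_le[OF Dc Y])
  also have "\<dots> \<le> dm X * dm Y" using dual_dim_le[OF X D] by simp
  finally show ?thesis .
qed

end

section \<open>Ultraproducts of vector spaces\<close>

lemma ultrafilter_not:
  "nonprincipal_ultrafilter U \<Longrightarrow> \<not> eventually P U \<Longrightarrow> eventually (\<lambda>i. \<not> P i) U"
  by (auto simp: nonprincipal_ultrafilter_def)

text \<open>By the ultrafilter property either \<open>f i = Suc n\<close> almost everywhere, or
  \<open>f i \<noteq> Suc n\<close> almost everywhere and the bound drops to
  \<open>n\<close>.\<close>

lemma ultrafilter_bounded_constant:
  fixes f :: "'i \<Rightarrow> nat"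
  assumes "nonprincipal_ultrafilter U" "\<forall>\<^sub>F i in U. f i \<le> n"
  shows "\<exists>m. \<forall>\<^sub>F i in U. f i = m"
  using assms(2)
proof (induction n)
  case (Suc n)
  show ?case
  proof (cases "\<forall>\<^sub>F i in U. f i = Suc n")
    case False
    then have "\<forall>\<^sub>F i in U. f i \<noteq> Suc n" using ultrafilter_not[OF assms(1)] by blast
    with Suc.prems have "\<forall>\<^sub>F i in U. f i \<le> n" by eventually_elim simp
    then show ?thesis by (rule Suc.IH)
  qed blast
qed auto

lemma uclass_cong: "(\<And>i. x i = y i) \<Longrightarrow> uclass U x = uclass U y"
  by (simp add: uclass_eq_iff)

lemma uclass_in_uprod [simp]: "uclass U x \<in> uprod U A \<longleftrightarrow> (\<forall>\<^sub>F i in U. x i \<in> A i)"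
proof
  assume "uclass U x \<in> uprod U A"
  then obtain y where "\<forall>\<^sub>F i in U. x i = y i" "\<forall>\<^sub>F i in U. y i \<in> A i"
    by (auto simp: uprod_def uclass_eq_iff)
  then show "\<forall>\<^sub>F i in U. x i \<in> A i" by eventually_elim simp
qed (auto simp: uprod_def)

text \<open>The representative is repaired at the exceptional indices by arbitrary elements of the
  nonempty sets \<open>A i\<close>. Afterwards hypotheses about the components hold at every index,
  and most equations between classes reduce to equations at each index.\<close>

lemma uprodE:
  assumes "a \<in> uprod U A" "\<And>i. A i \<noteq> {}"
  obtains x where "\<And>i. x i \<in> A i" "a = uclass U x"
proof -
  obtain y where y: "\<forall>\<^sub>F i in U. y i \<in> A i" "a = uclass U y" using assms(1) by (auto simp: uprod_def)
  define x where "x i = (if y i \<in> A i then y i else (SOME z. z \<in> A i))" for i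
  have "x i \<in> A i" for i using assms(2)[of i] by (auto simp: x_def intro: someI)
  moreover have "\<forall>\<^sub>F i in U. y i = x i" using y(1) by eventually_elim (simp add: x_def)
  then have "a = uclass U x" unfolding y(2) uclass_eq_iff .
  ultimately show thesis by (rule that)
qed

lemma uprod_rep: "a \<in> uprod U A \<Longrightarrow> (\<And>i. A i \<noteq> {}) \<Longrightarrow> \<exists>x. (\<forall>i. x i \<in> A i) \<and> a = uclass U x"
  by (erule uprodE) auto

lemma vectorspace_zero_closed:
  assumes "vectorspace K V" shows "\<zero>\<^bsub>V\<^esub> \<in> carrier V" "\<zero>\<^bsub>K\<^esub> \<in> carrier K"
proof -
  interpret vectorspace K V by (rule assms)
  show "\<zero>\<^bsub>V\<^esub> \<in> carrier V" "\<zero>\<^bsub>K\<^esub> \<in> carrier K" by auto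
qed

lemmas ultra_simps = ring_ultraproduct_def vec_ultraproduct_def ulift1_uclass ulift2_uclass ulift3_uclass

lemma carrier_ring_ultraproduct [simp]: "carrier (ring_ultraproduct U K) = uprod U (\<lambda>i. carrier (K i))"
  and zero_ring_ultraproduct [simp]: "\<zero>\<^bsub>ring_ultraproduct U K\<^esub> = uclass U (\<lambda>i. \<zero>\<^bsub>K i\<^esub>)"
  and one_ring_ultraproduct [simp]: "\<one>\<^bsub>ring_ultraproduct U K\<^esub> = uclass U (\<lambda>i. \<one>\<^bsub>K i\<^esub>)"
  and add_ring_ultraproduct [simp]:
    "uclass U x \<oplus>\<^bsub>ring_ultraproduct U K\<^esub> uclass U y = uclass U (\<lambda>i. x i \<oplus>\<^bsub>K i\<^esub> y i)"
  and mult_ring_ultraproduct [simp]: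
    "uclass U x \<otimes>\<^bsub>ring_ultraproduct U K\<^esub> uclass U y = uclass U (\<lambda>i. x i \<otimes>\<^bsub>K i\<^esub> y i)"
  by (simp_all add: ultra_simps)

lemma carrier_vec_ultraproduct [simp]: "carrier (vec_ultraproduct U V) = uprod U (\<lambda>i. carrier (V i))"
  and zero_vec_ultraproduct [simp]: "\<zero>\<^bsub>vec_ultraproduct U V\<^esub> = uclass U (\<lambda>i. \<zero>\<^bsub>V i\<^esub>)"
  and add_vec_ultraproduct [simp]:
    "uclass U x \<oplus>\<^bsub>vec_ultraproduct U V\<^esub> uclass U y = uclass U (\<lambda>i. x i \<oplus>\<^bsub>V i\<^esub> y i)"
  and smult_vec_ultraproduct [simp]:
    "uclass U a \<odot>\<^bsub>vec_ultraproduct U V\<^esub> uclass U y = uclass U (\<lambda>i. a i \<odot>\<^bsub>V i\<^esub> y i)"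
  by (simp_all add: ultra_simps)

text \<open>The recursive definition of \<open>nsum\<close> makes this an induction free of closure
  hypotheses; \<open>finsum\<close> obeys its recursion only for summands in the carrier, which here
  may fail at exceptional indices.\<close>

lemma nsum_vec_ultraproduct:
  "nsum (vec_ultraproduct U V) (\<lambda>j. uclass U (f j)) n = uclass U (\<lambda>i. nsum (V i) (\<lambda>j. f j i) n)"
  by (induction n) simp_all

lemma field_ring_ultraproduct:
  assumes U: "nonprincipal_ultrafilter U" and K: "\<And>i. field (K i)"
  shows "field (ring_ultraproduct U K)"
proof -
  interpret K: field "K i" for i by (rule K)
  let ?R = "ring_ultraproduct U K"
  have E: thesis if "a \<in> uprod U (\<lambda>i. carrier (K i))" "\<And>x. (\<And>i. x i \<in> carrier (K i)) \<Longrightarrow> a = uclass U x \<Longrightarrow> thesis" for a thesis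
    using that by (auto elim!: uprodE)
  have "cring ?R"
  proof (rule cringI)
    show "abelian_group ?R"
    proof (rule abelian_groupI)
      fix x assume "x \<in> carrier ?R"
      then obtain y where y: "\<forall>i. y i \<in> carrier (K i)" "x = uclass U y"
        using uprod_rep[of x U "\<lambda>i. carrier (K i)"] K.carrier_not_empty by auto
      show "\<exists>y\<in>carrier ?R. y \<oplus>\<^bsub>?R\<^esub> x = \<zero>\<^bsub>?R\<^esub>"
        by (rule bexI[of _ "uclass U (\<lambda>i. \<ominus>\<^bsub>K i\<^esub> y i)"]) (simp_all add: y K.l_neg)
    qed (auto elim!: E simp: K.a_ac)
    show "comm_monoid ?R"
      by (rule comm_monoidI) (auto elim!: E simp: K.m_ac)
  qed (auto elim!: E simp: K.l_distr)
  then show ?thesis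
  proof (rule cring.cring_fieldI2)
    have "\<not> (\<forall>\<^sub>F i in U. False)" using U by (auto simp: nonprincipal_ultrafilter_def trivial_limit_def)
    then show "\<zero>\<^bsub>?R\<^esub> \<noteq> \<one>\<^bsub>?R\<^esub>" by (simp add: uclass_eq_iff)
    fix a assume a: "a \<in> carrier ?R" "a \<noteq> \<zero>\<^bsub>?R\<^esub>"
    obtain x where x: "\<forall>i. x i \<in> carrier (K i)" "a = uclass U x"
      using uprod_rep[of a U "\<lambda>i. carrier (K i)"] a(1) K.carrier_not_empty by auto
    \<comment> \<open>A nonzero class merely fails to vanish almost everywhere; the ultrafilter
      property makes it nonzero almost everywhere, so that componentwise inverses exist
      there.\<close>
    have nz: "\<forall>\<^sub>F i in U. x i \<noteq> \<zero>\<^bsub>K i\<^esub>" using ultrafilter_not[OF U] a(2) x(2) by (simp add: uclass_eq_iff)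
    have inv: "inv\<^bsub>K i\<^esub> x i \<in> carrier (K i) \<and> x i \<otimes>\<^bsub>K i\<^esub> inv\<^bsub>K i\<^esub> x i = \<one>\<^bsub>K i\<^esub>" if "x i \<noteq> \<zero>\<^bsub>K i\<^esub>" for i
      using x(1) that by (simp add: K.field_Units)
    have "uclass U (\<lambda>i. inv\<^bsub>K i\<^esub> x i) \<in> carrier ?R"
      using nz inv by (auto elim: eventually_mono)
    moreover have "a \<otimes>\<^bsub>?R\<^esub> uclass U (\<lambda>i. inv\<^bsub>K i\<^esub> x i) = \<one>\<^bsub>?R\<^esub>"
      using nz inv by (auto simp: x(2) uclass_eq_iff elim: eventually_mono)
    ultimately show "\<exists>b\<in>carrier ?R. a \<otimes>\<^bsub>?R\<^esub> b = \<one>\<^bsub>?R\<^esub>" by blast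
  qed
qed

lemma vectorspace_vec_ultraproduct:
  assumes U: "nonprincipal_ultrafilter U" and V: "\<And>i. vectorspace (K i) (V i)"
  shows "vectorspace (ring_ultraproduct U K) (vec_ultraproduct U V)"
proof -
  interpret V: vectorspace "K i" "V i" for i by (rule V)
  let ?K = "ring_ultraproduct U K" and ?V = "vec_ultraproduct U V"
  have EK: thesis if "a \<in> uprod U (\<lambda>i. carrier (K i))" "\<And>x. (\<And>i. x i \<in> carrier (K i)) \<Longrightarrow> a = uclass U x \<Longrightarrow> thesis" for a thesis
    using that by (auto elim!: uprodE)
  have E: thesis if "a \<in> uprod U (\<lambda>i. carrier (V i))" "\<And>x. (\<And>i. x i \<in> carrier (V i)) \<Longrightarrow> a = uclass U x \<Longrightarrow> thesis" for a thesis
    using that by (auto elim!: uprodE)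
  show ?thesis
  proof (rule vs_criteria; (intro allI impI ballI)?)
    show "field ?K" using U V.field_axioms by (rule field_ring_ultraproduct)
    fix v assume "v \<in> carrier ?V"
    then obtain x where x: "\<forall>i. x i \<in> carrier (V i)" "v = uclass U x"
      using uprod_rep[of v U "\<lambda>i. carrier (V i)"] vectorspace_zero_closed(1)[OF V] by fastforce
    show "\<exists>u\<in>carrier ?V. v \<oplus>\<^bsub>?V\<^esub> u = \<zero>\<^bsub>?V\<^esub>"
      by (rule bexI[of _ "uclass U (\<lambda>i. \<ominus>\<^bsub>V i\<^esub> x i)"]) (simp_all add: x V.M.r_neg)
  qed (auto elim!: E EK simp: V.M.a_ac V.smult_l_distr V.smult_r_distr V.smult_assoc1)
qed

text \<open>\<open>g\<close> is prescribed only on representatives with all entries in the carriers.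
  This form fits functions of one class as well as operations on two classes with one argument
  fixed.\<close>

lemma linear_map_ultraproduct:
  assumes U: "nonprincipal_ultrafilter U" and f: "\<And>i. linear_map (K i) (V i) (W i) (f i)"
    and g: "\<And>x. (\<And>i. x i \<in> carrier (V i)) \<Longrightarrow> g (uclass U x) = uclass U (\<lambda>i. f i (x i))"
  shows "linear_map (ring_ultraproduct U K) (vec_ultraproduct U V) (vec_ultraproduct U W) g"
proof -
  interpret f: linear_map "K i" "V i" "W i" "f i" for i by (rule f)
  let ?K = "ring_ultraproduct U K" and ?V = "vec_ultraproduct U V" and ?W = "vec_ultraproduct U W"
  have ne: "carrier (V i) \<noteq> {}" "carrier (K i) \<noteq> {}" for i
    using vectorspace_zero_closed[OF f.V.vectorspace_axioms] by blast+
  have EK: "\<exists>x. (\<forall>i. x i \<in> carrier (K i)) \<and> a = uclass U x" if "a \<in> carrier ?K" for a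
    using uprod_rep[of a U "\<lambda>i. carrier (K i)"] that ne by simp
  have E: "\<exists>x. (\<forall>i. x i \<in> carrier (V i)) \<and> a = uclass U x" if "a \<in> carrier ?V" for a
    using uprod_rep[of a U "\<lambda>i. carrier (V i)"] that ne by simp
  have "g \<in> module_hom ?K ?V ?W"
    unfolding module_hom_def
  proof (intro CollectI conjI allI impI Pi_I; (elim conjE)?)
    fix x assume "x \<in> carrier ?V"
    then obtain x' where "\<forall>i. x' i \<in> carrier (V i)" "x = uclass U x'" using E by blast
    then show "g x \<in> carrier ?W" by (simp add: g)
  next
    fix x y assume "x \<in> carrier ?V" "y \<in> carrier ?V"
    then obtain x' y' where x': "\<forall>i. x' i \<in> carrier (V i)" "x = uclass U x'"
      and y': "\<forall>i. y' i \<in> carrier (V i)" "y = uclass U y'" by (metis E)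
    show "g (x \<oplus>\<^bsub>?V\<^esub> y) = g x \<oplus>\<^bsub>?W\<^esub> g y"
      using x' y' by (simp add: g)
  next
    fix a x assume "a \<in> carrier ?K" "x \<in> carrier ?V"
    then obtain a' x' where a': "\<forall>i. a' i \<in> carrier (K i)" "a = uclass U a'"
      and x': "\<forall>i. x' i \<in> carrier (V i)" "x = uclass U x'" by (metis E EK)
    show "g (a \<odot>\<^bsub>?V\<^esub> x) = a \<odot>\<^bsub>?W\<^esub> g x"
      using a' x' by (simp add: g)
  qed
  moreover have "vectorspace ?K ?V" "vectorspace ?K ?W"
    by (intro vectorspace_vec_ultraproduct U f.V.vectorspace_axioms f.W.vectorspace_axioms)+
  ultimately show ?thesis
    by (auto simp: linear_map_def mod_hom_def mod_hom_axioms_def vectorspace_def)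
qed

lemma linear_iso_ultraproduct:
  assumes U: "nonprincipal_ultrafilter U" and f: "\<And>i. linear_iso (K i) (V i) (W i) (f i)"
    and g: "\<And>x. (\<And>i. x i \<in> carrier (V i)) \<Longrightarrow> g (uclass U x) = uclass U (\<lambda>i. f i (x i))"
  shows "linear_iso (ring_ultraproduct U K) (vec_ultraproduct U V) (vec_ultraproduct U W) g"
  unfolding linear_iso_def
proof
  have f': "linear_map (K i) (V i) (W i) (f i)" "bij_betw (f i) (carrier (V i)) (carrier (W i))" for i
    using f by (auto simp: linear_iso_def)
  interpret f: linear_map "K i" "V i" "W i" "f i" for i by (rule f')
  show "linear_map (ring_ultraproduct U K) (vec_ultraproduct U V) (vec_ultraproduct U W) g"
    by (rule linear_map_ultraproduct[OF U f'(1) g])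
  let ?V = "vec_ultraproduct U V" and ?W = "vec_ultraproduct U W"
  have ne: "carrier (V i) \<noteq> {}" "carrier (W i) \<noteq> {}" for i
    using vectorspace_zero_closed(1)[OF f.V.vectorspace_axioms]
      vectorspace_zero_closed(1)[OF f.W.vectorspace_axioms] by blast+
  have E: "\<exists>x. (\<forall>i. x i \<in> carrier (V i)) \<and> a = uclass U x" if "a \<in> carrier ?V" for a
    using that ne by (auto elim!: uprodE)
  have inj: "f i x = f i y \<longleftrightarrow> x = y" if "x \<in> carrier (V i)" "y \<in> carrier (V i)" for i x y
    using f'(2)[of i] that by (auto simp: bij_betw_def inj_on_def)
  show "bij_betw g (carrier ?V) (carrier ?W)"
    unfolding bij_betw_def
  proof
    show "inj_on g (carrier ?V)"
    proof (rule inj_onI)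
      fix a b assume "a \<in> carrier ?V" "b \<in> carrier ?V" and eq: "g a = g b"
      then obtain x y where x: "\<forall>i. x i \<in> carrier (V i)" "a = uclass U x"
        and y: "\<forall>i. y i \<in> carrier (V i)" "b = uclass U y" using E by metis
      show "a = b" using eq x y by (simp add: g inj uclass_eq_iff)
    qed
    show "g ` carrier ?V = carrier ?W"
    proof (intro equalityI subsetI)
      fix z assume "z \<in> g ` carrier ?V"
      then obtain x where "\<forall>i. x i \<in> carrier (V i)" "z = g (uclass U x)" using E by blast
      then show "z \<in> carrier ?W" by (simp add: g)
    next
      fix z assume "z \<in> carrier ?W"
      then obtain y where y: "\<And>i. y i \<in> carrier (W i)" "z = uclass U y"
        using ne by (auto elim!: uprodE)
      have "\<forall>i. \<exists>x. x \<in> carrier (V i) \<and> f i x = y i"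
        using y(1) f'(2) by (metis bij_betw_def imageE)
      then obtain x where x: "\<forall>i. x i \<in> carrier (V i) \<and> f i (x i) = y i" by metis
      then have "z = g (uclass U x)" by (simp add: g y(2))
      then show "z \<in> g ` carrier ?V" using x by simp
    qed
  qed
qed

text \<open>The length \<open>n\<close> does not depend on the index, so the coefficients chosen in
  the components regroup into \<open>n\<close> classes. This is how boundedness of dimensions
  becomes finite dimension of the ultraproduct.\<close>

lemma spanning_ultraproduct:
  assumes b: "\<forall>\<^sub>F i in U. spanning (K i) (V i) n (b i)"
  shows "spanning (ring_ultraproduct U K) (vec_ultraproduct U V) n (\<lambda>j. uclass U (\<lambda>i. b i j))"
  unfolding spanning_def
proof (intro conjI allI impI ballI)
  show "uclass U (\<lambda>i. b i j) \<in> carrier (vec_ultraproduct U V)" if "j < n" for j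
    using b by (simp, eventually_elim) (use that spanning_closed in blast)
  fix v assume "v \<in> carrier (vec_ultraproduct U V)"
  then obtain x where x: "\<forall>\<^sub>F i in U. x i \<in> carrier (V i)" "v = uclass U x" by (auto simp: uprod_def)
  have "\<forall>\<^sub>F i in U. \<exists>a. (\<forall>j<n. a j \<in> carrier (K i)) \<and> x i = nsum (V i) (\<lambda>j. a j \<odot>\<^bsub>V i\<^esub> b i j) n"
    using b x(1) by eventually_elim (simp add: spanning_def)
  then obtain a where a: "\<forall>\<^sub>F i in U. (\<forall>j<n. a i j \<in> carrier (K i)) \<and>
      x i = nsum (V i) (\<lambda>j. a i j \<odot>\<^bsub>V i\<^esub> b i j) n"
    unfolding eventually_ex by blast
  let ?a = "\<lambda>j. uclass U (\<lambda>i. a i j)"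
  have "\<forall>j<n. ?a j \<in> carrier (ring_ultraproduct U K)"
    using a by (auto elim: eventually_mono)
  moreover have "v = nsum (vec_ultraproduct U V) (\<lambda>j. ?a j \<odot>\<^bsub>vec_ultraproduct U V\<^esub> uclass U (\<lambda>i. b i j)) n"
    using a by (simp add: nsum_vec_ultraproduct x(2) uclass_eq_iff) (auto elim: eventually_mono)
  ultimately show "\<exists>a. (\<forall>j<n. a j \<in> carrier (ring_ultraproduct U K)) \<and>
      v = nsum (vec_ultraproduct U V) (\<lambda>j. a j \<odot>\<^bsub>vec_ultraproduct U V\<^esub> uclass U (\<lambda>i. b i j)) n"
    by (intro exI[of _ ?a]) simp
qed

text \<open>Ultraproducts of finite-dimensional spaces commute with tensor products because the dimension
  of the left factor is almost everywhere constant: with a basis \<open>b\<^sub>1, \<dots>, b\<^sub>m\<close> of it, each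
  tensor is \<open>\<Sum>\<^sub>j b\<^sub>j \<otimes> y\<^sub>j\<close> for unique \<open>y\<^sub>j\<close>.\<close>

lemma tensor_ultraproduct_iso:
  assumes U: "nonprincipal_ultrafilter U"
    and V: "\<And>i. vectorspace (K i) (V i)" "\<And>i. vectorspace.fin_dim (K i) (V i)"
      "\<forall>\<^sub>F i in U. vectorspace.dim (K i) (V i) \<le> n"
    and W: "\<And>i. vectorspace (K i) (W i)"
    and c: "\<And>i. linear_iso (K i) (tensor_module (K i) (V i) (W i)) (Z i) (c i)"
  shows "\<exists>g. linear_iso (ring_ultraproduct U K)
      (tensor_module (ring_ultraproduct U K) (vec_ultraproduct U V) (vec_ultraproduct U W))
      (vec_ultraproduct U Z) g \<and>
    (\<forall>x y. (\<forall>i. x i \<in> carrier (V i)) \<longrightarrow> (\<forall>i. y i \<in> carrier (W i)) \<longrightarrow>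
      g (pure_tensor (ring_ultraproduct U K) (vec_ultraproduct U V) (vec_ultraproduct U W)
          (uclass U x) (uclass U y))
        = uclass U (\<lambda>i. c i (pure_tensor (K i) (V i) (W i) (x i) (y i))))"
proof -
  let ?K = "ring_ultraproduct U K" and ?V = "vec_ultraproduct U V" and ?W = "vec_ultraproduct U W"
  let ?Z = "vec_ultraproduct U Z"
  let ?B = "ulift2 U (\<lambda>i x y. c i (pure_tensor (K i) (V i) (W i) x y))"
  have c': "linear_map (K i) (tensor_module (K i) (V i) (W i)) (Z i) (c i)"
    "bij_betw (c i) (carrier (tensor_module (K i) (V i) (W i))) (carrier (Z i))" for i
    using c by (auto simp: linear_iso_def)
  interpret c: linear_map "K i" "tensor_module (K i) (V i) (W i)" "Z i" "c i" for i by (rule c')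
  interpret V: vectorspace "K i" "V i" for i by (rule V)
  interpret W: vectorspace "K i" "W i" for i by (rule W)
  interpret T: tensor_setting "K i" "V i" "W i" for i by unfold_locales
  interpret uV: vectorspace ?K ?V by (rule vectorspace_vec_ultraproduct[OF U V(1)])
  interpret uW: vectorspace ?K ?W by (rule vectorspace_vec_ultraproduct[OF U W])
  interpret uZ: vectorspace ?K ?Z
    by (rule vectorspace_vec_ultraproduct[OF U]) (rule c.W.vectorspace_axioms)
  interpret uT: tensor_setting ?K ?V ?W by unfold_locales
  have E: "\<exists>x. (\<forall>i. x i \<in> carrier (V i)) \<and> a = uclass U x" if "a \<in> carrier ?V" for a
    using that by (auto elim!: uprodE)
  have EW: "\<exists>x. (\<forall>i. x i \<in> carrier (W i)) \<and> a = uclass U x" if "a \<in> carrier ?W" for a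
    using that by (auto elim!: uprodE)
  have "(\<lambda>v. ?B v y) \<in> module_hom ?K ?V ?Z" if y: "y \<in> carrier ?W" for y
  proof -
    obtain y' where y': "\<forall>i. y' i \<in> carrier (W i)" "y = uclass U y'" using EW[OF y] by blast
    have "linear_map (K i) (V i) (Z i) (\<lambda>x. c i (pure_tensor (K i) (V i) (W i) x (y' i)))" for i
      using mod_hom_comp[OF T.pure_hom_left c.mod_hom_axioms] y'(1) V.vectorspace_axioms c.W.vectorspace_axioms
      by (simp add: linear_map_def)
    then have "linear_map ?K ?V ?Z (\<lambda>v. ?B v y)"
      by (rule linear_map_ultraproduct[OF U]) (simp add: y'(2) ulift2_uclass)
    then show ?thesis by (simp add: linear_map_def mod_hom_def mod_hom_axioms_def)
  qed
  moreover have "?B x \<in> module_hom ?K ?W ?Z" if x: "x \<in> carrier ?V" for x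
  proof -
    obtain x' where x': "\<forall>i. x' i \<in> carrier (V i)" "x = uclass U x'" using E[OF x] by blast
    have "linear_map (K i) (W i) (Z i) (\<lambda>y. c i (pure_tensor (K i) (V i) (W i) (x' i) y))" for i
      using mod_hom_comp[OF T.pure_hom_right c.mod_hom_axioms] x'(1) W.vectorspace_axioms c.W.vectorspace_axioms
      by (simp add: linear_map_def)
    then have "linear_map ?K ?W ?Z (?B x)"
      by (rule linear_map_ultraproduct[OF U]) (simp add: x'(2) ulift2_uclass)
    then show ?thesis by (simp add: linear_map_def mod_hom_def mod_hom_axioms_def)
  qed
  ultimately have "uT.bilinear_to ?Z ?B" by (simp add: uT.bilinear_to_def)
  then obtain g where g: "mod_hom ?K uT.T ?Z g"
      "\<forall>v\<in>carrier ?V. \<forall>w\<in>carrier ?W. g (uT.pt v w) = ?B v w"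
    using uT.lift_exists[OF uZ.module_axioms] by blast
  interpret g: mod_hom ?K uT.T ?Z g by (rule g)
  have gp: "g (uT.pt (uclass U x) (uclass U y)) = uclass U (\<lambda>i. c i (T.pt i (x i) (y i)))"
    if "\<forall>\<^sub>F i in U. x i \<in> carrier (V i)" "\<forall>\<^sub>F i in U. y i \<in> carrier (W i)" for x y
    using g(2) that by (simp add: ulift2_uclass)
  obtain m where m: "\<forall>\<^sub>F i in U. V.dim i = m" using ultrafilter_bounded_constant[OF U V(3)] by blast
  have "\<exists>b. spanning (K i) (V i) (V.dim i) b \<and> independent (K i) (V i) (V.dim i) b" for i
    using V.basis_family_exists[OF V(2)] by metis
  then obtain b where b: "\<And>i. spanning (K i) (V i) (V.dim i) (b i)" "\<And>i. independent (K i) (V i) (V.dim i) (b i)"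
    by metis
  let ?b = "\<lambda>j. uclass U (\<lambda>i. b i j)"
  \<comment> \<open>The bases were chosen with the individual lengths \<open>V.dim i\<close>; almost
    everywhere this length is \<open>m\<close>.\<close>
  have sp: "\<forall>\<^sub>F i in U. spanning (K i) (V i) m (b i)" and li: "\<forall>\<^sub>F i in U. independent (K i) (V i) m (b i)"
    using m by (eventually_elim, use b in force)+
  have spU: "spanning ?K ?V m ?b" by (rule spanning_ultraproduct[OF sp])
  have bc: "\<forall>\<^sub>F i in U. b i j \<in> carrier (V i)" if "j < m" for j
    using sp by eventually_elim (rule spanning_closed[OF _ that])
  \<comment> \<open>On an expansion along \<open>?b\<close> the induced map \<open>g\<close> is
    computed componentwise. Injectivity and surjectivity are both read off from expansions of the
    common length \<open>m\<close>.\<close>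
  have gsum: "g (nsum uT.T (\<lambda>j. uT.pt (?b j) (uclass U (y j))) m)
      = uclass U (\<lambda>i. c i (nsum (T.T i) (\<lambda>j. T.pt i (b i j) (y j i)) m))"
    if y: "\<And>j i. y j i \<in> carrier (W i)" for y
  proof -
    have "g (nsum uT.T (\<lambda>j. uT.pt (?b j) (uclass U (y j))) m)
        = nsum ?Z (\<lambda>j. g (uT.pt (?b j) (uclass U (y j)))) m"
      using bc y by (intro g.nsum_hom uT.pure_closed) auto
    also have "\<dots> = nsum ?Z (\<lambda>j. uclass U (\<lambda>i. c i (T.pt i (b i j) (y j i)))) m"
      using bc y by (intro nsum_cong gp) auto
    also have "\<dots> = uclass U (\<lambda>i. nsum (Z i) (\<lambda>j. c i (T.pt i (b i j) (y j i))) m)"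
      by (rule nsum_vec_ultraproduct)
    also have "\<dots> = uclass U (\<lambda>i. c i (nsum (T.T i) (\<lambda>j. T.pt i (b i j) (y j i)) m))"
      unfolding uclass_eq_iff using sp
    proof eventually_elim
      case (elim i)
      show ?case
        using elim y by (intro c.nsum_hom[symmetric] T.pure_closed spanning_closed[OF elim]) auto
    qed
    finally show ?thesis .
  qed
  have "inj_on g (carrier uT.T)"
  proof (rule inj_onI)
    have ker: "t = \<zero>\<^bsub>uT.T\<^esub>" if t: "t \<in> carrier uT.T" and z: "g t = \<zero>\<^bsub>?Z\<^esub>" for t
    proof -
      obtain y where y: "\<forall>j<m. y j \<in> carrier ?W" "t = nsum uT.T (\<lambda>j. uT.pt (?b j) (y j)) m"
        using uT.spanning_expansion[OF spU t] by blast
      \<comment> \<open>Representatives with every entry in \<open>W i\<close> are chosen for all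
        \<open>j\<close> at once; from \<open>m\<close> onwards zero serves as filler.\<close>
      have "\<forall>j. \<exists>y'. (\<forall>i. y' i \<in> carrier (W i)) \<and> (j < m \<longrightarrow> y j = uclass U y')"
      proof
        fix j
        show "\<exists>y'. (\<forall>i. y' i \<in> carrier (W i)) \<and> (j < m \<longrightarrow> y j = uclass U y')"
        proof (cases "j < m")
          case False
          then show ?thesis using W.M.zero_closed by (intro exI[of _ "\<lambda>i. \<zero>\<^bsub>W i\<^esub>"]) simp
        qed (use EW[of "y j"] y(1) in auto)
      qed
      then obtain y' where y': "\<And>j i. y' j i \<in> carrier (W i)" "\<And>j. j < m \<Longrightarrow> y j = uclass U (y' j)"
        by metis
      have t': "t = nsum uT.T (\<lambda>j. uT.pt (?b j) (uclass U (y' j))) m"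
        unfolding y(2) by (intro nsum_cong) (simp add: y'(2))
      have "\<forall>\<^sub>F i in U. c i (nsum (T.T i) (\<lambda>j. T.pt i (b i j) (y' j i)) m) = \<zero>\<^bsub>Z i\<^esub>"
        using z unfolding t' gsum[OF y'(1)] by (simp add: uclass_eq_iff)
      \<comment> \<open>Where the component vanishes, injectivity of \<open>c i\<close> makes the
        expansion zero, and independence of \<open>b i\<close> forces all coefficients to be
        zero.\<close>
      then have "\<forall>\<^sub>F i in U. \<forall>j<m. y' j i = \<zero>\<^bsub>W i\<^esub>"
        using sp li
      proof eventually_elim
        case (elim i)
        let ?s = "nsum (T.T i) (\<lambda>j. T.pt i (b i j) (y' j i)) m"
        have "?s \<in> carrier (T.T i)"
          using y'(1) by (intro abelian_group.nsum_closed[OF module.axioms(2)[OF T.module_tensor]]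
              T.pure_closed spanning_closed[OF elim(2)])
        moreover have "c i ?s = c i \<zero>\<^bsub>T.T i\<^esub>" using elim(1) by simp
        ultimately have "?s = \<zero>\<^bsub>T.T i\<^esub>"
          using c'(2)[of i] vectorspace_zero_closed(1)[OF c.V.vectorspace_axioms[of i]] by (meson bij_betw_def inj_onD)
        then have "y' j i = \<zero>\<^bsub>W i\<^esub>" if "j < m" for j
          using y'(1) that by (intro T.basis_expansion_zero[OF elim(2,3), of "\<lambda>j. y' j i"])
        then show ?case by blast
      qed
      then have "\<forall>\<^sub>F i in U. y' j i = \<zero>\<^bsub>W i\<^esub>" if "j < m" for j using that by (auto elim: eventually_mono)
      then have y0: "uclass U (y' j) = \<zero>\<^bsub>?W\<^esub>" if "j < m" for j using that by (simp add: uclass_eq_iff)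
      show ?thesis unfolding t'
      proof (rule uT.T.M.nsum_zero)
        fix j assume j: "j < m"
        interpret r: mod_hom ?K ?W uT.T "uT.pt (?b j)" by (rule uT.pure_hom_right) (use bc j in simp)
        show "uT.pt (?b j) (uclass U (y' j)) = \<zero>\<^bsub>uT.T\<^esub>" unfolding y0[OF j] by (rule r.f0_is_0)
      qed
    qed
    fix s t assume s: "s \<in> carrier uT.T" and t: "t \<in> carrier uT.T" and eq: "g s = g t"
    have "g (s \<ominus>\<^bsub>uT.T\<^esub> t) = g s \<ominus>\<^bsub>?Z\<^esub> g t" using s t by (rule g.f_minus)
    also have "\<dots> = \<zero>\<^bsub>?Z\<^esub>" unfolding eq using t g.f_im by (simp add: uZ.M.minus_eq uZ.M.r_neg del: zero_vec_ultraproduct)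
    finally have "s \<ominus>\<^bsub>uT.T\<^esub> t = \<zero>\<^bsub>uT.T\<^esub>" using s t by (intro ker) auto
    then show "s = t" using s t by simp
  qed
  moreover have "g ` carrier uT.T = carrier ?Z"
  proof (intro equalityI subsetI)
    fix z assume "z \<in> carrier ?Z"
    then obtain z' where z': "\<And>i. z' i \<in> carrier (Z i)" "z = uclass U z'"
      using vectorspace_zero_closed(1)[OF c.W.vectorspace_axioms] by (auto elim!: uprodE)
    have "\<forall>i. \<exists>t. t \<in> carrier (T.T i) \<and> c i t = z' i" using z'(1) c'(2) by (metis bij_betw_def imageE)
    then obtain t where t: "\<And>i. t i \<in> carrier (T.T i)" "\<And>i. c i (t i) = z' i" by metis
    \<comment> \<open>Coefficients are chosen at every index, with zero where \<open>b i\<close>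
      fails to span with length \<open>m\<close> or where \<open>j\<close> is at least
      \<open>m\<close>, because \<open>gsum\<close> asks for entries in \<open>W i\<close>
      throughout.\<close>
    have "\<forall>i. \<exists>y. (\<forall>j. y j \<in> carrier (W i)) \<and>
        (spanning (K i) (V i) m (b i) \<longrightarrow> t i = nsum (T.T i) (\<lambda>j. T.pt i (b i j) (y j)) m)"
    proof
      fix i
      show "\<exists>y. (\<forall>j. y j \<in> carrier (W i)) \<and>
        (spanning (K i) (V i) m (b i) \<longrightarrow> t i = nsum (T.T i) (\<lambda>j. T.pt i (b i j) (y j)) m)"
      proof (cases "spanning (K i) (V i) m (b i)")
        case True
        obtain y where y: "\<forall>j<m. y j \<in> carrier (W i)" "t i = nsum (T.T i) (\<lambda>j. T.pt i (b i j) (y j)) m"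
          using T.spanning_expansion[OF True t(1)] by blast
        have "t i = nsum (T.T i) (\<lambda>j. T.pt i (b i j) (if j < m then y j else \<zero>\<^bsub>W i\<^esub>)) m"
          unfolding y(2) by (intro nsum_cong) simp
        then show ?thesis using y(1) by (intro exI[of _ "\<lambda>j. if j < m then y j else \<zero>\<^bsub>W i\<^esub>"]) simp
      next
        case False
        then show ?thesis using W.M.zero_closed by (intro exI[of _ "\<lambda>_. \<zero>\<^bsub>W i\<^esub>"]) simp
      qed
    qed
    then obtain y where y: "\<And>i j. y i j \<in> carrier (W i)"
        "\<And>i. spanning (K i) (V i) m (b i) \<Longrightarrow> t i = nsum (T.T i) (\<lambda>j. T.pt i (b i j) (y i j)) m"
      by metis
    let ?s = "nsum uT.T (\<lambda>j. uT.pt (?b j) (uclass U (\<lambda>i. y i j))) m"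
    have "?s \<in> carrier uT.T" using bc y(1) by (intro uT.T.M.nsum_closed uT.pure_closed) auto
    moreover have "g ?s = z"
      unfolding gsum[of "\<lambda>j i. y i j", OF y(1)] z'(2) uclass_eq_iff
      using sp by eventually_elim (simp add: y(2)[symmetric] t(2))
    ultimately show "z \<in> g ` carrier uT.T" by blast
  qed (use g.f_im in blast)
  moreover have "linear_map ?K uT.T ?Z g"
    using vectorspace_tensor[OF uV.vectorspace_axioms uW.vectorspace_axioms] uZ.vectorspace_axioms g(1)
    by (simp add: linear_map_def)
  ultimately have "linear_iso ?K uT.T ?Z g" by (simp add: linear_iso_def bij_betw_def)
  then show ?thesis using gp by (intro exI[of _ g]) simp
qed

section \<open>The restricted ultraproduct\<close>

lemma (in abelian_tensor_category) interchange_closed: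
  assumes "A \<in> Obj C" "B \<in> Obj C" "X \<in> Obj C" "Y \<in> Obj C"
  shows "interchange C A B X Y \<in> Hom C ((A \<otimes>\<^sub>o B) \<otimes>\<^sub>o (X \<otimes>\<^sub>o Y)) ((A \<otimes>\<^sub>o X) \<otimes>\<^sub>o (B \<otimes>\<^sub>o Y))"
proof -
  have inv: "inverse_arr C P Q f \<in> Hom C Q P" if "P \<in> Obj C" "Q \<in> Obj C" "is_iso C P Q f" for P Q f
    using is_inverse_inverse_arr[OF that] by (simp add: is_inverse_def)
  have iso: "f \<in> Hom C P Q" if "is_iso C P Q f" for P Q f using that by (simp add: is_iso_def)
  note t = Tensor_closed and a = TensorArr_closed
  show ?thesis
    unfolding interchange_def
    by (rule Comp_closed[where Y = "A \<otimes>\<^sub>o (X \<otimes>\<^sub>o (B \<otimes>\<^sub>o Y))"]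
        Comp_closed[where Y = "A \<otimes>\<^sub>o ((X \<otimes>\<^sub>o B) \<otimes>\<^sub>o Y)"]
        Comp_closed[where Y = "A \<otimes>\<^sub>o ((B \<otimes>\<^sub>o X) \<otimes>\<^sub>o Y)"]
        Comp_closed[where Y = "A \<otimes>\<^sub>o (B \<otimes>\<^sub>o (X \<otimes>\<^sub>o Y))"]
      | intro t a Id_closed inv iso Assoc_iso Comm_iso assms)+
qed

context neutral_tannakian
begin

text \<open>A fibre functor only asserts that a tensor structure exists. The bounds on dimensions do
  not mention the structure, so any one may be chosen to prove them.\<close>

lemma tensor_structure_exists:
  obtains c u where "neutral_tannakian_tensor C W w c u"
proof -
  obtain c u where "tensor_structure C W w c u" using tensor_functor by blast
  then have "neutral_tannakian_tensor C W w c u"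
    using neutral_tannakian_axioms by (simp add: neutral_tannakian_tensor_def)
  then show thesis by (rule that)
qed

lemma dim_tensor_le: "X \<in> Obj C \<Longrightarrow> Y \<in> Obj C \<Longrightarrow> dm (X \<otimes>\<^sub>o Y) \<le> dm X * dm Y"
  using neutral_tannakian_tensor.tensor_dim_le by (metis tensor_structure_exists)

lemma dim_unit_le: "dm (UnitObj C) \<le> 1"
  using neutral_tannakian_tensor.unit_dim_le by (metis tensor_structure_exists)

lemma dim_internal_hom_le:
  "X \<in> Obj C \<Longrightarrow> Y \<in> Obj C \<Longrightarrow> is_internal_hom C X Y H h \<Longrightarrow> dm H \<le> dm X * dm Y"
  using neutral_tannakian_tensor.internal_hom_dim_le by (metis tensor_structure_exists)

end

locale tannakian_family =
  fixes U :: "'i filter" and C :: "'i \<Rightarrow> ('o, 'm) tensor_cat"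
    and W :: "'i \<Rightarrow> 'o \<Rightarrow> ('m, 'v) module" and w :: "'i \<Rightarrow> 'm \<Rightarrow> 'v \<Rightarrow> 'v"
  assumes ultra: "nonprincipal_ultrafilter U"
    and neutral: "neutral_tannakian (C i) (W i) (w i)"
begin

sublocale T: neutral_tannakian "C i" "W i" "w i" for i by (rule neutral)

abbreviation R where "R \<equiv> restricted_ultraproduct U C W"
abbreviation cl where "cl \<equiv> uclass U"

section \<open>Representatives of objects and arrows\<close>

lemma R_simps [simp]:
  "cl g \<cdot>\<^bsub>R\<^esub> cl f = cl (\<lambda>i. g i \<cdot>\<^bsub>C i\<^esub> f i)"
  "Id R (cl X) = cl (\<lambda>i. Id (C i) (X i))"
  "cl f \<boxplus>\<^bsub>R\<^esub> cl g = cl (\<lambda>i. f i \<boxplus>\<^bsub>C i\<^esub> g i)"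
  "Zero R (cl X) (cl Y) = cl (\<lambda>i. Zero (C i) (X i) (Y i))"
  "cl X \<otimes>\<^sub>o\<^bsub>R\<^esub> cl Y = cl (\<lambda>i. X i \<otimes>\<^sub>o\<^bsub>C i\<^esub> Y i)"
  "cl f \<otimes>\<^sub>m\<^bsub>R\<^esub> cl g = cl (\<lambda>i. f i \<otimes>\<^sub>m\<^bsub>C i\<^esub> g i)"
  "UnitObj R = cl (\<lambda>i. UnitObj (C i))"
  "Assoc R (cl X) (cl Y) (cl Z) = cl (\<lambda>i. Assoc (C i) (X i) (Y i) (Z i))"
  "Comm R (cl X) (cl Y) = cl (\<lambda>i. Comm (C i) (X i) (Y i))"
  "UnitIso R (cl X) = cl (\<lambda>i. UnitIso (C i) (X i))"
  by (simp_all add: restricted_ultraproduct_def cat_ultraproduct_def ulift1_uclass ulift2_uclass ulift3_uclass)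

text \<open>Objects of \<open>R\<close> only require entries in \<open>Obj (C i)\<close> almost
  everywhere. Asking for this at every index lets the facts about \<open>C i\<close> be used without
  exceptions; \<open>ObjE\<close> provides such representatives.\<close>

definition good :: "('i \<Rightarrow> 'o) \<Rightarrow> bool" where
  "good X \<longleftrightarrow> (\<forall>i. X i \<in> Obj (C i)) \<and> (\<exists>n. \<forall>\<^sub>F i in U. T.dm i (X i) \<le> n)"

lemma goodD [simp]: "good X \<Longrightarrow> X i \<in> Obj (C i)"
  by (simp add: good_def)

lemma cl_in_Obj [simp]: "good X \<Longrightarrow> cl X \<in> Obj R"
  by (auto simp: good_def restricted_ultraproduct_def intro!: exI[of _ X])

lemma ObjE:
  assumes "A \<in> Obj R" obtains X where "good X" "A = cl X"
proof -
  obtain Y n where Y: "A = cl Y" "\<forall>\<^sub>F i in U. Y i \<in> Obj (C i)" "\<forall>\<^sub>F i in U. T.dm i (Y i) \<le> n"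
    using assms by (auto simp: restricted_ultraproduct_def)
  \<comment> \<open>The unit object is a default that is available in every \<open>C i\<close>; the
    values at exceptional indices do not change the class.\<close>
  define X where "X i = (if Y i \<in> Obj (C i) then Y i else UnitObj (C i))" for i
  have eq: "\<forall>\<^sub>F i in U. Y i = X i" using Y(2) by eventually_elim (simp add: X_def)
  have "X i \<in> Obj (C i)" for i by (simp add: X_def T.UnitObj_closed)
  moreover have "\<forall>\<^sub>F i in U. T.dm i (X i) \<le> n" using eq Y(3) by eventually_elim simp
  ultimately have "good X" by (auto simp: good_def)
  moreover have "A = cl X" using eq by (simp add: Y(1) uclass_eq_iff)
  ultimately show thesis by (rule that)
qed

lemma cl_in_Hom [simp]: "cl f \<in> Hom R (cl X) (cl Y) \<longleftrightarrow> (\<forall>\<^sub>F i in U. f i \<in> Hom (C i) (X i) (Y i))"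
  using uclass_in_Hom_iff[of U f C X Y] by (simp add: restricted_ultraproduct_def)

lemma Hom_R: "Hom R (cl X) (cl Y) = uprod U (\<lambda>i. Hom (C i) (X i) (Y i))"
proof (intro equalityI subsetI)
  fix a assume a: "a \<in> Hom R (cl X) (cl Y)"
  then obtain f where "a = cl f" by (auto simp: restricted_ultraproduct_def cat_ultraproduct_def)
  with a show "a \<in> uprod U (\<lambda>i. Hom (C i) (X i) (Y i))" by simp
qed (auto simp: uprod_def)

lemma HomE:
  assumes "a \<in> Hom R (cl X) (cl Y)"
  obtains f where "a = cl f" "\<forall>i. X i \<in> Obj (C i) \<longrightarrow> Y i \<in> Obj (C i) \<longrightarrow> f i \<in> Hom (C i) (X i) (Y i)"
proof -
  obtain f where f: "a = cl f" "\<forall>\<^sub>F i in U. f i \<in> Hom (C i) (X i) (Y i)"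
    using assms unfolding Hom_R by (auto simp: uprod_def)
  \<comment> \<open>The zero arrow is the default here. It is known to be an arrow from
    \<open>X i\<close> to \<open>Y i\<close> only between objects of \<open>C i\<close>, whence the
    conditional form of the conclusion.\<close>
  define g where "g i = (if f i \<in> Hom (C i) (X i) (Y i) then f i else Zero (C i) (X i) (Y i))" for i
  have "\<forall>\<^sub>F i in U. f i = g i" using f(2) by eventually_elim (simp add: g_def)
  then have "a = cl g" by (simp add: f(1) uclass_eq_iff)
  moreover have "\<forall>i. X i \<in> Obj (C i) \<longrightarrow> Y i \<in> Obj (C i) \<longrightarrow> g i \<in> Hom (C i) (X i) (Y i)"
    by (auto simp: g_def T.Zero_closed)
  ultimately show thesis by (rule that)
qed

lemma category_R: "category R"
proof
  fix A B A' B' f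
  assume "A \<in> Obj R" "B \<in> Obj R" "A' \<in> Obj R" "B' \<in> Obj R" "f \<in> Hom R A B" "f \<in> Hom R A' B'"
  then obtain X Y X' Y' g where g: "good X" "good Y" "good X'" "good Y'"
      "A = cl X" "B = cl Y" "A' = cl X'" "B' = cl Y'" "f = cl g"
      "cl g \<in> Hom R (cl X) (cl Y)" "cl g \<in> Hom R (cl X') (cl Y')"
    by (metis ObjE HomE)
  then have "\<forall>\<^sub>F i in U. g i \<in> Hom (C i) (X i) (Y i)" "\<forall>\<^sub>F i in U. g i \<in> Hom (C i) (X' i) (Y' i)" by simp_all
  then have "\<forall>\<^sub>F i in U. X i = X' i \<and> Y i = Y' i"
    by eventually_elim (use g(1-4) T.Hom_unique in \<open>metis goodD\<close>)
  then show "A = A' \<and> B = B'" by (simp add: g uclass_eq_iff eventually_conj_iff)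
next
  fix A B D f g
  assume "A \<in> Obj R" "B \<in> Obj R" "D \<in> Obj R" "f \<in> Hom R A B" "g \<in> Hom R B D"
  then show "g \<cdot>\<^bsub>R\<^esub> f \<in> Hom R A D"
    by (clarsimp elim!: ObjE HomE) (meson T.Comp_closed goodD always_eventually)
next
  fix A assume "A \<in> Obj R"
  then show "Id R A \<in> Hom R A A" by (clarsimp elim!: ObjE simp: T.Id_closed)
next
  fix A B f assume "A \<in> Obj R" "B \<in> Obj R" "f \<in> Hom R A B"
  then show "f \<cdot>\<^bsub>R\<^esub> Id R A = f"
    by (clarsimp elim!: ObjE HomE) (rule uclass_cong, metis T.Comp_Id goodD)
next
  fix A B f assume "A \<in> Obj R" "B \<in> Obj R" "f \<in> Hom R A B"
  then show "Id R B \<cdot>\<^bsub>R\<^esub> f = f"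
    by (clarsimp elim!: ObjE HomE) (rule uclass_cong, metis T.Id_Comp goodD)
next
  fix A B D E f g h
  assume "A \<in> Obj R" "B \<in> Obj R" "D \<in> Obj R" "E \<in> Obj R"
    "f \<in> Hom R A B" "g \<in> Hom R B D" "h \<in> Hom R D E"
  then show "(h \<cdot>\<^bsub>R\<^esub> g) \<cdot>\<^bsub>R\<^esub> f = h \<cdot>\<^bsub>R\<^esub> (g \<cdot>\<^bsub>R\<^esub> f)"
    by (clarsimp elim!: ObjE HomE) (rule uclass_cong, metis T.Comp_assoc goodD)
qed

sublocale R: category R by (rule category_R)

lemma preadditive_category_R: "preadditive_category R"
proof (rule preadditive_category.intro[OF category_R], rule preadditive_category_axioms.intro)
  fix A B assume "A \<in> Obj R" "B \<in> Obj R"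
  then obtain X Y where X: "good X" "A = cl X" and Y: "good Y" "B = cl Y" by (metis ObjE)
  let ?H = "\<lambda>i. \<lparr>carrier = Hom (C i) (X i) (Y i), monoid.mult = Add (C i), one = Zero (C i) (X i) (Y i)\<rparr>"
  interpret G: comm_group "?H i" for i using X Y by (intro T.Hom_comm_group) simp_all
  note ops = G.m_closed[simplified] G.one_closed[simplified] G.m_assoc[simplified] G.m_comm[simplified]
    G.l_one[simplified]
  have E: "\<exists>f. a = cl f \<and> (\<forall>i. f i \<in> Hom (C i) (X i) (Y i))" if "a \<in> Hom R A B" for a
    using that X Y by (auto elim!: HomE)
  show "comm_group \<lparr>carrier = Hom R A B, monoid.mult = Add R, one = Zero R A B\<rparr>"
  proof (rule comm_groupI; simp)
    fix a b assume "a \<in> Hom R A B" "b \<in> Hom R A B"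
    then obtain f g where f: "a = cl f" "b = cl g" "\<forall>i. f i \<in> Hom (C i) (X i) (Y i)"
      "\<forall>i. g i \<in> Hom (C i) (X i) (Y i)" using E by metis
    then show "a \<boxplus>\<^bsub>R\<^esub> b \<in> Hom R A B" by (simp add: X Y ops)
    have "f i \<boxplus>\<^bsub>C i\<^esub> g i = g i \<boxplus>\<^bsub>C i\<^esub> f i" for i using f ops(4)[of "f i" i "g i"] by blast
    then show "a \<boxplus>\<^bsub>R\<^esub> b = b \<boxplus>\<^bsub>R\<^esub> a" by (simp add: f(1,2) uclass_eq_iff)
    fix c assume "c \<in> Hom R A B"
    then obtain h where "c = cl h" "\<forall>i. h i \<in> Hom (C i) (X i) (Y i)" using E by metis
    then show "a \<boxplus>\<^bsub>R\<^esub> b \<boxplus>\<^bsub>R\<^esub> c = a \<boxplus>\<^bsub>R\<^esub> (b \<boxplus>\<^bsub>R\<^esub> c)" using f by (simp add: ops(3))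
  next
    show "Zero R A B \<in> Hom R A B" by (simp add: X Y ops)
  next
    fix a assume "a \<in> Hom R A B"
    then obtain f where f: "a = cl f" "\<forall>i. f i \<in> Hom (C i) (X i) (Y i)" using E by metis
    then show "Zero R A B \<boxplus>\<^bsub>R\<^esub> a = a" by (simp add: X Y ops(5))
    have "\<forall>i. \<exists>g. g \<in> Hom (C i) (X i) (Y i) \<and> g \<boxplus>\<^bsub>C i\<^esub> f i = Zero (C i) (X i) (Y i)"
      using G.l_inv_ex[simplified] f(2) by blast
    then obtain g where "\<And>i. g i \<in> Hom (C i) (X i) (Y i) \<and> g i \<boxplus>\<^bsub>C i\<^esub> f i = Zero (C i) (X i) (Y i)"
      by metis
    then show "\<exists>b\<in>Hom R A B. b \<boxplus>\<^bsub>R\<^esub> a = Zero R A B"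
      using f by (intro bexI[of _ "cl g"]) (simp_all add: X Y)
  qed
next
  fix A B D f f' g
  assume "A \<in> Obj R" "B \<in> Obj R" "D \<in> Obj R" "f \<in> Hom R A B" "f' \<in> Hom R A B" "g \<in> Hom R B D"
  then show "g \<cdot>\<^bsub>R\<^esub> (f \<boxplus>\<^bsub>R\<^esub> f') = (g \<cdot>\<^bsub>R\<^esub> f) \<boxplus>\<^bsub>R\<^esub> (g \<cdot>\<^bsub>R\<^esub> f')"
    by (clarsimp elim!: ObjE HomE) (rule uclass_cong, metis T.Comp_Add goodD)
next
  fix A B D f g g'
  assume "A \<in> Obj R" "B \<in> Obj R" "D \<in> Obj R" "f \<in> Hom R A B" "g \<in> Hom R B D" "g' \<in> Hom R B D"
  then show "(g \<boxplus>\<^bsub>R\<^esub> g') \<cdot>\<^bsub>R\<^esub> f = (g \<cdot>\<^bsub>R\<^esub> f) \<boxplus>\<^bsub>R\<^esub> (g' \<cdot>\<^bsub>R\<^esub> f)"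
    by (clarsimp elim!: ObjE HomE) (rule uclass_cong, metis T.Add_Comp goodD)
qed

sublocale R: preadditive_category R by (rule preadditive_category_R)

text \<open>Monotonicity of \<open>b\<close> turns bounds for \<open>X\<close> and \<open>Y\<close>
  on a large set into a single bound for \<open>Z\<close>. It is used with sums, products and the
  two projections.\<close>

lemma good_boundedI:
  assumes "\<And>i. Z i \<in> Obj (C i)" "good X" "good Y" "\<And>i. T.dm i (Z i) \<le> b (T.dm i (X i)) (T.dm i (Y i))"
    and mono: "\<And>m m' n n'. m \<le> m' \<Longrightarrow> n \<le> n' \<Longrightarrow> b m n \<le> b m' n'"
  shows "good Z"
proof -
  obtain m n where "\<forall>\<^sub>F i in U. T.dm i (X i) \<le> m" "\<forall>\<^sub>F i in U. T.dm i (Y i) \<le> n"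
    using assms(2,3) by (auto simp: good_def)
  then have "\<forall>\<^sub>F i in U. T.dm i (Z i) \<le> b m n"
    by eventually_elim (meson assms(4) mono order_trans)
  with assms(1) show ?thesis by (auto simp: good_def)
qed

section \<open>Constructions that keep dimensions bounded\<close>

lemma good_kernel:
  assumes "good X" "good Y" "\<And>i. is_kernel (C i) (X i) (Y i) (f i) (L i) (k i)"
  shows "good L"
proof (rule good_boundedI[where b = "\<lambda>m n. m", OF _ assms(1,2)])
  show "L i \<in> Obj (C i)" for i using assms(3) by (simp add: is_kernel_def)
  show "T.dm i (L i) \<le> T.dm i (X i)" for i by (rule T.kernel_dim_le[OF _ _ assms(3)]) (simp_all add: assms)
qed

lemma good_cokernel:
  assumes "good X" "good Y" "\<And>i. is_cokernel (C i) (X i) (Y i) (f i) (Q i) (q i)"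
  shows "good Q"
proof (rule good_boundedI[where b = "\<lambda>m n. n", OF _ assms(1,2)])
  show "Q i \<in> Obj (C i)" for i using assms(3) by (simp add: is_cokernel_def)
  show "T.dm i (Q i) \<le> T.dm i (Y i)" for i by (rule T.cokernel_dim_le[OF _ _ assms(3)]) (simp_all add: assms)
qed

lemma good_tensor [simp]: "good X \<Longrightarrow> good Y \<Longrightarrow> good (\<lambda>i. X i \<otimes>\<^sub>o\<^bsub>C i\<^esub> Y i)"
  by (rule good_boundedI[where b = "\<lambda>m n. m * n" and X = X and Y = Y])
    (auto simp: T.Tensor_closed T.dim_tensor_le mult_le_mono)

lemma good_unit [simp]: "good (\<lambda>i. UnitObj (C i))"
  unfolding good_def using T.dim_unit_le T.UnitObj_closed by (blast intro: always_eventually)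

lemma good_internal_hom:
  assumes "good X" "good Y" "\<And>i. is_internal_hom (C i) (X i) (Y i) (H i) (e i)"
  shows "good H"
proof (rule good_boundedI[where b = "\<lambda>m n. m * n", OF _ assms(1,2)])
  show "H i \<in> Obj (C i)" for i using assms(3) by (simp add: is_internal_hom_def)
  show "T.dm i (H i) \<le> T.dm i (X i) * T.dm i (Y i)" for i
    by (rule T.dim_internal_hom_le[OF _ _ assms(3)]) (simp_all add: assms)
qed (rule mult_le_mono)

section \<open>Kernels and cokernels in the restricted ultraproduct, and the abelian
  structure\<close>

lemma is_kernel_R_I:
  assumes X: "good X" "good Y" "good L" and k: "\<forall>\<^sub>F i in U. is_kernel (C i) (X i) (Y i) (f i) (L i) (k i)"
  shows "is_kernel R (cl X) (cl Y) (cl f) (cl L) (cl k)"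
  unfolding is_kernel_def
proof (intro conjI ballI impI)
  show "cl f \<in> Hom R (cl X) (cl Y)" "cl k \<in> Hom R (cl L) (cl X)" "cl f \<cdot>\<^bsub>R\<^esub> cl k = Zero R (cl L) (cl Y)"
    using k by (auto simp: uclass_eq_iff is_kernel_def elim: eventually_mono)
  fix T' g' assume "T' \<in> Obj R" "g' \<in> Hom R T' (cl X)" and z: "cl f \<cdot>\<^bsub>R\<^esub> g' = Zero R T' (cl Y)"
  then obtain T g where T: "good T" "T' = cl T" and g: "g' = cl g" "\<forall>i. g i \<in> Hom (C i) (T i) (X i)"
    using X by (metis ObjE HomE goodD)
  have "\<forall>\<^sub>F i in U. f i \<cdot>\<^bsub>C i\<^esub> g i = Zero (C i) (T i) (Y i)" using z by (simp add: T g uclass_eq_iff)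
  \<comment> \<open>A test object of \<open>R\<close> has a representative with entries in all the
    \<open>C i\<close>, so the universal property of almost every component applies; the solutions
    chosen there form one class.\<close>
  with k have ex: "\<forall>\<^sub>F i in U. \<exists>!h. h \<in> Hom (C i) (T i) (L i) \<and> k i \<cdot>\<^bsub>C i\<^esub> h = g i"
    by eventually_elim (use T g in \<open>simp add: is_kernel_def\<close>)
  then have "\<forall>\<^sub>F i in U. \<exists>h. h \<in> Hom (C i) (T i) (L i) \<and> k i \<cdot>\<^bsub>C i\<^esub> h = g i"
    by eventually_elim blast
  then obtain h where h: "\<forall>\<^sub>F i in U. h i \<in> Hom (C i) (T i) (L i) \<and> k i \<cdot>\<^bsub>C i\<^esub> h i = g i"
    unfolding eventually_ex by blast
  show "\<exists>!h. h \<in> Hom R T' (cl L) \<and> cl k \<cdot>\<^bsub>R\<^esub> h = g'"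
  proof (rule ex1I[of _ "cl h"])
    show "cl h \<in> Hom R T' (cl L) \<and> cl k \<cdot>\<^bsub>R\<^esub> cl h = g'"
      using h by (auto simp: T g uclass_eq_iff elim: eventually_mono)
    fix a assume a: "a \<in> Hom R T' (cl L) \<and> cl k \<cdot>\<^bsub>R\<^esub> a = g'"
    then obtain b where b: "a = cl b" "\<forall>i. b i \<in> Hom (C i) (T i) (L i)"
      using X T by (metis HomE goodD)
    have "\<forall>\<^sub>F i in U. k i \<cdot>\<^bsub>C i\<^esub> b i = g i" using a by (simp add: b g uclass_eq_iff)
    with ex h have "\<forall>\<^sub>F i in U. b i = h i" by eventually_elim (use b in blast)
    then show "a = cl h" by (simp add: b uclass_eq_iff)
  qed
qed (use X in simp)

lemma is_kernel_R_D:
  assumes X: "good X" "good Y" "good L" and K: "is_kernel R (cl X) (cl Y) (cl f) (cl L) (cl k)"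
  shows "\<forall>\<^sub>F i in U. is_kernel (C i) (X i) (Y i) (f i) (L i) (k i)"
proof -
  have "cl f \<in> Hom R (cl X) (cl Y)" using K by (simp add: is_kernel_def)
  \<comment> \<open>The entries of \<open>f\<close> are known to be arrows only almost everywhere;
    \<open>f'\<close> changes the others, so that a kernel can be chosen at every index.\<close>
  then obtain f' where f': "cl f = cl f'" "\<forall>i. f' i \<in> Hom (C i) (X i) (Y i)"
    using X by (metis HomE goodD)
  have "\<forall>i. \<exists>L' k'. is_kernel (C i) (X i) (Y i) (f' i) L' k'"
    using X f' T.kernel_exists by (metis goodD)
  then obtain L' k' where k': "\<And>i. is_kernel (C i) (X i) (Y i) (f' i) (L' i) (k' i)" by metis
  have L': "good L'" by (rule good_kernel[OF X(1,2) k'])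
  have K': "is_kernel R (cl X) (cl Y) (cl f) (cl L') (cl k')"
    unfolding f'(1) using X L' k' by (intro is_kernel_R_I) auto
  have fact: "\<exists>!h. h \<in> Hom R (cl L1) (cl L2) \<and> cl k2 \<cdot>\<^bsub>R\<^esub> h = cl k1"
    if "good L1" "is_kernel R (cl X) (cl Y) (cl f) (cl L1) (cl k1)" "is_kernel R (cl X) (cl Y) (cl f) (cl L2) (cl k2)"
    for L1 L2 k1 k2
  proof -
    have "cl L1 \<in> Obj R" using that(1) by simp
    moreover have "cl k1 \<in> Hom R (cl L1) (cl X)" "cl f \<cdot>\<^bsub>R\<^esub> cl k1 = Zero R (cl L1) (cl Y)"
      using that(2) unfolding is_kernel_def by blast+
    ultimately show ?thesis using that(3) unfolding is_kernel_def by blast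
  qed
  obtain a where a: "cl a \<in> Hom R (cl L) (cl L')" "cl k' \<cdot>\<^bsub>R\<^esub> cl a = cl k" "\<forall>i. a i \<in> Hom (C i) (L i) (L' i)"
    using fact[OF X(3) K K'] X L' by (metis HomE goodD)
  obtain b where b: "cl b \<in> Hom R (cl L') (cl L)" "cl k \<cdot>\<^bsub>R\<^esub> cl b = cl k'" "\<forall>i. b i \<in> Hom (C i) (L' i) (L i)"
    using fact[OF L' K' K] X L' by (metis HomE goodD)
  have O: "cl L \<in> Obj R" "cl L' \<in> Obj R" "cl X \<in> Obj R" using X L' by simp_all
  have k: "cl k \<in> Hom R (cl L) (cl X)" "cl k' \<in> Hom R (cl L') (cl X)"
    using K K' unfolding is_kernel_def by blast+
  \<comment> \<open>Both the composite of \<open>cl b\<close> and \<open>cl a\<close> and the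
    identity factor \<open>cl k'\<close> through itself; uniqueness of the factorisation makes them
    equal.\<close>
  have "cl k' \<cdot>\<^bsub>R\<^esub> (cl a \<cdot>\<^bsub>R\<^esub> cl b) = cl k'"
    using R.Comp_assoc[OF O(2) O(1) O(2) O(3) b(1) a(1) k(2)] a(2) b(2) by (simp del: R_simps)
  moreover have "cl k' \<cdot>\<^bsub>R\<^esub> Id R (cl L') = cl k'" by (rule R.Comp_Id[OF O(2,3) k(2)])
  ultimately have ab: "cl a \<cdot>\<^bsub>R\<^esub> cl b = Id R (cl L')"
    using fact[OF L' K' K'] R.Comp_closed[OF O(2,1,2) b(1) a(1)] R.Id_closed[OF O(2)] by blast
  have "cl k \<cdot>\<^bsub>R\<^esub> (cl b \<cdot>\<^bsub>R\<^esub> cl a) = cl k"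
    using R.Comp_assoc[OF O(1) O(2) O(1) O(3) a(1) b(1) k(1)] a(2) b(2) by (simp del: R_simps)
  moreover have "cl k \<cdot>\<^bsub>R\<^esub> Id R (cl L) = cl k" by (rule R.Comp_Id[OF O(1,3) k(1)])
  ultimately have ba: "cl b \<cdot>\<^bsub>R\<^esub> cl a = Id R (cl L)"
    using fact[OF X(3) K K] R.Comp_closed[OF O(1,2,1) a(1) b(1)] R.Id_closed[OF O(1)] by blast
  \<comment> \<open>Back in the components: for almost every \<open>i\<close> the objects
    \<open>L i\<close> and \<open>L' i\<close> are isomorphic compatibly with \<open>k i\<close> and
    \<open>k' i\<close>, so \<open>kernel_transport\<close> applies.\<close>
  have "\<forall>\<^sub>F i in U. f i = f' i" "\<forall>\<^sub>F i in U. k' i \<cdot>\<^bsub>C i\<^esub> a i = k i"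
    "\<forall>\<^sub>F i in U. a i \<cdot>\<^bsub>C i\<^esub> b i = Id (C i) (L' i)" "\<forall>\<^sub>F i in U. b i \<cdot>\<^bsub>C i\<^esub> a i = Id (C i) (L i)"
    using f'(1) a(2) ab ba by (simp_all add: uclass_eq_iff)
  then show ?thesis
  proof eventually_elim
    case (elim i)
    show ?case
      using T.kernel_transport[OF k', of i "L i" "a i" "b i"] X elim a(3) b(3) by simp
  qed
qed

lemma is_cokernel_R_I:
  assumes X: "good X" "good Y" "good Q" and q: "\<forall>\<^sub>F i in U. is_cokernel (C i) (X i) (Y i) (f i) (Q i) (q i)"
  shows "is_cokernel R (cl X) (cl Y) (cl f) (cl Q) (cl q)"
  unfolding is_cokernel_def
proof (intro conjI ballI impI)
  show "cl f \<in> Hom R (cl X) (cl Y)" "cl q \<in> Hom R (cl Y) (cl Q)" "cl q \<cdot>\<^bsub>R\<^esub> cl f = Zero R (cl X) (cl Q)"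
    using q by (auto simp: uclass_eq_iff is_cokernel_def elim: eventually_mono)
  fix T' g' assume "T' \<in> Obj R" "g' \<in> Hom R (cl Y) T'" and z: "g' \<cdot>\<^bsub>R\<^esub> cl f = Zero R (cl X) T'"
  then obtain T g where T: "good T" "T' = cl T" and g: "g' = cl g" "\<forall>i. g i \<in> Hom (C i) (Y i) (T i)"
    using X by (metis ObjE HomE goodD)
  have "\<forall>\<^sub>F i in U. g i \<cdot>\<^bsub>C i\<^esub> f i = Zero (C i) (X i) (T i)" using z by (simp add: T g uclass_eq_iff)
  with q have ex: "\<forall>\<^sub>F i in U. \<exists>!h. h \<in> Hom (C i) (Q i) (T i) \<and> h \<cdot>\<^bsub>C i\<^esub> q i = g i"
    by eventually_elim (use T g in \<open>simp add: is_cokernel_def\<close>)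
  then have "\<forall>\<^sub>F i in U. \<exists>h. h \<in> Hom (C i) (Q i) (T i) \<and> h \<cdot>\<^bsub>C i\<^esub> q i = g i"
    by eventually_elim blast
  then obtain h where h: "\<forall>\<^sub>F i in U. h i \<in> Hom (C i) (Q i) (T i) \<and> h i \<cdot>\<^bsub>C i\<^esub> q i = g i"
    unfolding eventually_ex by blast
  show "\<exists>!h. h \<in> Hom R (cl Q) T' \<and> h \<cdot>\<^bsub>R\<^esub> cl q = g'"
  proof (rule ex1I[of _ "cl h"])
    show "cl h \<in> Hom R (cl Q) T' \<and> cl h \<cdot>\<^bsub>R\<^esub> cl q = g'"
      using h by (auto simp: T g uclass_eq_iff elim: eventually_mono)
    fix a assume a: "a \<in> Hom R (cl Q) T' \<and> a \<cdot>\<^bsub>R\<^esub> cl q = g'"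
    then obtain b where b: "a = cl b" "\<forall>i. b i \<in> Hom (C i) (Q i) (T i)"
      using X T by (metis HomE goodD)
    have "\<forall>\<^sub>F i in U. b i \<cdot>\<^bsub>C i\<^esub> q i = g i" using a by (simp add: b g uclass_eq_iff)
    with ex h have "\<forall>\<^sub>F i in U. b i = h i" by eventually_elim (use b in blast)
    then show "a = cl h" by (simp add: b uclass_eq_iff)
  qed
qed (use X in simp)

lemma is_cokernel_R_D:
  assumes X: "good X" "good Y" "good Q" and K: "is_cokernel R (cl X) (cl Y) (cl f) (cl Q) (cl q)"
  shows "\<forall>\<^sub>F i in U. is_cokernel (C i) (X i) (Y i) (f i) (Q i) (q i)"
proof -
  have "cl f \<in> Hom R (cl X) (cl Y)" using K by (simp add: is_cokernel_def)
  then obtain f' where f': "cl f = cl f'" "\<forall>i. f' i \<in> Hom (C i) (X i) (Y i)"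
    using X by (metis HomE goodD)
  have "\<forall>i. \<exists>Q' q'. is_cokernel (C i) (X i) (Y i) (f' i) Q' q'"
    using X f' T.cokernel_exists by (metis goodD)
  then obtain Q' q' where q': "\<And>i. is_cokernel (C i) (X i) (Y i) (f' i) (Q' i) (q' i)" by metis
  have Q': "good Q'" by (rule good_cokernel[OF X(1,2) q'])
  have K': "is_cokernel R (cl X) (cl Y) (cl f) (cl Q') (cl q')"
    unfolding f'(1) using X Q' q' by (intro is_cokernel_R_I) auto
  have fact: "\<exists>!h. h \<in> Hom R (cl L2) (cl L1) \<and> h \<cdot>\<^bsub>R\<^esub> cl k2 = cl k1"
    if "good L1" "is_cokernel R (cl X) (cl Y) (cl f) (cl L1) (cl k1)" "is_cokernel R (cl X) (cl Y) (cl f) (cl L2) (cl k2)"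
    for L1 L2 k1 k2
  proof -
    have "cl L1 \<in> Obj R" using that(1) by simp
    moreover have "cl k1 \<in> Hom R (cl Y) (cl L1)" "cl k1 \<cdot>\<^bsub>R\<^esub> cl f = Zero R (cl X) (cl L1)"
      using that(2) unfolding is_cokernel_def by blast+
    ultimately show ?thesis using that(3) unfolding is_cokernel_def by blast
  qed
  obtain a where a: "cl a \<in> Hom R (cl Q') (cl Q)" "cl a \<cdot>\<^bsub>R\<^esub> cl q' = cl q" "\<forall>i. a i \<in> Hom (C i) (Q' i) (Q i)"
    using fact[OF X(3) K K'] X Q' by (metis HomE goodD)
  obtain b where b: "cl b \<in> Hom R (cl Q) (cl Q')" "cl b \<cdot>\<^bsub>R\<^esub> cl q = cl q'" "\<forall>i. b i \<in> Hom (C i) (Q i) (Q' i)"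
    using fact[OF Q' K' K] X Q' by (metis HomE goodD)
  have O: "cl Q \<in> Obj R" "cl Q' \<in> Obj R" "cl Y \<in> Obj R" using X Q' by simp_all
  have q: "cl q \<in> Hom R (cl Y) (cl Q)" "cl q' \<in> Hom R (cl Y) (cl Q')"
    using K K' unfolding is_cokernel_def by blast+
  have "(cl b \<cdot>\<^bsub>R\<^esub> cl a) \<cdot>\<^bsub>R\<^esub> cl q' = cl q'"
    using R.Comp_assoc[OF O(3) O(2) O(1) O(2) q(2) a(1) b(1)] a(2) b(2) by (simp del: R_simps)
  moreover have "Id R (cl Q') \<cdot>\<^bsub>R\<^esub> cl q' = cl q'" by (rule R.Id_Comp[OF O(3,2) q(2)])
  ultimately have ba: "cl b \<cdot>\<^bsub>R\<^esub> cl a = Id R (cl Q')"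
    using fact[OF Q' K' K'] R.Comp_closed[OF O(2,1,2) a(1) b(1)] R.Id_closed[OF O(2)] by blast
  have "(cl a \<cdot>\<^bsub>R\<^esub> cl b) \<cdot>\<^bsub>R\<^esub> cl q = cl q"
    using R.Comp_assoc[OF O(3) O(1) O(2) O(1) q(1) b(1) a(1)] a(2) b(2) by (simp del: R_simps)
  moreover have "Id R (cl Q) \<cdot>\<^bsub>R\<^esub> cl q = cl q" by (rule R.Id_Comp[OF O(3,1) q(1)])
  ultimately have ab: "cl a \<cdot>\<^bsub>R\<^esub> cl b = Id R (cl Q)"
    using fact[OF X(3) K K] R.Comp_closed[OF O(1,2,1) b(1) a(1)] R.Id_closed[OF O(1)] by blast
  have "\<forall>\<^sub>F i in U. f i = f' i" "\<forall>\<^sub>F i in U. a i \<cdot>\<^bsub>C i\<^esub> q' i = q i"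
    "\<forall>\<^sub>F i in U. b i \<cdot>\<^bsub>C i\<^esub> a i = Id (C i) (Q' i)" "\<forall>\<^sub>F i in U. a i \<cdot>\<^bsub>C i\<^esub> b i = Id (C i) (Q i)"
    using f'(1) a(2) ab ba by (simp_all add: uclass_eq_iff)
  then show ?thesis
  proof eventually_elim
    case (elim i)
    show ?case
      using T.cokernel_transport[OF q', of i "Q i" "a i" "b i"] X elim a(3) b(3) by simp
  qed
qed

lemma abelian_category_R: "abelian_category R"
proof
  have "\<exists>N\<in>Obj (C i). \<forall>X\<in>Obj (C i). (\<exists>!f. f \<in> Hom (C i) X N) \<and> (\<exists>!f. f \<in> Hom (C i) N X)" for i
    by (rule T.zero_object)
  then obtain N where N: "\<And>i. N i \<in> Obj (C i)"
      "\<And>i X. X \<in> Obj (C i) \<Longrightarrow> \<exists>!f. f \<in> Hom (C i) X (N i)"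
      "\<And>i X. X \<in> Obj (C i) \<Longrightarrow> \<exists>!f. f \<in> Hom (C i) (N i) X" by metis
  have "T.dm i (N i) = 0" for i by (rule T.zero_object_dim[OF N(1,2)])
  then have gN: "good N" using N(1) by (auto simp: good_def)
  show "\<exists>N\<in>Obj R. \<forall>X\<in>Obj R. (\<exists>!f. f \<in> Hom R X N) \<and> (\<exists>!f. f \<in> Hom R N X)"
  proof (intro bexI[of _ "cl N"] ballI)
    fix A assume "A \<in> Obj R"
    then obtain X where X: "good X" "A = cl X" by (rule ObjE)
    have Z: "Zero (C i) (X i) (N i) \<in> Hom (C i) (X i) (N i)" "Zero (C i) (N i) (X i) \<in> Hom (C i) (N i) (X i)" for i
      using X gN by (simp_all add: T.Zero_closed)
    have "a = Zero R A (cl N)" if a: "a \<in> Hom R A (cl N)" for a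
    proof -
      obtain f where f: "a = cl f" "\<forall>i. f i \<in> Hom (C i) (X i) (N i)" using a X gN by (metis HomE goodD)
      have "f i = Zero (C i) (X i) (N i)" for i using N(2)[of "X i" i] X f Z by auto
      then show ?thesis by (simp add: f X uclass_eq_iff)
    qed
    moreover have "a = Zero R (cl N) A" if a: "a \<in> Hom R (cl N) A" for a
    proof -
      obtain f where f: "a = cl f" "\<forall>i. f i \<in> Hom (C i) (N i) (X i)" using a X gN by (metis HomE goodD)
      have "f i = Zero (C i) (N i) (X i)" for i using N(3)[of "X i" i] X f Z by auto
      then show ?thesis by (simp add: f X uclass_eq_iff)
    qed
    moreover have "Zero R A (cl N) \<in> Hom R A (cl N)" "Zero R (cl N) A \<in> Hom R (cl N) A"
      using Z by (simp_all add: X)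
    ultimately show "(\<exists>!f. f \<in> Hom R A (cl N)) \<and> (\<exists>!f. f \<in> Hom R (cl N) A)" by blast
  qed (use gN in simp)
next
  fix A B assume "A \<in> Obj R" "B \<in> Obj R"
  then obtain X Y where X: "good X" "A = cl X" and Y: "good Y" "B = cl Y" by (metis ObjE)
  have "\<forall>i. \<exists>P a b p q. P \<in> Obj (C i) \<and> a \<in> Hom (C i) (X i) P \<and> b \<in> Hom (C i) (Y i) P \<and>
      p \<in> Hom (C i) P (X i) \<and> q \<in> Hom (C i) P (Y i) \<and>
      p \<cdot>\<^bsub>C i\<^esub> a = Id (C i) (X i) \<and> q \<cdot>\<^bsub>C i\<^esub> b = Id (C i) (Y i) \<and>
      p \<cdot>\<^bsub>C i\<^esub> b = Zero (C i) (Y i) (X i) \<and> q \<cdot>\<^bsub>C i\<^esub> a = Zero (C i) (X i) (Y i) \<and>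
      (a \<cdot>\<^bsub>C i\<^esub> p) \<boxplus>\<^bsub>C i\<^esub> (b \<cdot>\<^bsub>C i\<^esub> q) = Id (C i) P"
    using T.biproduct X Y goodD by meson
  then obtain P a b p q where P: "\<And>i. P i \<in> Obj (C i) \<and> a i \<in> Hom (C i) (X i) (P i) \<and> b i \<in> Hom (C i) (Y i) (P i) \<and>
      p i \<in> Hom (C i) (P i) (X i) \<and> q i \<in> Hom (C i) (P i) (Y i) \<and>
      p i \<cdot>\<^bsub>C i\<^esub> a i = Id (C i) (X i) \<and> q i \<cdot>\<^bsub>C i\<^esub> b i = Id (C i) (Y i) \<and>
      p i \<cdot>\<^bsub>C i\<^esub> b i = Zero (C i) (Y i) (X i) \<and> q i \<cdot>\<^bsub>C i\<^esub> a i = Zero (C i) (X i) (Y i) \<and>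
      (a i \<cdot>\<^bsub>C i\<^esub> p i) \<boxplus>\<^bsub>C i\<^esub> (b i \<cdot>\<^bsub>C i\<^esub> q i) = Id (C i) (P i)"
    by metis
  have dim: "T.dm i (P i) \<le> T.dm i (X i) + T.dm i (Y i)" for i
    using P[of i] X Y by (intro T.biproduct_dim_le[where i = "a i" and j = "b i" and p = "p i" and q = "q i"]) auto
  have "good P"
    by (rule good_boundedI[where b = "\<lambda>m n. m + n", OF _ X(1) Y(1) dim]) (use P in auto)
  then show "\<exists>P\<in>Obj R. \<exists>i\<in>Hom R A P. \<exists>j\<in>Hom R B P. \<exists>p\<in>Hom R P A. \<exists>q\<in>Hom R P B.
      p \<cdot>\<^bsub>R\<^esub> i = Id R A \<and> q \<cdot>\<^bsub>R\<^esub> j = Id R B \<and> p \<cdot>\<^bsub>R\<^esub> j = Zero R B A \<and> q \<cdot>\<^bsub>R\<^esub> i = Zero R A B \<and>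
      (i \<cdot>\<^bsub>R\<^esub> p) \<boxplus>\<^bsub>R\<^esub> (j \<cdot>\<^bsub>R\<^esub> q) = Id R P"
    using P by (intro bexI[of _ "cl P"] bexI[of _ "cl a"] bexI[of _ "cl b"] bexI[of _ "cl p"] bexI[of _ "cl q"])
      (simp_all add: X Y)
next
  fix A B a assume "A \<in> Obj R" "B \<in> Obj R" "a \<in> Hom R A B"
  then obtain X Y f where X: "good X" "A = cl X" "good Y" "B = cl Y" and f: "a = cl f" "\<forall>i. f i \<in> Hom (C i) (X i) (Y i)"
    by (metis ObjE HomE goodD)
  have "\<forall>i. \<exists>L k. is_kernel (C i) (X i) (Y i) (f i) L k" using T.kernel_exists X f by (metis goodD)
  then obtain L k where k: "\<And>i. is_kernel (C i) (X i) (Y i) (f i) (L i) (k i)" by metis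
  have "is_kernel R A B a (cl L) (cl k)"
    unfolding X(2,4) f(1) by (rule is_kernel_R_I[OF X(1,3) good_kernel[OF X(1,3) k]]) (simp add: k)
  then show "\<exists>L k. is_kernel R A B a L k" by blast
  have "\<forall>i. \<exists>L k. is_cokernel (C i) (X i) (Y i) (f i) L k" using T.cokernel_exists X f by (metis goodD)
  then obtain Q q where q: "\<And>i. is_cokernel (C i) (X i) (Y i) (f i) (Q i) (q i)" by metis
  have "is_cokernel R A B a (cl Q) (cl q)"
    unfolding X(2,4) f(1) by (rule is_cokernel_R_I[OF X(1,3) good_cokernel[OF X(1,3) q]]) (simp add: q)
  then show "\<exists>Q q. is_cokernel R A B a Q q" by blast
next
  fix A B a assume "A \<in> Obj R" "B \<in> Obj R" and m: "is_mono R A B a"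
  moreover from m have "a \<in> Hom R A B" by (simp add: is_mono_def)
  ultimately obtain X Y f where X: "good X" "A = cl X" "good Y" "B = cl Y"
    and f: "a = cl f" "\<forall>i. f i \<in> Hom (C i) (X i) (Y i)"
    by (metis ObjE HomE goodD)
  have "\<forall>i. \<exists>L k. is_kernel (C i) (X i) (Y i) (f i) L k" using T.kernel_exists X f by (metis goodD)
  then obtain L k where k: "\<And>i. is_kernel (C i) (X i) (Y i) (f i) (L i) (k i)" by metis
  have "\<forall>i. \<exists>L k. is_cokernel (C i) (X i) (Y i) (f i) L k" using T.cokernel_exists X f by (metis goodD)
  then obtain Q q where q: "\<And>i. is_cokernel (C i) (X i) (Y i) (f i) (Q i) (q i)" by metis
  have gL: "good L" and gQ: "good Q" using good_kernel[OF X(1,3) k] good_cokernel[OF X(1,3) q] .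
  have z: "Zero (C i) (L i) (X i) \<in> Hom (C i) (L i) (X i)" for i using gL X by (simp add: T.Zero_closed)
  \<comment> \<open>The kernel arrow and the zero arrow have the same composite with
    \<open>a\<close>. Monomorphy in \<open>R\<close> is used for this one pair and makes
    \<open>k i\<close> zero almost everywhere, hence \<open>f i\<close> a monomorphism
    there.\<close>
  have "f i \<cdot>\<^bsub>C i\<^esub> k i = f i \<cdot>\<^bsub>C i\<^esub> Zero (C i) (L i) (X i)" for i
    using k[of i] gL X f T.Comp_Zero[of "L i" i "X i" "Y i" "f i"] by (simp add: is_kernel_def)
  then have "a \<cdot>\<^bsub>R\<^esub> cl k = a \<cdot>\<^bsub>R\<^esub> cl (\<lambda>i. Zero (C i) (L i) (X i))" by (simp add: f)
  moreover have "cl k \<in> Hom R (cl L) A" "cl (\<lambda>i. Zero (C i) (L i) (X i)) \<in> Hom R (cl L) A"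
    using k z by (simp_all add: X is_kernel_def)
  ultimately have "cl k = cl (\<lambda>i. Zero (C i) (L i) (X i))"
    using m gL unfolding is_mono_def by (meson cl_in_Obj)
  then have "\<forall>\<^sub>F i in U. k i = Zero (C i) (L i) (X i)" by (simp add: uclass_eq_iff)
  \<comment> \<open>In the abelian category \<open>C i\<close> a monomorphism is the kernel of its
    cokernel, which is \<open>q i\<close> here.\<close>
  then have "\<forall>\<^sub>F i in U. is_kernel (C i) (Y i) (Q i) (q i) (X i) (f i)"
  proof eventually_elim
    case (elim i)
    have "is_mono (C i) (X i) (Y i) (f i)" using k[of i] elim X by (intro T.mono_if_kernel_Zero[of _ _ _ _ "L i"]) auto
    then show ?case using T.mono_short_exact[of "X i" i "Y i", OF _ _ _ q] X by (simp add: short_exact_def)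
  qed
  then have "is_kernel R B (cl Q) (cl q) A a" unfolding X f using X gQ by (intro is_kernel_R_I)
  then show "\<exists>Z\<in>Obj R. \<exists>g. is_kernel R B Z g A a" using gQ cl_in_Obj by blast
next
  fix A B a assume "A \<in> Obj R" "B \<in> Obj R" and m: "is_epi R A B a"
  moreover from m have "a \<in> Hom R A B" by (simp add: is_epi_def)
  ultimately obtain X Y f where X: "good X" "A = cl X" "good Y" "B = cl Y"
    and f: "a = cl f" "\<forall>i. f i \<in> Hom (C i) (X i) (Y i)"
    by (metis ObjE HomE goodD)
  have "\<forall>i. \<exists>L k. is_kernel (C i) (X i) (Y i) (f i) L k" using T.kernel_exists X f by (metis goodD)
  then obtain L k where k: "\<And>i. is_kernel (C i) (X i) (Y i) (f i) (L i) (k i)" by metis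
  have "\<forall>i. \<exists>L k. is_cokernel (C i) (X i) (Y i) (f i) L k" using T.cokernel_exists X f by (metis goodD)
  then obtain Q q where q: "\<And>i. is_cokernel (C i) (X i) (Y i) (f i) (Q i) (q i)" by metis
  have gL: "good L" and gQ: "good Q" using good_kernel[OF X(1,3) k] good_cokernel[OF X(1,3) q] .
  have z: "Zero (C i) (Y i) (Q i) \<in> Hom (C i) (Y i) (Q i)" for i using gQ X by (simp add: T.Zero_closed)
  \<comment> \<open>Dually, epimorphy in \<open>R\<close> is tested on the cokernel arrow against
    the zero arrow.\<close>
  have "q i \<cdot>\<^bsub>C i\<^esub> f i = Zero (C i) (Y i) (Q i) \<cdot>\<^bsub>C i\<^esub> f i" for i
    using q[of i] gQ X f T.Zero_Comp[of "X i" i "Y i" "Q i" "f i"] by (simp add: is_cokernel_def)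
  then have "cl q \<cdot>\<^bsub>R\<^esub> a = cl (\<lambda>i. Zero (C i) (Y i) (Q i)) \<cdot>\<^bsub>R\<^esub> a" by (simp add: f)
  moreover have "cl q \<in> Hom R B (cl Q)" "cl (\<lambda>i. Zero (C i) (Y i) (Q i)) \<in> Hom R B (cl Q)"
    using q z by (simp_all add: X is_cokernel_def)
  ultimately have "cl q = cl (\<lambda>i. Zero (C i) (Y i) (Q i))"
    using m gQ unfolding is_epi_def by (meson cl_in_Obj)
  then have "\<forall>\<^sub>F i in U. q i = Zero (C i) (Y i) (Q i)" by (simp add: uclass_eq_iff)
  then have "\<forall>\<^sub>F i in U. is_cokernel (C i) (L i) (X i) (k i) (Y i) (f i)"
  proof eventually_elim
    case (elim i)
    have "is_epi (C i) (X i) (Y i) (f i)" using q[of i] elim X by (intro T.epi_if_cokernel_Zero[of _ _ _ _ "Q i"]) auto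
    then show ?case using T.epi_short_exact[of "X i" i "Y i", OF _ _ _ k] X by (simp add: short_exact_def)
  qed
  then have "is_cokernel R (cl L) A (cl k) B a" unfolding X f using X gL by (intro is_cokernel_R_I)
  then show "\<exists>Z\<in>Obj R. \<exists>g. is_cokernel R Z A g B a" using gL cl_in_Obj by blast
qed

sublocale R: abelian_category R by (rule abelian_category_R)

section \<open>Isomorphisms and the tensor structure\<close>

lemma is_inverse_R:
  "is_inverse R (cl X) (cl Y) (cl f) (cl g) \<longleftrightarrow> (\<forall>\<^sub>F i in U. is_inverse (C i) (X i) (Y i) (f i) (g i))"
  by (simp add: is_inverse_def uclass_eq_iff eventually_conj_iff)

lemma is_iso_R:
  assumes "good X" "good Y"
  shows "is_iso R (cl X) (cl Y) (cl f) \<longleftrightarrow> (\<forall>\<^sub>F i in U. is_iso (C i) (X i) (Y i) (f i))"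
proof
  assume iso: "is_iso R (cl X) (cl Y) (cl f)"
  then obtain b where b: "is_inverse R (cl X) (cl Y) (cl f) b" by (auto simp: is_iso_def)
  then obtain g where "b = cl g" by (auto simp: is_inverse_def elim!: HomE)
  then have "\<forall>\<^sub>F i in U. is_inverse (C i) (X i) (Y i) (f i) (g i)" using b by (simp add: is_inverse_R)
  moreover have "\<forall>\<^sub>F i in U. f i \<in> Hom (C i) (X i) (Y i)" using iso by (simp add: is_iso_def)
  ultimately show "\<forall>\<^sub>F i in U. is_iso (C i) (X i) (Y i) (f i)"
    by eventually_elim (auto simp: is_iso_def)
next
  assume iso: "\<forall>\<^sub>F i in U. is_iso (C i) (X i) (Y i) (f i)"
  then have "\<forall>\<^sub>F i in U. \<exists>g. is_inverse (C i) (X i) (Y i) (f i) g" by eventually_elim (simp add: is_iso_def)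
  then obtain g where "\<forall>\<^sub>F i in U. is_inverse (C i) (X i) (Y i) (f i) (g i)" unfolding eventually_ex by blast
  then have "is_inverse R (cl X) (cl Y) (cl f) (cl g)" by (simp add: is_inverse_R)
  moreover have "\<forall>\<^sub>F i in U. f i \<in> Hom (C i) (X i) (Y i)" using iso by eventually_elim (simp add: is_iso_def)
  ultimately show "is_iso R (cl X) (cl Y) (cl f)" by (auto simp: is_iso_def)
qed

lemma inverse_arr_R:
  assumes X: "good X" "good Y" and iso: "\<And>i. is_iso (C i) (X i) (Y i) (f i)"
  shows "inverse_arr R (cl X) (cl Y) (cl f) = cl (\<lambda>i. inverse_arr (C i) (X i) (Y i) (f i))"
proof (rule R.inverse_arr_eq)
  show "cl f \<in> Hom R (cl X) (cl Y)" using iso by (simp add: is_iso_def)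
  show "is_inverse R (cl X) (cl Y) (cl f) (cl (\<lambda>i. inverse_arr (C i) (X i) (Y i) (f i)))"
    using T.is_inverse_inverse_arr[OF _ _ iso] X by (simp add: is_inverse_R)
qed (use X in simp_all)

lemma abelian_tensor_category_R: "abelian_tensor_category R"
proof
  fix A B assume "A \<in> Obj R" "B \<in> Obj R"
  then show "A \<otimes>\<^sub>o\<^bsub>R\<^esub> B \<in> Obj R" by (clarsimp elim!: ObjE)
next
  show "UnitObj R \<in> Obj R" by simp
next
  fix A B A' B' f g
  assume "A \<in> Obj R" "B \<in> Obj R" "A' \<in> Obj R" "B' \<in> Obj R" "f \<in> Hom R A A'" "g \<in> Hom R B B'"
  then show "f \<otimes>\<^sub>m\<^bsub>R\<^esub> g \<in> Hom R (A \<otimes>\<^sub>o\<^bsub>R\<^esub> B) (A' \<otimes>\<^sub>o\<^bsub>R\<^esub> B')"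
    by (clarsimp elim!: ObjE HomE) (simp add: T.TensorArr_closed)
next
  fix A B assume "A \<in> Obj R" "B \<in> Obj R"
  then show "Id R A \<otimes>\<^sub>m\<^bsub>R\<^esub> Id R B = Id R (A \<otimes>\<^sub>o\<^bsub>R\<^esub> B)"
    by (clarsimp elim!: ObjE) (simp add: T.TensorArr_Id)
next
  fix A A' A'' B B' B'' f f' g g'
  assume "A \<in> Obj R" "A' \<in> Obj R" "A'' \<in> Obj R" "B \<in> Obj R" "B' \<in> Obj R" "B'' \<in> Obj R"
    "f \<in> Hom R A A'" "f' \<in> Hom R A' A''" "g \<in> Hom R B B'" "g' \<in> Hom R B' B''"
  then show "(f' \<cdot>\<^bsub>R\<^esub> f) \<otimes>\<^sub>m\<^bsub>R\<^esub> (g' \<cdot>\<^bsub>R\<^esub> g) = (f' \<otimes>\<^sub>m\<^bsub>R\<^esub> g') \<cdot>\<^bsub>R\<^esub> (f \<otimes>\<^sub>m\<^bsub>R\<^esub> g)"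
    by (clarsimp elim!: ObjE HomE) (rule uclass_cong, rule T.TensorArr_Comp[rotated 6], blast, blast, blast, blast, simp_all)
next
  fix A A' B B' f f' g
  assume "A \<in> Obj R" "A' \<in> Obj R" "B \<in> Obj R" "B' \<in> Obj R" "f \<in> Hom R A A'" "f' \<in> Hom R A A'" "g \<in> Hom R B B'"
  then show "(f \<boxplus>\<^bsub>R\<^esub> f') \<otimes>\<^sub>m\<^bsub>R\<^esub> g = (f \<otimes>\<^sub>m\<^bsub>R\<^esub> g) \<boxplus>\<^bsub>R\<^esub> (f' \<otimes>\<^sub>m\<^bsub>R\<^esub> g)"
    by (clarsimp elim!: ObjE HomE) (rule uclass_cong, metis T.Add_TensorArr goodD)
next
  fix A A' B B' f g g'
  assume "A \<in> Obj R" "A' \<in> Obj R" "B \<in> Obj R" "B' \<in> Obj R" "f \<in> Hom R A A'" "g \<in> Hom R B B'" "g' \<in> Hom R B B'"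
  then show "f \<otimes>\<^sub>m\<^bsub>R\<^esub> (g \<boxplus>\<^bsub>R\<^esub> g') = (f \<otimes>\<^sub>m\<^bsub>R\<^esub> g) \<boxplus>\<^bsub>R\<^esub> (f \<otimes>\<^sub>m\<^bsub>R\<^esub> g')"
    by (clarsimp elim!: ObjE HomE) (rule uclass_cong, metis T.TensorArr_Add goodD)
next
  fix A B D assume "A \<in> Obj R" "B \<in> Obj R" "D \<in> Obj R"
  then show "is_iso R (A \<otimes>\<^sub>o\<^bsub>R\<^esub> (B \<otimes>\<^sub>o\<^bsub>R\<^esub> D)) ((A \<otimes>\<^sub>o\<^bsub>R\<^esub> B) \<otimes>\<^sub>o\<^bsub>R\<^esub> D) (Assoc R A B D)"
    by (clarsimp elim!: ObjE) (simp add: is_iso_R T.Assoc_iso)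
next
  fix A A' B B' D D' f g h
  assume "A \<in> Obj R" "A' \<in> Obj R" "B \<in> Obj R" "B' \<in> Obj R" "D \<in> Obj R" "D' \<in> Obj R"
    "f \<in> Hom R A A'" "g \<in> Hom R B B'" "h \<in> Hom R D D'"
  then show "Assoc R A' B' D' \<cdot>\<^bsub>R\<^esub> (f \<otimes>\<^sub>m\<^bsub>R\<^esub> (g \<otimes>\<^sub>m\<^bsub>R\<^esub> h)) = ((f \<otimes>\<^sub>m\<^bsub>R\<^esub> g) \<otimes>\<^sub>m\<^bsub>R\<^esub> h) \<cdot>\<^bsub>R\<^esub> Assoc R A B D"
    by (clarsimp elim!: ObjE HomE) (rule uclass_cong, metis T.Assoc_natural goodD)
next
  fix A B assume "A \<in> Obj R" "B \<in> Obj R"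
  then show "is_iso R (A \<otimes>\<^sub>o\<^bsub>R\<^esub> B) (B \<otimes>\<^sub>o\<^bsub>R\<^esub> A) (Comm R A B)"
    by (clarsimp elim!: ObjE) (simp add: is_iso_R T.Comm_iso)
next
  fix A A' B B' f g
  assume "A \<in> Obj R" "A' \<in> Obj R" "B \<in> Obj R" "B' \<in> Obj R" "f \<in> Hom R A A'" "g \<in> Hom R B B'"
  then show "Comm R A' B' \<cdot>\<^bsub>R\<^esub> (f \<otimes>\<^sub>m\<^bsub>R\<^esub> g) = (g \<otimes>\<^sub>m\<^bsub>R\<^esub> f) \<cdot>\<^bsub>R\<^esub> Comm R A B"
    by (clarsimp elim!: ObjE HomE) (rule uclass_cong, metis T.Comm_natural goodD)
next
  fix A assume "A \<in> Obj R"
  then show "is_iso R A (UnitObj R \<otimes>\<^sub>o\<^bsub>R\<^esub> A) (UnitIso R A)"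
    by (clarsimp elim!: ObjE) (simp add: is_iso_R T.UnitIso_iso)
next
  fix A A' f assume "A \<in> Obj R" "A' \<in> Obj R" "f \<in> Hom R A A'"
  then show "UnitIso R A' \<cdot>\<^bsub>R\<^esub> f = (Id R (UnitObj R) \<otimes>\<^sub>m\<^bsub>R\<^esub> f) \<cdot>\<^bsub>R\<^esub> UnitIso R A"
    by (clarsimp elim!: ObjE HomE) (rule uclass_cong, metis T.UnitIso_natural goodD)
next
  fix A B D E assume "A \<in> Obj R" "B \<in> Obj R" "D \<in> Obj R" "E \<in> Obj R"
  then show "Assoc R (A \<otimes>\<^sub>o\<^bsub>R\<^esub> B) D E \<cdot>\<^bsub>R\<^esub> Assoc R A B (D \<otimes>\<^sub>o\<^bsub>R\<^esub> E)
      = (Assoc R A B D \<otimes>\<^sub>m\<^bsub>R\<^esub> Id R E) \<cdot>\<^bsub>R\<^esub> Assoc R A (B \<otimes>\<^sub>o\<^bsub>R\<^esub> D) E \<cdot>\<^bsub>R\<^esub> (Id R A \<otimes>\<^sub>m\<^bsub>R\<^esub> Assoc R B D E)"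
    by (clarsimp elim!: ObjE) (rule uclass_cong, simp add: T.pentagon)
next
  fix A B assume "A \<in> Obj R" "B \<in> Obj R"
  then show "Comm R B A \<cdot>\<^bsub>R\<^esub> Comm R A B = Id R (A \<otimes>\<^sub>o\<^bsub>R\<^esub> B)"
    by (clarsimp elim!: ObjE) (simp add: T.symmetry)
next
  fix A B D assume "A \<in> Obj R" "B \<in> Obj R" "D \<in> Obj R"
  then show "Assoc R D A B \<cdot>\<^bsub>R\<^esub> Comm R (A \<otimes>\<^sub>o\<^bsub>R\<^esub> B) D \<cdot>\<^bsub>R\<^esub> Assoc R A B D
      = (Comm R A D \<otimes>\<^sub>m\<^bsub>R\<^esub> Id R B) \<cdot>\<^bsub>R\<^esub> Assoc R A D B \<cdot>\<^bsub>R\<^esub> (Id R A \<otimes>\<^sub>m\<^bsub>R\<^esub> Comm R B D)"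
    by (clarsimp elim!: ObjE) (rule uclass_cong, simp add: T.hexagon)
next
  fix A B assume "A \<in> Obj R" "B \<in> Obj R"
  then show "Assoc R A (UnitObj R) B \<cdot>\<^bsub>R\<^esub> (Id R A \<otimes>\<^sub>m\<^bsub>R\<^esub> UnitIso R B)
      = (Comm R (UnitObj R) A \<cdot>\<^bsub>R\<^esub> UnitIso R A) \<otimes>\<^sub>m\<^bsub>R\<^esub> Id R B"
    by (clarsimp elim!: ObjE) (rule uclass_cong, simp add: T.triangle)
qed

sublocale R: abelian_tensor_category R by (rule abelian_tensor_category_R)

section \<open>Internal Homs and rigidity\<close>

lemma is_internal_hom_R_I:
  assumes X: "good X" "good Y" "good H" and e: "\<forall>\<^sub>F i in U. is_internal_hom (C i) (X i) (Y i) (H i) (e i)"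
  shows "is_internal_hom R (cl X) (cl Y) (cl H) (cl e)"
  unfolding is_internal_hom_def
proof (intro conjI ballI)
  show "cl e \<in> Hom R (cl H \<otimes>\<^sub>o\<^bsub>R\<^esub> cl X) (cl Y)"
    using e by (auto simp: is_internal_hom_def elim: eventually_mono)
  fix T' g' assume "T' \<in> Obj R" and g': "g' \<in> Hom R (T' \<otimes>\<^sub>o\<^bsub>R\<^esub> cl X) (cl Y)"
  then obtain T where T: "good T" "T' = cl T" by (metis ObjE)
  obtain g where g: "g' = cl g" "\<forall>i. g i \<in> Hom (C i) (T i \<otimes>\<^sub>o\<^bsub>C i\<^esub> X i) (Y i)"
    using g' X T by (auto elim!: HomE simp: T.Tensor_closed)
  have ex: "\<forall>\<^sub>F i in U. \<exists>!h. h \<in> Hom (C i) (T i) (H i) \<and> e i \<cdot>\<^bsub>C i\<^esub> (h \<otimes>\<^sub>m\<^bsub>C i\<^esub> Id (C i) (X i)) = g i"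
    using e by eventually_elim (use T g in \<open>simp add: is_internal_hom_def\<close>)
  then have "\<forall>\<^sub>F i in U. \<exists>h. h \<in> Hom (C i) (T i) (H i) \<and> e i \<cdot>\<^bsub>C i\<^esub> (h \<otimes>\<^sub>m\<^bsub>C i\<^esub> Id (C i) (X i)) = g i"
    by eventually_elim blast
  then obtain h where h: "\<forall>\<^sub>F i in U. h i \<in> Hom (C i) (T i) (H i) \<and>
      e i \<cdot>\<^bsub>C i\<^esub> (h i \<otimes>\<^sub>m\<^bsub>C i\<^esub> Id (C i) (X i)) = g i"
    unfolding eventually_ex by blast
  show "\<exists>!h. h \<in> Hom R T' (cl H) \<and> cl e \<cdot>\<^bsub>R\<^esub> (h \<otimes>\<^sub>m\<^bsub>R\<^esub> Id R (cl X)) = g'"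
  proof (rule ex1I[of _ "cl h"])
    show "cl h \<in> Hom R T' (cl H) \<and> cl e \<cdot>\<^bsub>R\<^esub> (cl h \<otimes>\<^sub>m\<^bsub>R\<^esub> Id R (cl X)) = g'"
      using h by (auto simp: T g uclass_eq_iff elim: eventually_mono)
    fix a assume a: "a \<in> Hom R T' (cl H) \<and> cl e \<cdot>\<^bsub>R\<^esub> (a \<otimes>\<^sub>m\<^bsub>R\<^esub> Id R (cl X)) = g'"
    then obtain b where b: "a = cl b" "\<forall>i. b i \<in> Hom (C i) (T i) (H i)"
      using X T by (metis HomE goodD)
    have "\<forall>\<^sub>F i in U. e i \<cdot>\<^bsub>C i\<^esub> (b i \<otimes>\<^sub>m\<^bsub>C i\<^esub> Id (C i) (X i)) = g i" using a by (simp add: b g uclass_eq_iff)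
    with ex h have "\<forall>\<^sub>F i in U. b i = h i" by eventually_elim (use b in blast)
    then show "a = cl h" by (simp add: b uclass_eq_iff)
  qed
qed (use X in simp)

lemma is_internal_hom_R_exists:
  assumes X: "good X" "good Y"
  obtains H e where "good H" "\<And>i. is_internal_hom (C i) (X i) (Y i) (H i) (e i)"
    "is_internal_hom R (cl X) (cl Y) (cl H) (cl e)"
proof -
  have "\<forall>i. \<exists>H e. is_internal_hom (C i) (X i) (Y i) H e"
    using X T.internal_hom_exists by (metis goodD)
  then obtain H e where e: "\<And>i. is_internal_hom (C i) (X i) (Y i) (H i) (e i)" by metis
  have H: "good H" by (rule good_internal_hom[OF X e])
  have "is_internal_hom R (cl X) (cl Y) (cl H) (cl e)" using e by (intro is_internal_hom_R_I X H) simp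
  with H e that show thesis by blast
qed

text \<open>Reflexivity and the tensor condition on internal Homs are required for every choice of
  internal Homs in \<open>R\<close>; this brings an arbitrary choice down to the components. The
  method is the one for kernels, with \<open>internal_hom_transport\<close> at the end.\<close>

lemma is_internal_hom_R_D:
  assumes X: "good X" "good Y" "good L" and K: "is_internal_hom R (cl X) (cl Y) (cl L) (cl l)"
  shows "\<forall>\<^sub>F i in U. is_internal_hom (C i) (X i) (Y i) (L i) (l i)"
proof -
  obtain H e where H: "good H" and e: "\<And>i. is_internal_hom (C i) (X i) (Y i) (H i) (e i)"
    and E: "is_internal_hom R (cl X) (cl Y) (cl H) (cl e)" using is_internal_hom_R_exists[OF X(1,2)] by blast
  have O: "cl L \<in> Obj R" "cl H \<in> Obj R" "cl X \<in> Obj R" "cl Y \<in> Obj R" using X H by simp_all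
  have fact: "\<exists>!h. h \<in> Hom R A B \<and> q \<cdot>\<^bsub>R\<^esub> (h \<otimes>\<^sub>m\<^bsub>R\<^esub> Id R (cl X)) = p"
    if "is_internal_hom R (cl X) (cl Y) A p" "is_internal_hom R (cl X) (cl Y) B q" for A B p q
  proof -
    have A: "A \<in> Obj R" and p: "p \<in> Hom R (A \<otimes>\<^sub>o\<^bsub>R\<^esub> cl X) (cl Y)"
      using that(1) by (simp_all only: is_internal_hom_def)
    have univ: "\<forall>T\<in>Obj R. \<forall>f\<in>Hom R (T \<otimes>\<^sub>o\<^bsub>R\<^esub> cl X) (cl Y).
        \<exists>!g. g \<in> Hom R T B \<and> q \<cdot>\<^bsub>R\<^esub> (g \<otimes>\<^sub>m\<^bsub>R\<^esub> Id R (cl X)) = f"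
      using that(2)[unfolded is_internal_hom_def] by (elim conjE)
    show ?thesis by (rule bspec[OF bspec[OF univ A] p])
  qed
  obtain a where a: "cl a \<in> Hom R (cl L) (cl H)" "cl e \<cdot>\<^bsub>R\<^esub> (cl a \<otimes>\<^sub>m\<^bsub>R\<^esub> Id R (cl X)) = cl l"
    "\<forall>i. a i \<in> Hom (C i) (L i) (H i)"
    using fact[OF K E] X H by (metis HomE goodD)
  obtain b where b: "cl b \<in> Hom R (cl H) (cl L)" "cl l \<cdot>\<^bsub>R\<^esub> (cl b \<otimes>\<^sub>m\<^bsub>R\<^esub> Id R (cl X)) = cl e"
    "\<forall>i. b i \<in> Hom (C i) (H i) (L i)"
    using fact[OF E K] X H by (metis HomE goodD)
  \<comment> \<open>Tensoring with \<open>cl X\<close> is functorial, so evaluating after a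
    composite can be done in two stages. With this, the comparison arrows \<open>a\<close> and
    \<open>b\<close> are seen to be mutually inverse as in the case of kernels.\<close>
  have comp: "q \<cdot>\<^bsub>R\<^esub> ((t \<cdot>\<^bsub>R\<^esub> s) \<otimes>\<^sub>m\<^bsub>R\<^esub> Id R (cl X)) = (q \<cdot>\<^bsub>R\<^esub> (t \<otimes>\<^sub>m\<^bsub>R\<^esub> Id R (cl X))) \<cdot>\<^bsub>R\<^esub> (s \<otimes>\<^sub>m\<^bsub>R\<^esub> Id R (cl X))"
    if "A \<in> Obj R" "B \<in> Obj R" "D \<in> Obj R" "s \<in> Hom R A B" "t \<in> Hom R B D" "q \<in> Hom R (D \<otimes>\<^sub>o\<^bsub>R\<^esub> cl X) (cl Y)"
    for A B D s t q
  proof -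
    note I = R.Id_closed[OF O(3)]
    have "(t \<cdot>\<^bsub>R\<^esub> s) \<otimes>\<^sub>m\<^bsub>R\<^esub> (Id R (cl X) \<cdot>\<^bsub>R\<^esub> Id R (cl X)) = (t \<otimes>\<^sub>m\<^bsub>R\<^esub> Id R (cl X)) \<cdot>\<^bsub>R\<^esub> (s \<otimes>\<^sub>m\<^bsub>R\<^esub> Id R (cl X))"
      by (rule R.TensorArr_Comp[OF that(1-3) O(3,3,3) that(4,5) I I])
    moreover have "Id R (cl X) \<cdot>\<^bsub>R\<^esub> Id R (cl X) = Id R (cl X)" by (rule R.Id_Comp[OF O(3,3) I])
    moreover have "(q \<cdot>\<^bsub>R\<^esub> (t \<otimes>\<^sub>m\<^bsub>R\<^esub> Id R (cl X))) \<cdot>\<^bsub>R\<^esub> (s \<otimes>\<^sub>m\<^bsub>R\<^esub> Id R (cl X))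
        = q \<cdot>\<^bsub>R\<^esub> ((t \<otimes>\<^sub>m\<^bsub>R\<^esub> Id R (cl X)) \<cdot>\<^bsub>R\<^esub> (s \<otimes>\<^sub>m\<^bsub>R\<^esub> Id R (cl X)))"
      using that O I by (intro R.Comp_assoc[of "A \<otimes>\<^sub>o\<^bsub>R\<^esub> cl X" "B \<otimes>\<^sub>o\<^bsub>R\<^esub> cl X" "D \<otimes>\<^sub>o\<^bsub>R\<^esub> cl X" "cl Y"]
          R.Tensor_closed R.TensorArr_closed)
    ultimately show ?thesis by (simp del: R_simps)
  qed
  have k: "cl l \<in> Hom R (cl L \<otimes>\<^sub>o\<^bsub>R\<^esub> cl X) (cl Y)" "cl e \<in> Hom R (cl H \<otimes>\<^sub>o\<^bsub>R\<^esub> cl X) (cl Y)"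
    using K E unfolding is_internal_hom_def by blast+
  have idc: "q \<cdot>\<^bsub>R\<^esub> (Id R A \<otimes>\<^sub>m\<^bsub>R\<^esub> Id R (cl X)) = q" if "A \<in> Obj R" "q \<in> Hom R (A \<otimes>\<^sub>o\<^bsub>R\<^esub> cl X) (cl Y)" for A q
    using that O R.TensorArr_Id[OF that(1) O(3)] R.Comp_Id[OF R.Tensor_closed[OF that(1) O(3)] O(4) that(2)]
    by (simp del: R_simps)
  have "cl e \<cdot>\<^bsub>R\<^esub> ((cl a \<cdot>\<^bsub>R\<^esub> cl b) \<otimes>\<^sub>m\<^bsub>R\<^esub> Id R (cl X)) = cl e"
    using comp[OF O(2,1,2) b(1) a(1) k(2)] a(2) b(2) by (simp del: R_simps)
  then have ab: "cl a \<cdot>\<^bsub>R\<^esub> cl b = Id R (cl H)"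
    using fact[OF E E] idc[OF O(2) k(2)] R.Comp_closed[OF O(2,1,2) b(1) a(1)] R.Id_closed[OF O(2)] by blast
  have "cl l \<cdot>\<^bsub>R\<^esub> ((cl b \<cdot>\<^bsub>R\<^esub> cl a) \<otimes>\<^sub>m\<^bsub>R\<^esub> Id R (cl X)) = cl l"
    using comp[OF O(1,2,1) a(1) b(1) k(1)] a(2) b(2) by (simp del: R_simps)
  then have ba: "cl b \<cdot>\<^bsub>R\<^esub> cl a = Id R (cl L)"
    using fact[OF K K] idc[OF O(1) k(1)] R.Comp_closed[OF O(1,2,1) a(1) b(1)] R.Id_closed[OF O(1)] by blast
  have "\<forall>\<^sub>F i in U. e i \<cdot>\<^bsub>C i\<^esub> (a i \<otimes>\<^sub>m\<^bsub>C i\<^esub> Id (C i) (X i)) = l i"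
    "\<forall>\<^sub>F i in U. a i \<cdot>\<^bsub>C i\<^esub> b i = Id (C i) (H i)" "\<forall>\<^sub>F i in U. b i \<cdot>\<^bsub>C i\<^esub> a i = Id (C i) (L i)"
    using a(2) ab ba by (simp_all add: uclass_eq_iff)
  then show ?thesis
  proof eventually_elim
    case (elim i)
    show ?case
      using T.internal_hom_transport[OF e, of i "L i" "a i" "b i"] X elim a(3) b(3) by simp
  qed
qed

text \<open>Transposes in \<open>R\<close> are unique, so it suffices that the componentwise
  transposes satisfy the defining equation almost everywhere. The typing of \<open>f\<close> is
  assumed only almost everywhere because it is derived from internal Homs in the components.\<close>

lemma transpose_arr_R:
  assumes X: "good X" "good Y" "good H" "good T" and e: "is_internal_hom R (cl X) (cl Y) (cl H) (cl e)"
    and f: "\<forall>\<^sub>F i in U. f i \<in> Hom (C i) (T i \<otimes>\<^sub>o\<^bsub>C i\<^esub> X i) (Y i)"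
  shows "transpose_arr R (cl T) (cl X) (cl H) (cl e) (cl f)
    = cl (\<lambda>i. transpose_arr (C i) (T i) (X i) (H i) (e i) (f i))"
proof (rule R.transpose_arr_eq[OF e])
  have 1: "\<forall>\<^sub>F i in U. transpose_arr (C i) (T i) (X i) (H i) (e i) (f i) \<in> Hom (C i) (T i) (H i) \<and>
      e i \<cdot>\<^bsub>C i\<^esub> (transpose_arr (C i) (T i) (X i) (H i) (e i) (f i) \<otimes>\<^sub>m\<^bsub>C i\<^esub> Id (C i) (X i)) = f i"
    using is_internal_hom_R_D[OF X(1-3) e] f
  proof eventually_elim
    case (elim i)
    then show ?case using T.transpose_arr_props[OF elim(1) _ elim(2)] X by simp
  qed
  show "cl (\<lambda>i. transpose_arr (C i) (T i) (X i) (H i) (e i) (f i)) \<in> Hom R (cl T) (cl H)"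
    using 1 by (auto elim: eventually_mono)
  show "cl e \<cdot>\<^bsub>R\<^esub> (cl (\<lambda>i. transpose_arr (C i) (T i) (X i) (H i) (e i) (f i)) \<otimes>\<^sub>m\<^bsub>R\<^esub> Id R (cl X)) = cl f"
    using 1 by (auto simp: uclass_eq_iff elim: eventually_mono)
qed (use X f in simp_all)

lemma interchange_R:
  assumes "good A" "good B" "good X" "good Y"
  shows "interchange R (cl A) (cl B) (cl X) (cl Y) = cl (\<lambda>i. interchange (C i) (A i) (B i) (X i) (Y i))"
  unfolding interchange_def using assms by (simp add: inverse_arr_R T.Assoc_iso T.Tensor_closed)

lemma Obj_HomE:
  assumes "is_internal_hom R (cl X) (cl Y) A a"
  obtains H h where "good H" "A = cl H" "a = cl h"
proof -
  have "A \<in> Obj R" "a \<in> Hom R (A \<otimes>\<^sub>o\<^bsub>R\<^esub> cl X) (cl Y)" using assms by (auto simp: is_internal_hom_def)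
  then show thesis using that by (auto elim!: ObjE HomE)
qed

lemma rigid_abelian_tensor_category_R: "rigid_abelian_tensor_category R"
proof
  fix A B assume "A \<in> Obj R" "B \<in> Obj R"
  then obtain X Y where "good X" "A = cl X" "good Y" "B = cl Y" by (metis ObjE)
  then show "\<exists>H e. is_internal_hom R A B H e" using is_internal_hom_R_exists by metis
next
  fix A assume "A \<in> Obj R"
  then obtain X where X: "good X" "A = cl X" by (rule ObjE)
  show "reflexive R A"
    unfolding reflexive_def
  proof (intro allI impI; elim conjE)
    fix D' d' E' e' assume D': "is_internal_hom R A (UnitObj R) D' d'" and E': "is_internal_hom R D' (UnitObj R) E' e'"
    obtain D d where D: "good D" "D' = cl D" "d' = cl d" using D' unfolding X R_simps by (rule Obj_HomE)
    obtain E e where E: "good E" "E' = cl E" "e' = cl e" using E' unfolding D R_simps by (rule Obj_HomE)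
    \<comment> \<open>The given internal Homs of \<open>R\<close> are internal Homs in almost every
      component, where reflexivity of \<open>X i\<close> is available.\<close>
    have d: "\<forall>\<^sub>F i in U. is_internal_hom (C i) (X i) (UnitObj (C i)) (D i) (d i)"
      using D' unfolding X D R_simps by (intro is_internal_hom_R_D X D good_unit)
    have e: "\<forall>\<^sub>F i in U. is_internal_hom (C i) (D i) (UnitObj (C i)) (E i) (e i)"
      using E' unfolding E D R_simps by (intro is_internal_hom_R_D E D good_unit)
    have f: "\<forall>\<^sub>F i in U. d i \<cdot>\<^bsub>C i\<^esub> Comm (C i) (X i) (D i) \<in> Hom (C i) (X i \<otimes>\<^sub>o\<^bsub>C i\<^esub> D i) (UnitObj (C i))"
      using d
    proof eventually_elim
      case (elim i)
      have "Comm (C i) (X i) (D i) \<in> Hom (C i) (X i \<otimes>\<^sub>o\<^bsub>C i\<^esub> D i) (D i \<otimes>\<^sub>o\<^bsub>C i\<^esub> X i)"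
        using T.Comm_iso[of "X i" i "D i"] X D by (simp add: is_iso_def)
      then show ?case
        using elim X D T.Tensor_closed T.UnitObj_closed
        by (intro T.Comp_closed[of "X i \<otimes>\<^sub>o\<^bsub>C i\<^esub> D i" i "D i \<otimes>\<^sub>o\<^bsub>C i\<^esub> X i"]) (auto simp: is_internal_hom_def)
    qed
    have "\<forall>\<^sub>F i in U. is_iso (C i) (X i) (E i) (transpose_arr (C i) (X i) (D i) (E i) (e i) (d i \<cdot>\<^bsub>C i\<^esub> Comm (C i) (X i) (D i)))"
      using d e
    proof eventually_elim
      case (elim i)
      then show ?case using T.all_reflexive[of "X i" i] X unfolding reflexive_def by simp
    qed
    then show "is_iso R A E' (transpose_arr R A D' E' e' (d' \<cdot>\<^bsub>R\<^esub> Comm R A D'))"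
      using X D E E' f by (simp add: is_iso_R transpose_arr_R[where Y = "\<lambda>i. UnitObj (C i)"])
  qed
next
  fix A1 B1 A2 B2 M1 a1 M2 a2 M a
  assume "A1 \<in> Obj R" "B1 \<in> Obj R" "A2 \<in> Obj R" "B2 \<in> Obj R"
    and M: "is_internal_hom R A1 B1 M1 a1" "is_internal_hom R A2 B2 M2 a2"
      "is_internal_hom R (A1 \<otimes>\<^sub>o\<^bsub>R\<^esub> A2) (B1 \<otimes>\<^sub>o\<^bsub>R\<^esub> B2) M a"
  then obtain X1 Y1 X2 Y2 where X: "good X1" "good Y1" "good X2" "good Y2"
      "A1 = cl X1" "B1 = cl Y1" "A2 = cl X2" "B2 = cl Y2" by (metis ObjE)
  obtain H1 e1 where H1: "good H1" "M1 = cl H1" "a1 = cl e1" using M(1) unfolding X(5,6) by (rule Obj_HomE)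
  obtain H2 e2 where H2: "good H2" "M2 = cl H2" "a2 = cl e2" using M(2) unfolding X(7,8) by (rule Obj_HomE)
  obtain H e where H: "good H" "M = cl H" "a = cl e" using M(3) unfolding X(5-8) R_simps by (rule Obj_HomE)
  have e1: "\<forall>\<^sub>F i in U. is_internal_hom (C i) (X1 i) (Y1 i) (H1 i) (e1 i)"
    using M(1) unfolding X H1 by (intro is_internal_hom_R_D X H1)
  have e2: "\<forall>\<^sub>F i in U. is_internal_hom (C i) (X2 i) (Y2 i) (H2 i) (e2 i)"
    using M(2) unfolding X H2 by (intro is_internal_hom_R_D X H2)
  have M3: "is_internal_hom R (cl (\<lambda>i. X1 i \<otimes>\<^sub>o\<^bsub>C i\<^esub> X2 i)) (cl (\<lambda>i. Y1 i \<otimes>\<^sub>o\<^bsub>C i\<^esub> Y2 i)) (cl H) (cl e)"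
    using M(3) unfolding X H R_simps .
  have e: "\<forall>\<^sub>F i in U. is_internal_hom (C i) (X1 i \<otimes>\<^sub>o\<^bsub>C i\<^esub> X2 i) (Y1 i \<otimes>\<^sub>o\<^bsub>C i\<^esub> Y2 i) (H i) (e i)"
    by (rule is_internal_hom_R_D[OF _ _ H(1) M3]) (simp_all add: X)
  let ?f = "\<lambda>i. (e1 i \<otimes>\<^sub>m\<^bsub>C i\<^esub> e2 i) \<cdot>\<^bsub>C i\<^esub> interchange (C i) (H1 i) (H2 i) (X1 i) (X2 i)"
  have f: "\<forall>\<^sub>F i in U. ?f i \<in> Hom (C i) ((H1 i \<otimes>\<^sub>o\<^bsub>C i\<^esub> H2 i) \<otimes>\<^sub>o\<^bsub>C i\<^esub> (X1 i \<otimes>\<^sub>o\<^bsub>C i\<^esub> X2 i)) (Y1 i \<otimes>\<^sub>o\<^bsub>C i\<^esub> Y2 i)"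
    using e1 e2
  proof eventually_elim
    case (elim i)
    have "interchange (C i) (H1 i) (H2 i) (X1 i) (X2 i) \<in>
        Hom (C i) ((H1 i \<otimes>\<^sub>o\<^bsub>C i\<^esub> H2 i) \<otimes>\<^sub>o\<^bsub>C i\<^esub> (X1 i \<otimes>\<^sub>o\<^bsub>C i\<^esub> X2 i)) ((H1 i \<otimes>\<^sub>o\<^bsub>C i\<^esub> X1 i) \<otimes>\<^sub>o\<^bsub>C i\<^esub> (H2 i \<otimes>\<^sub>o\<^bsub>C i\<^esub> X2 i))"
      using X H1 H2 by (intro T.interchange_closed) simp_all
    moreover have "e1 i \<otimes>\<^sub>m\<^bsub>C i\<^esub> e2 i \<in>
        Hom (C i) ((H1 i \<otimes>\<^sub>o\<^bsub>C i\<^esub> X1 i) \<otimes>\<^sub>o\<^bsub>C i\<^esub> (H2 i \<otimes>\<^sub>o\<^bsub>C i\<^esub> X2 i)) (Y1 i \<otimes>\<^sub>o\<^bsub>C i\<^esub> Y2 i)"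
      using X H1 H2 elim by (intro T.TensorArr_closed T.Tensor_closed) (simp_all add: is_internal_hom_def)
    ultimately show ?case
      using X H1 H2 T.Tensor_closed
      by (intro T.Comp_closed[of _ i "(H1 i \<otimes>\<^sub>o\<^bsub>C i\<^esub> X1 i) \<otimes>\<^sub>o\<^bsub>C i\<^esub> (H2 i \<otimes>\<^sub>o\<^bsub>C i\<^esub> X2 i)"]) auto
  qed
  have "\<forall>\<^sub>F i in U. is_iso (C i) (H1 i \<otimes>\<^sub>o\<^bsub>C i\<^esub> H2 i) (H i)
      (transpose_arr (C i) (H1 i \<otimes>\<^sub>o\<^bsub>C i\<^esub> H2 i) (X1 i \<otimes>\<^sub>o\<^bsub>C i\<^esub> X2 i) (H i) (e i) (?f i))"
    using e1 e2 e by eventually_elim (rule T.internal_hom_tensor; simp add: X)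
  then show "is_iso R (M1 \<otimes>\<^sub>o\<^bsub>R\<^esub> M2) M
      (transpose_arr R (M1 \<otimes>\<^sub>o\<^bsub>R\<^esub> M2) (A1 \<otimes>\<^sub>o\<^bsub>R\<^esub> A2) M a ((a1 \<otimes>\<^sub>m\<^bsub>R\<^esub> a2) \<cdot>\<^bsub>R\<^esub> interchange R M1 M2 A1 A2))"
    unfolding X(5-8) H1(2,3) H2(2,3) H(2,3) using X(1-4) H1(1) H2(1) H(1) M3 f
    by (simp add: is_iso_R interchange_R transpose_arr_R[where Y = "\<lambda>i. Y1 i \<otimes>\<^sub>o\<^bsub>C i\<^esub> Y2 i"])
qed

text \<open>An equality of rings, not just an isomorphism: arrows of \<open>R\<close> are classes of
  tuples of arrows, and the operations on both sides are the same componentwise lifts.\<close>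

lemma End_ring_R: "End_ring R = ring_ultraproduct U (\<lambda>i. End_ring (C i))"
  unfolding End_ring_def ring_ultraproduct_def
  by (simp add: Hom_R) (simp add: restricted_ultraproduct_def cat_ultraproduct_def)

lemma tannakian_category_R: "tannakian_category R"
proof -
  have "field (End_ring R)"
    unfolding End_ring_R by (rule field_ring_ultraproduct[OF ultra T.End_field])
  then show ?thesis
    using rigid_abelian_tensor_category_R by (simp add: tannakian_category_def tannakian_category_axioms_def)
qed

end

section \<open>The fibre functor on the restricted ultraproduct\<close>

text \<open>The ultraproduct of regular modules and the regular module of the ultraproduct field may
  differ in the filler \<open>mult\<close> component, so they cannot simply be equated; linearity
  sees only carrier, addition and scalar multiplication.\<close>

lemma linear_iso_regular_module:
  assumes "linear_iso K V Z g" "carrier V = carrier K" "ring.add V = ring.add K" "smult V = monoid.mult K"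
  shows "linear_iso K (regular_module K) Z g"
proof -
  have Z: "vectorspace K Z" and g: "g \<in> module_hom K V Z"
    using assms(1) by (simp_all add: linear_iso_def linear_map_def mod_hom_def mod_hom_axioms_def)
  interpret K: field K by (rule vectorspace.axioms(2)[OF Z])
  let ?M = "regular_module K"
  have M: "vectorspace K ?M"
  proof (rule vs_criteria; (intro allI impI ballI)?)
    show "field K" by (rule K.field_axioms)
    show "\<exists>u\<in>carrier ?M. v \<oplus>\<^bsub>?M\<^esub> u = \<zero>\<^bsub>?M\<^esub>" if "v \<in> carrier ?M" for v
      using that by (intro bexI[of _ "\<ominus>\<^bsub>K\<^esub> v"]) (simp_all add: regular_module_def K.r_neg)
  qed (auto simp: regular_module_def K.a_ac K.m_assoc K.l_distr K.r_distr)
  have "module_hom K V Z = module_hom K ?M Z"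
    by (simp add: module_hom_def regular_module_def assms)
  then have "linear_map K ?M Z g"
    using M Z g by (simp add: linear_map_def mod_hom_def mod_hom_axioms_def vectorspace_def)
  then show ?thesis using assms by (simp add: linear_iso_def regular_module_def)
qed

context tannakian_family
begin

abbreviation VR where "VR \<equiv> ultra_obj U W"
abbreviation wR where "wR \<equiv> ultra_arr U w"

lemma VR_cl [simp]: "VR (cl X) = vec_ultraproduct U (\<lambda>i. W i (X i))"
  by (rule ultra_obj_uclass)

lemma wR_cl [simp]: "wR (cl f) (cl v) = cl (\<lambda>i. w i (f i) (v i))"
  by (rule ultra_arr_uclass)

lemma VRE:
  assumes "a \<in> uprod U (\<lambda>i. carrier (W i (X i)))" "good X"
  obtains x where "a = cl x" "\<forall>i. x i \<in> carrier (W i (X i))"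
proof -
  have "carrier (W i (X i)) \<noteq> {}" for i
    using vectorspace_zero_closed(1)[OF T.obj_vectorspace, of "X i" i] goodD[OF assms(2)] by blast
  then show thesis using uprod_rep[OF assms(1)] that by metis
qed

lemma vec_functor_R: "vec_functor R VR wR"
proof (rule vec_functor.intro[OF category_R], rule vec_functor_axioms.intro)
  fix A assume "A \<in> Obj R"
  then obtain X where X: "good X" "A = cl X" by (rule ObjE)
  have vs: "vectorspace (End_ring (C i)) (W i (X i))" for i using X by (simp add: T.obj_vectorspace)
  show v: "vectorspace (End_ring R) (VR A)"
    unfolding X VR_cl End_ring_R by (rule vectorspace_vec_ultraproduct[OF ultra vs])
  \<comment> \<open>The bound that defines \<open>R\<close> is what makes the fibre finite
    dimensional: spanning families of the common length \<open>n\<close> pass to the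
    ultraproduct.\<close>
  obtain n where n: "\<forall>\<^sub>F i in U. T.dm i (X i) \<le> n" using X by (auto simp: good_def)
  then have "\<forall>\<^sub>F i in U. \<exists>b. spanning (End_ring (C i)) (W i (X i)) n b"
    by eventually_elim (use X vectorspace.dim_le_spanning[OF vs] T.obj_fin_dim in simp)
  then obtain b where "\<forall>\<^sub>F i in U. spanning (End_ring (C i)) (W i (X i)) n (b i)"
    unfolding eventually_ex by blast
  from spanning_ultraproduct[OF this] show "vectorspace.fin_dim (End_ring R) (VR A)"
    using vectorspace.spanning_fin_dim[OF v] unfolding X VR_cl End_ring_R by blast
  fix v assume "v \<in> carrier (VR A)"
  then show "wR (Id R A) v = v"
    using X by (auto elim!: VRE simp: T.map_Id)
next
  fix A B a assume "A \<in> Obj R" "B \<in> Obj R" "a \<in> Hom R A B"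
  then obtain X Y f where X: "good X" "A = cl X" "good Y" "B = cl Y"
    and f: "a = cl f" "\<forall>i. f i \<in> Hom (C i) (X i) (Y i)" by (metis ObjE HomE goodD)
  show "linear_map (End_ring R) (VR A) (VR B) (wR a)"
    unfolding X VR_cl End_ring_R
    by (rule linear_map_ultraproduct[OF ultra, of _ _ _ "\<lambda>i. w i (f i)"]) (use X f in \<open>simp_all add: T.map_linear\<close>)
next
  fix A B D a b v
  assume "A \<in> Obj R" "B \<in> Obj R" "D \<in> Obj R" "a \<in> Hom R A B" "b \<in> Hom R B D" and v: "v \<in> carrier (VR A)"
  then obtain X Y Z f g where X: "good X" "A = cl X" "good Y" "B = cl Y" "good Z" "D = cl Z"
    and f: "a = cl f" "\<forall>i. f i \<in> Hom (C i) (X i) (Y i)" "b = cl g" "\<forall>i. g i \<in> Hom (C i) (Y i) (Z i)"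
    by (metis ObjE HomE goodD)
  obtain x where x: "v = cl x" "\<forall>i. x i \<in> carrier (W i (X i))" using v X by (auto elim: VRE)
  have "w i (g i \<cdot>\<^bsub>C i\<^esub> f i) (x i) = w i (g i) (w i (f i) (x i))" for i
    using X f x by (intro T.map_Comp) auto
  then show "wR (b \<cdot>\<^bsub>R\<^esub> a) v = wR b (wR a v)" by (simp add: f x)
qed

text \<open>Exactness has to be shown for every short exact sequence of \<open>R\<close>, whose
  kernel and cokernel arrows are arbitrary; the transfer of kernels and cokernels to components
  applies to both.\<close>

lemma short_exact_R:
  assumes "good X" "good Y" "good Z" "short_exact R (cl X) (cl Y) (cl Z) (cl f) (cl g)"
  shows "\<forall>\<^sub>F i in U. short_exact (C i) (X i) (Y i) (Z i) (f i) (g i)"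
  using assms is_kernel_R_D[of Y Z X g f] is_cokernel_R_D[of X Y Z f g]
  by (simp add: short_exact_def eventually_conj_iff)

lemma scale_arr_R:
  assumes "good X" "good Y"
  shows "scale_arr R (cl X) (cl Y) (cl a) (cl f) = cl (\<lambda>i. scale_arr (C i) (X i) (Y i) (a i) (f i))"
  unfolding scale_arr_def using assms by (simp add: inverse_arr_R T.UnitIso_iso)

lemma tensor_structure_R: "\<exists>c u. tensor_structure R VR wR c u"
proof -
  have "\<forall>i. \<exists>c u. tensor_structure (C i) (W i) (w i) c u" using T.tensor_functor by blast
  then obtain c u where cu: "\<And>i. tensor_structure (C i) (W i) (w i) (c i) (u i)" by metis
  let ?K = "ring_ultraproduct U (\<lambda>i. End_ring (C i))"
  let ?p = "\<lambda>i X Y. pure_tensor (End_ring (C i)) (W i X) (W i Y)"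
  define V where "V X = vec_ultraproduct U (\<lambda>i. W i (X i))" for X
  define P where "P X Y g \<longleftrightarrow>
    linear_iso ?K (tensor_module ?K (V X) (V Y)) (V (\<lambda>i. X i \<otimes>\<^sub>o\<^bsub>C i\<^esub> Y i)) g \<and>
    (\<forall>x y. (\<forall>i. x i \<in> carrier (W i (X i))) \<longrightarrow> (\<forall>i. y i \<in> carrier (W i (Y i))) \<longrightarrow>
      g (pure_tensor ?K (V X) (V Y) (cl x) (cl y)) = cl (\<lambda>i. c i (X i) (Y i) (?p i (X i) (Y i) (x i) (y i))))"
    for X Y g
  have ex: "\<exists>g. P X Y g" if X: "good X" "good Y" for X Y
  proof -
    obtain n where n: "\<forall>\<^sub>F i in U. T.dm i (X i) \<le> n" using X by (auto simp: good_def)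
    show ?thesis
      unfolding P_def V_def
      by (rule tensor_ultraproduct_iso[OF ultra _ _ n])
        (use X tensor_structure.tensor_iso[OF cu] in \<open>simp_all add: T.obj_vectorspace T.obj_fin_dim\<close>)
  qed
  \<comment> \<open>A comparison map has to be a function of the classes \<open>A\<close> and
    \<open>B\<close>, while \<open>P\<close> speaks of tuples. Representatives and map are chosen
    together, and \<open>cR\<close> is then shown to work for all good representatives.\<close>
  define cR where "cR A B = (SOME g. \<exists>X Y. good X \<and> good Y \<and> A = cl X \<and> B = cl Y \<and> P X Y g)" for A B
  have cR: "linear_iso ?K (tensor_module ?K (V X) (V Y)) (V (\<lambda>i. X i \<otimes>\<^sub>o\<^bsub>C i\<^esub> Y i)) (cR (cl X) (cl Y))"
    "\<And>x y. (\<And>i. x i \<in> carrier (W i (X i))) \<Longrightarrow> (\<And>i. y i \<in> carrier (W i (Y i))) \<Longrightarrow>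
      cR (cl X) (cl Y) (pure_tensor ?K (V X) (V Y) (cl x) (cl y))
        = cl (\<lambda>i. c i (X i) (Y i) (?p i (X i) (Y i) (x i) (y i)))"
    if X: "good X" "good Y" for X Y
  proof -
    have "\<exists>g X' Y'. good X' \<and> good Y' \<and> cl X = cl X' \<and> cl Y = cl Y' \<and> P X' Y' g"
      using ex X by blast
    from someI_ex[OF this] obtain X' Y' where X': "good X'" "good Y'" "cl X = cl X'" "cl Y = cl Y'"
      and P: "P X' Y' (cR (cl X) (cl Y))"
      unfolding cR_def by blast
    \<comment> \<open>Tuples of objects that agree almost everywhere have literally the same
      ultraproduct of fibres, so the isomorphism found for \<open>X'\<close> and \<open>Y'\<close>
      has the right source and target for \<open>X\<close> and \<open>Y\<close>.\<close>
    have eqX: "\<forall>\<^sub>F i in U. X' i = X i" "\<forall>\<^sub>F i in U. Y' i = Y i" using X'(3,4) by (metis uclass_eq_iff)+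
    have VX: "V X' = V X" "V Y' = V Y" "V (\<lambda>i. X' i \<otimes>\<^sub>o\<^bsub>C i\<^esub> Y' i) = V (\<lambda>i. X i \<otimes>\<^sub>o\<^bsub>C i\<^esub> Y i)"
      using eqX unfolding V_def by (intro vec_ultraproduct_cong; eventually_elim; simp)+
    show "linear_iso ?K (tensor_module ?K (V X) (V Y)) (V (\<lambda>i. X i \<otimes>\<^sub>o\<^bsub>C i\<^esub> Y i)) (cR (cl X) (cl Y))"
      using P unfolding P_def VX by (rule conjunct1)
    fix x y assume x: "\<And>i. x i \<in> carrier (W i (X i))" and y: "\<And>i. y i \<in> carrier (W i (Y i))"
    \<comment> \<open>The entries of \<open>x\<close> lie in the fibres of \<open>X'\<close> only
      almost everywhere; they are repaired before the formula in \<open>P\<close> is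
      applied.\<close>
    have "\<forall>\<^sub>F i in U. x i \<in> carrier (W i (X' i))" using eqX(1) by eventually_elim (simp add: x)
    then have "cl x \<in> uprod U (\<lambda>i. carrier (W i (X' i)))" by simp
    then obtain x' where x': "cl x = cl x'" "\<forall>i. x' i \<in> carrier (W i (X' i))" using X'(1) by (rule VRE)
    have "\<forall>\<^sub>F i in U. y i \<in> carrier (W i (Y' i))" using eqX(2) by eventually_elim (simp add: y)
    then have "cl y \<in> uprod U (\<lambda>i. carrier (W i (Y' i)))" by simp
    then obtain y' where y': "cl y = cl y'" "\<forall>i. y' i \<in> carrier (W i (Y' i))" using X'(2) by (rule VRE)
    have "cR (cl X) (cl Y) (pure_tensor ?K (V X') (V Y') (cl x') (cl y'))
        = cl (\<lambda>i. c i (X' i) (Y' i) (?p i (X' i) (Y' i) (x' i) (y' i)))"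
      using P x'(2) y'(2) unfolding P_def by blast
    also have "\<dots> = cl (\<lambda>i. c i (X i) (Y i) (?p i (X i) (Y i) (x i) (y i)))"
      using x'(1) y'(1) eqX unfolding uclass_eq_iff by eventually_elim simp
    finally show "cR (cl X) (cl Y) (pure_tensor ?K (V X) (V Y) (cl x) (cl y))
        = cl (\<lambda>i. c i (X i) (Y i) (?p i (X i) (Y i) (x i) (y i)))"
      unfolding VX x'(1) y'(1) .
  qed
  \<comment> \<open>Products of vectors lie in the fibre of the tensor product at every index, which
    allows the formula for \<open>cR\<close> to be applied twice in the associativity
    diagram.\<close>
  have tpc: "c i X Y (?p i X Y x y) \<in> carrier (W i (X \<otimes>\<^sub>o\<^bsub>C i\<^esub> Y))"
    if "X \<in> Obj (C i)" "Y \<in> Obj (C i)" "x \<in> carrier (W i X)" "y \<in> carrier (W i Y)" for i X Y x y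
  proof -
    interpret neutral_tannakian_tensor "C i" "W i" "w i" "c i" "u i"
      using neutral cu by (simp add: neutral_tannakian_tensor_def)
    show ?thesis using that by (rule tp_closed)
  qed
  have one: "u i \<one>\<^bsub>End_ring (C i)\<^esub> \<in> carrier (W i (UnitObj (C i)))" for i
  proof -
    interpret neutral_tannakian_tensor "C i" "W i" "w i" "c i" "u i"
      using neutral cu by (simp add: neutral_tannakian_tensor_def)
    show ?thesis by (rule one_closed)
  qed
  have VRV: "VR (cl X) = V X" for X by (simp add: V_def)
  have rep: "\<exists>x. v = cl x \<and> (\<forall>i. x i \<in> carrier (W i (X i)))" if "good X" "v \<in> carrier (V X)" for X v
    using that by (auto simp: V_def elim: VRE)
  have "tensor_structure R VR wR cR (ulift1 U u)"
  proof (rule tensor_structure.intro[OF vec_functor_R], rule tensor_structure_axioms.intro)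
    fix A B assume "A \<in> Obj R" "B \<in> Obj R"
    then obtain X Y where X: "good X" "A = cl X" "good Y" "B = cl Y" by (metis ObjE)
    show "linear_iso (End_ring R) (tensor_module (End_ring R) (VR A) (VR B)) (VR (A \<otimes>\<^sub>o\<^bsub>R\<^esub> B)) (cR A B)"
      using cR(1)[OF X(1,3)] unfolding X End_ring_R R_simps VRV .
    fix v z assume "v \<in> carrier (VR A)" "z \<in> carrier (VR B)"
    then obtain x y where x: "v = cl x" "\<forall>i. x i \<in> carrier (W i (X i))"
      and y: "z = cl y" "\<forall>i. y i \<in> carrier (W i (Y i))" using rep X unfolding X VRV by meson
    have "w i (Comm (C i) (X i) (Y i)) (c i (X i) (Y i) (?p i (X i) (Y i) (x i) (y i)))
        = c i (Y i) (X i) (?p i (Y i) (X i) (y i) (x i))" for i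
      using X x y by (intro tensor_structure.tensor_comm[OF cu]) auto
    then show "wR (Comm R A B) (cR A B (pure_tensor (End_ring R) (VR A) (VR B) v z))
        = cR B A (pure_tensor (End_ring R) (VR B) (VR A) z v)"
      unfolding X x(1) y(1) End_ring_R VRV using X x y by (simp add: cR(2))
  next
    fix A A' B B' a b v z
    assume "A \<in> Obj R" "A' \<in> Obj R" "B \<in> Obj R" "B' \<in> Obj R" "a \<in> Hom R A A'" "b \<in> Hom R B B'"
      and vz: "v \<in> carrier (VR A)" "z \<in> carrier (VR B)"
    then obtain X X' Y Y' f g where X: "good X" "A = cl X" "good X'" "A' = cl X'" "good Y" "B = cl Y"
        "good Y'" "B' = cl Y'"
      and f: "a = cl f" "\<forall>i. f i \<in> Hom (C i) (X i) (X' i)" "b = cl g" "\<forall>i. g i \<in> Hom (C i) (Y i) (Y' i)"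
      by (metis ObjE HomE goodD)
    obtain x y where x: "v = cl x" "\<forall>i. x i \<in> carrier (W i (X i))"
      and y: "z = cl y" "\<forall>i. y i \<in> carrier (W i (Y i))" using rep X vz unfolding X VRV by meson
    have fx: "w i (f i) (x i) \<in> carrier (W i (X' i))" "w i (g i) (y i) \<in> carrier (W i (Y' i))" for i
      using X f x y T.w_closed goodD by meson+
    have "w i (f i \<otimes>\<^sub>m\<^bsub>C i\<^esub> g i) (c i (X i) (Y i) (?p i (X i) (Y i) (x i) (y i)))
        = c i (X' i) (Y' i) (?p i (X' i) (Y' i) (w i (f i) (x i)) (w i (g i) (y i)))" for i
      using X f x y by (intro tensor_structure.tensor_natural[OF cu]) auto
    then show "wR (a \<otimes>\<^sub>m\<^bsub>R\<^esub> b) (cR A B (pure_tensor (End_ring R) (VR A) (VR B) v z))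
        = cR A' B' (pure_tensor (End_ring R) (VR A') (VR B') (wR a v) (wR b z))"
      unfolding X f(1,3) x(1) y(1) End_ring_R VRV using X x y fx by (simp add: cR(2))
  next
    fix A B D v z t
    assume "A \<in> Obj R" "B \<in> Obj R" "D \<in> Obj R"
      and vzt: "v \<in> carrier (VR A)" "z \<in> carrier (VR B)" "t \<in> carrier (VR D)"
    then obtain X Y Z where X: "good X" "A = cl X" "good Y" "B = cl Y" "good Z" "D = cl Z" by (metis ObjE)
    obtain x where x: "v = cl x" "\<forall>i. x i \<in> carrier (W i (X i))" using rep X(1) vzt unfolding X VRV by meson
    obtain y where y: "z = cl y" "\<forall>i. y i \<in> carrier (W i (Y i))" using rep X(3) vzt unfolding X VRV by meson
    obtain s where s: "t = cl s" "\<forall>i. s i \<in> carrier (W i (Z i))" using rep X(5) vzt unfolding X VRV by meson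
    have "w i (Assoc (C i) (X i) (Y i) (Z i)) (c i (X i) (Y i \<otimes>\<^sub>o\<^bsub>C i\<^esub> Z i)
          (?p i (X i) (Y i \<otimes>\<^sub>o\<^bsub>C i\<^esub> Z i) (x i) (c i (Y i) (Z i) (?p i (Y i) (Z i) (y i) (s i)))))
        = c i (X i \<otimes>\<^sub>o\<^bsub>C i\<^esub> Y i) (Z i) (?p i (X i \<otimes>\<^sub>o\<^bsub>C i\<^esub> Y i) (Z i)
          (c i (X i) (Y i) (?p i (X i) (Y i) (x i) (y i))) (s i))" for i
      using X x y s by (intro tensor_structure.tensor_assoc[OF cu]) auto
    then show "wR (Assoc R A B D) (cR A (B \<otimes>\<^sub>o\<^bsub>R\<^esub> D) (pure_tensor (End_ring R) (VR A) (VR (B \<otimes>\<^sub>o\<^bsub>R\<^esub> D)) v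
          (cR B D (pure_tensor (End_ring R) (VR B) (VR D) z t))))
        = cR (A \<otimes>\<^sub>o\<^bsub>R\<^esub> B) D (pure_tensor (End_ring R) (VR (A \<otimes>\<^sub>o\<^bsub>R\<^esub> B)) (VR D)
          (cR A B (pure_tensor (End_ring R) (VR A) (VR B) v z)) t)"
      unfolding X x(1) y(1) s(1) End_ring_R R_simps VRV using X x y s tpc by (simp add: cR(2))
  next
    have "linear_iso ?K (vec_ultraproduct U (\<lambda>i. regular_module (End_ring (C i))))
        (vec_ultraproduct U (\<lambda>i. W i (UnitObj (C i)))) (ulift1 U u)"
      by (rule linear_iso_ultraproduct[OF ultra tensor_structure.unit_iso[OF cu]]) (simp add: ulift1_uclass)
    then show "linear_iso (End_ring R) (regular_module (End_ring R)) (VR (UnitObj R)) (ulift1 U u)"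
      unfolding End_ring_R R_simps VR_cl
      by (rule linear_iso_regular_module)
        (simp_all add: regular_module_def vec_ultraproduct_def ring_ultraproduct_def)
  next
    fix A v assume "A \<in> Obj R" and v: "v \<in> carrier (VR A)"
    then obtain X where X: "good X" "A = cl X" by (metis ObjE)
    obtain x where x: "v = cl x" "\<forall>i. x i \<in> carrier (W i (X i))" using rep X(1) v unfolding X VRV by meson
    have "w i (UnitIso (C i) (X i)) (x i)
        = c i (UnitObj (C i)) (X i) (?p i (UnitObj (C i)) (X i) (u i \<one>\<^bsub>End_ring (C i)\<^esub>) (x i))" for i
      using X x by (intro tensor_structure.tensor_unit[OF cu]) auto
    then show "wR (UnitIso R A) v = cR (UnitObj R) A
        (pure_tensor (End_ring R) (VR (UnitObj R)) (VR A) (ulift1 U u \<one>\<^bsub>End_ring R\<^esub>) v)"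
      unfolding X x(1) End_ring_R R_simps VRV using X x one by (simp add: cR(2) ulift1_uclass)
  qed
  then show ?thesis by blast
qed

lemma fibre_functor_R: "fibre_functor R VR wR"
proof (rule fibre_functor.intro[OF vec_functor_R], rule fibre_functor_axioms.intro)
  show "\<exists>c u. tensor_structure R VR wR c u" by (rule tensor_structure_R)
next
  fix A B a b v
  assume "A \<in> Obj R" "B \<in> Obj R" "a \<in> Hom R A B" "b \<in> Hom R A B" and v: "v \<in> carrier (VR A)"
  then obtain X Y f g where X: "good X" "A = cl X" "good Y" "B = cl Y"
    and f: "a = cl f" "\<forall>i. f i \<in> Hom (C i) (X i) (Y i)" "b = cl g" "\<forall>i. g i \<in> Hom (C i) (X i) (Y i)"
    by (metis ObjE HomE goodD)
  obtain x where x: "v = cl x" "\<forall>i. x i \<in> carrier (W i (X i))" using v X by (auto elim: VRE)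
  have "w i (f i \<boxplus>\<^bsub>C i\<^esub> g i) (x i) = w i (f i) (x i) \<oplus>\<^bsub>W i (Y i)\<^esub> w i (g i) (x i)" for i
    using X f x by (intro T.map_Add) auto
  then show "wR (a \<boxplus>\<^bsub>R\<^esub> b) v = wR a v \<oplus>\<^bsub>VR B\<^esub> wR b v" by (simp add: X f x)
next
  fix A B k a v
  assume "A \<in> Obj R" "B \<in> Obj R" and k: "k \<in> carrier (End_ring R)" and "a \<in> Hom R A B" and v: "v \<in> carrier (VR A)"
  then obtain X Y f where X: "good X" "A = cl X" "good Y" "B = cl Y"
    and f: "a = cl f" "\<forall>i. f i \<in> Hom (C i) (X i) (Y i)" by (metis ObjE HomE goodD)
  obtain x where x: "v = cl x" "\<forall>i. x i \<in> carrier (W i (X i))" using v X by (auto elim: VRE)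
  have "carrier (End_ring (C i)) \<noteq> {}" for i
    using T.Id_closed[OF T.UnitObj_closed] by (auto simp: End_ring_def)
  then obtain l where l: "k = cl l" "\<forall>i. l i \<in> carrier (End_ring (C i))"
    using uprod_rep[of k U "\<lambda>i. carrier (End_ring (C i))"] k by (auto simp: End_ring_R)
  have "w i (scale_arr (C i) (X i) (Y i) (l i) (f i)) (x i) = l i \<odot>\<^bsub>W i (Y i)\<^esub> w i (f i) (x i)" for i
    using X f x l by (intro T.map_scale) auto
  then show "wR (scale_arr R A B k a) v = k \<odot>\<^bsub>VR B\<^esub> wR a v" by (simp add: X f x l scale_arr_R)
next
  fix A B D a b
  assume "A \<in> Obj R" "B \<in> Obj R" "D \<in> Obj R" and se: "short_exact R A B D a b"
  moreover from se have "a \<in> Hom R A B" "b \<in> Hom R B D"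
    by (auto simp: short_exact_def is_kernel_def)
  ultimately obtain X Y Z f g where X: "good X" "A = cl X" "good Y" "B = cl Y" "good Z" "D = cl Z"
    and f: "a = cl f" "\<forall>i. f i \<in> Hom (C i) (X i) (Y i)" "b = cl g" "\<forall>i. g i \<in> Hom (C i) (Y i) (Z i)"
    by (metis ObjE HomE goodD)
  have exact: "\<forall>\<^sub>F i in U. inj_on (w i (f i)) (carrier (W i (X i))) \<and>
      w i (f i) ` carrier (W i (X i)) = {v \<in> carrier (W i (Y i)). w i (g i) v = \<zero>\<^bsub>W i (Z i)\<^esub>} \<and>
      w i (g i) ` carrier (W i (Y i)) = carrier (W i (Z i))"
    using short_exact_R[OF X(1,3,5) se[unfolded X f(1,3)]]
  proof eventually_elim
    case (elim i)
    then show ?case using X by (intro T.exact) auto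
  qed
  have "inj_on (wR a) (carrier (VR A))"
  proof (rule inj_onI)
    fix v z assume "v \<in> carrier (VR A)" "z \<in> carrier (VR A)" and eq: "wR a v = wR a z"
    then obtain x y where x: "v = cl x" "\<forall>i. x i \<in> carrier (W i (X i))" "z = cl y" "\<forall>i. y i \<in> carrier (W i (X i))"
      using X by (auto elim!: VRE)
    have "\<forall>\<^sub>F i in U. w i (f i) (x i) = w i (f i) (y i)" using eq by (simp add: f x uclass_eq_iff)
    with exact have "\<forall>\<^sub>F i in U. x i = y i"
      by eventually_elim (use x in \<open>auto simp: inj_on_def\<close>)
    then show "v = z" by (simp add: x uclass_eq_iff)
  qed
  moreover have "wR a ` carrier (VR A) = {v \<in> carrier (VR B). wR b v = \<zero>\<^bsub>VR D\<^esub>}"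
  proof (intro equalityI subsetI)
    fix z assume "z \<in> wR a ` carrier (VR A)"
    then obtain x where x: "z = wR a (cl x)" "\<forall>i. x i \<in> carrier (W i (X i))" using X by (auto elim!: VRE)
    from exact have "\<forall>\<^sub>F i in U. w i (f i) (x i) \<in> carrier (W i (Y i)) \<and> w i (g i) (w i (f i) (x i)) = \<zero>\<^bsub>W i (Z i)\<^esub>"
      by eventually_elim (use x in blast)
    then show "z \<in> {v \<in> carrier (VR B). wR b v = \<zero>\<^bsub>VR D\<^esub>}"
      by (simp add: x(1) f X uclass_eq_iff eventually_conj_iff)
  next
    fix z assume z: "z \<in> {v \<in> carrier (VR B). wR b v = \<zero>\<^bsub>VR D\<^esub>}"
    then obtain y where y: "z = cl y" "\<forall>i. y i \<in> carrier (W i (Y i))" using X by (auto elim!: VRE)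
    have "\<forall>\<^sub>F i in U. w i (g i) (y i) = \<zero>\<^bsub>W i (Z i)\<^esub>" using z by (simp add: y f X uclass_eq_iff)
    \<comment> \<open>Preimages exist in almost every component; choosing one at each such index
      gives a class that maps to \<open>z\<close>.\<close>
    with exact have "\<forall>\<^sub>F i in U. \<exists>x. x \<in> carrier (W i (X i)) \<and> w i (f i) x = y i"
    proof eventually_elim
      case (elim i)
      then have "y i \<in> w i (f i) ` carrier (W i (X i))" using y by simp
      then show ?case by (elim imageE) (rule exI, rule conjI, assumption, erule sym)
    qed
    then obtain x where x: "\<forall>\<^sub>F i in U. x i \<in> carrier (W i (X i)) \<and> w i (f i) (x i) = y i"
      unfolding eventually_ex by blast
    then have "z = wR a (cl x)" "cl x \<in> carrier (VR A)"
      by (auto simp: y f X uclass_eq_iff elim: eventually_mono)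
    then show "z \<in> wR a ` carrier (VR A)" by blast
  qed
  moreover have "wR b ` carrier (VR B) = carrier (VR D)"
  proof (intro equalityI subsetI)
    fix z assume "z \<in> wR b ` carrier (VR B)"
    then obtain y where y: "z = wR b (cl y)" "\<forall>i. y i \<in> carrier (W i (Y i))" using X by (auto elim!: VRE)
    from exact have "\<forall>\<^sub>F i in U. w i (g i) (y i) \<in> carrier (W i (Z i))" by eventually_elim (use y in blast)
    then show "z \<in> carrier (VR D)" by (simp add: y(1) f X)
  next
    fix z assume "z \<in> carrier (VR D)"
    then obtain t where t: "z = cl t" "\<forall>i. t i \<in> carrier (W i (Z i))" using X by (auto elim!: VRE)
    from exact have "\<forall>\<^sub>F i in U. \<exists>y. y \<in> carrier (W i (Y i)) \<and> w i (g i) y = t i"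
    proof eventually_elim
      case (elim i)
      then have "t i \<in> w i (g i) ` carrier (W i (Y i))" using t by simp
      then show ?case by (elim imageE) (rule exI, rule conjI, assumption, erule sym)
    qed
    then obtain y where y: "\<forall>\<^sub>F i in U. y i \<in> carrier (W i (Y i)) \<and> w i (g i) (y i) = t i"
      unfolding eventually_ex by blast
    then have "z = wR b (cl y)" "cl y \<in> carrier (VR B)"
      by (auto simp: t f X uclass_eq_iff elim: eventually_mono)
    then show "z \<in> wR b ` carrier (VR B)" by blast
  qed
  ultimately show "inj_on (wR a) (carrier (VR A)) \<and>
      wR a ` carrier (VR A) = {v \<in> carrier (VR B). wR b v = \<zero>\<^bsub>VR D\<^esub>} \<and>
      wR b ` carrier (VR B) = carrier (VR D)" by blast
next
  fix A B a b
  assume "A \<in> Obj R" "B \<in> Obj R" "a \<in> Hom R A B" "b \<in> Hom R A B"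
    and eq: "\<And>v. v \<in> carrier (VR A) \<Longrightarrow> wR a v = wR b v"
  then obtain X Y f g where X: "good X" "A = cl X" "good Y" "B = cl Y"
    and f: "a = cl f" "\<forall>i. f i \<in> Hom (C i) (X i) (Y i)" "b = cl g" "\<forall>i. g i \<in> Hom (C i) (X i) (Y i)"
    by (metis ObjE HomE goodD)
  \<comment> \<open>Where \<open>f i\<close> and \<open>g i\<close> differ, faithfulness in
    \<open>C i\<close> supplies a vector that separates them; elsewhere zero serves. The class of
    these vectors alone detects whether \<open>a\<close> and \<open>b\<close> agree.\<close>
  have "\<exists>x. x \<in> carrier (W i (X i)) \<and> (w i (f i) x = w i (g i) x \<longrightarrow> f i = g i)" for i
  proof (cases "f i = g i")
    case True
    then show ?thesis using vectorspace_zero_closed(1)[OF T.obj_vectorspace[of "X i" i]] X by auto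
  next
    case False
    then show ?thesis using T.faithful[of "X i" i "Y i" "f i" "g i"] X f by auto
  qed
  then obtain x where x: "\<And>i. x i \<in> carrier (W i (X i))" "\<And>i. w i (f i) (x i) = w i (g i) (x i) \<Longrightarrow> f i = g i"
    by metis
  have "wR a (cl x) = wR b (cl x)" using x(1) by (intro eq) (simp add: X)
  then have "\<forall>\<^sub>F i in U. w i (f i) (x i) = w i (g i) (x i)" by (simp add: f uclass_eq_iff)
  then have "\<forall>\<^sub>F i in U. f i = g i" by eventually_elim (rule x(2))
  then show "a = b" by (simp add: f uclass_eq_iff)
qed

end

theorem theorem1p2p1:
  fixes U :: "'i filter"
    and C :: "'i \<Rightarrow> ('o, 'm) tensor_cat"
    and W :: "'i \<Rightarrow> 'o \<Rightarrow> ('m, 'v) module"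
    and w :: "'i \<Rightarrow> 'm \<Rightarrow> 'v \<Rightarrow> 'v"
  assumes "nonprincipal_ultrafilter U"
    and "\<And>i. neutral_tannakian_category (C i) (W i) (w i)"
  shows "tannakian_category (restricted_ultraproduct U C W) \<and>
    End_ring (restricted_ultraproduct U C W) = ring_ultraproduct U (\<lambda>i. End_ring (C i)) \<and>
    fibre_functor (restricted_ultraproduct U C W) (ultra_obj U W) (ultra_arr U w)"
proof -
  interpret tannakian_family U C W w
    using assms by (simp add: tannakian_family_def neutral_tannakian_def neutral_tannakian_category_def)
  show ?thesis using tannakian_category_R End_ring_R fibre_functor_R by blast
qed

end
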